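(* Let $A$, $\mathcal H$, $\mathcal H_+$, $\mathrm T=[\Gamma_0,\Gamma_1]^\top$, $J$, $\omega$, $Q_t$, $\mathcal A_t$ and $t_0\in[0,1]$ be as in the context, let $\lambda$ be an isolated eigenvalue of $\mathcal A_{t_0}$ of finite multiplicity $m\in\mathbb N$, and let $P_t$, $S_{t_0}$, $U_t$, $W_t=P_{t_0}U_t^{-1}\mathcal A_tU_tP_{t_0}$, $\dot W_{t_0}$, $\ddot W_{t_0}$ be as defined in the context. Suppose that $\dot W_{t_0}$, considered as an operator in $\operatorname{ran}(P_{t_0})$, has $m'\le m$ distinct eigenvalues $\mu_1,\dots,\mu_{m'}$, and denote by $P^{(i)}_{t_0}$ the eigenprojection of $\dot W_{t_0}$ in $\operatorname{ran}(P_{t_0})$ corresponding to $\mu_i$, $1\le i\le m'$. For each $i\le m'$ suppose that $P^{(i)}_{t_0}\ddot W_{t_0}P^{(i)}_{t_0}$, considered as an operator in $\operatorname{ran}(P^{(i)}_{t_0})$, has $m_i'\le m$ distinct eigenvalues $\nu_{i,1},\dots,\nu_{i,m_i'}$. Then for $t$ near $t_0$ there is a labeling $\lambda_{i,k}(t)$ of the eigenvalue curves of the operator $\mathcal A_tP_t$ (restricted to $\operatorname{ran}(P_t)$) or, equivalently, of $W_t$, such that, as $t\to t_0$, $$\lambda_{i,k}(t)=\lambda+\mu_i(t-t_0)+\tfrac12\nu_{i,k}(t-t_0)^2+o((t-t_0)^2),\quad k=1,\dots,m_i',\ i=1,\dots,m'.$$ Moreover, there is an orthonormal set of eigenvectors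 $u_{i,k}$ of the operators $P^{(i)}_{t_0}\ddot W_{t_0}P^{(i)}_{t_0}$ (and therefore of the operators $\dot W_{t_0}$, $W_{t_0}$ and $\mathcal A_{t_0}$), $$\{u_{i,k}\in\operatorname{ran}(P^{(i)}_{t_0}):\ k=1,\dots,m_i',\ i=1,\dots,m'\}\subset\operatorname{ran}(P_{t_0}),$$ such that, for $k=1,\dots,m_i'$, $i=1,\dots,m'$, $$\begin{aligned}\lambda_{i,k}(t)=\lambda&+\omega(\dot Q_{t_0}\mathrm Tu_{i,k},\mathrm Tu_{i,k})(t-t_0)\\&+\tfrac12\Big(\omega(\ddot Q_{t_0}\mathrm Tu_{i,k},\mathrm Tu_{i,k})-2\big\langle\mathrm T(\mathrm TS_{t_0})^*\dot Q_{t_0}J\mathrm TP_{t_0}u_{i,k},\ \dot Q_{t_0}J\mathrm TP_{t_0}u_{i,k}\big\rangle_{\mathfrak H\times\mathfrak H}\Big)(t-t_0)^2+o((t-t_0)^2).\end{aligned}$$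
   Context: Inner products are linear in the first argument. $\mathcal H$, $\mathfrak H$ are complex Hilbert spaces. $A$ is a densely defined symmetric operator in $\mathcal H$ with equal (possibly infinite) deficiency indices. $\mathcal H_+:=\operatorname{dom}(A^* )$ is equipped with the graph scalar product $\langle u,v\rangle_{\mathcal H_+}=\langle u,v\rangle_{\mathcal H}+\langle A^*u,A^*v\rangle_{\mathcal H}$. Boundary triplet: $\mathrm T:=[\Gamma_0,\Gamma_1]^\top\in\mathcal B(\mathcal H_+,\mathfrak H\times\mathfrak H)$ is bounded, surjective, and satisfies $\langle A^*u,v\rangle_{\mathcal H}-\langle u,A^*v\rangle_{\mathcal H}=\langle\Gamma_1u,\Gamma_0v\rangle_{\mathfrak H}-\langle\Gamma_0u,\Gamma_1v\rangle_{\mathfrak H}$ for all $u,v\in\mathcal H_+$. Symplectic form on $\mathfrak H\times\mathfrak H$: $\omega((f_1,f_2)^\top,(g_1,g_2)^\top)=\langle f_2,g_1\rangle_{\mathfrak H}-\langle f_1,g_2\rangle_{\mathfrak H}=\langle J(f_1,f_2)^\top,(g_1,g_2)^\top\rangle_{\mathfrak H\times\mathfrak H}$, with $J=\begin{bmatrix}0&I_{\mathfrak H}\\-I_{\mathfrak H}&0\end{bmatrix}$. A subspace $\mathcal F\subset\mathfrak H\times\mathfrak H$ is Lagrangian if it equals its $\omega$-annihilator $\{f:\omega(f,g)=0\ \forall g\in\mathcal F\}$. For every Lagrangian $\mathcal F$, the restriction of $A^*$ to $\mathrm T^{-1}(\mathcal F)$ is a self-adjoint extension of $A$, and all self-adjoint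 extensions arise this way. Family: for $t\in[0,1]$, $Q_t\in\mathcal B(\mathfrak H\times\mathfrak H)$ is an orthogonal projection whose range is Lagrangian; $t_0\in[0,1]$ is fixed and, as $t\to t_0$ (in $[0,1]$), $Q_t=Q_{t_0}+\dot Q_{t_0}(t-t_0)+\frac12\ddot Q_{t_0}(t-t_0)^2+o((t-t_0)^2)$ in $\mathcal B(\mathfrak H\times\mathfrak H)$ with $\dot Q_{t_0},\ddot Q_{t_0}\in\mathcal B(\mathfrak H\times\mathfrak H)$. $\mathcal A_t$ is the self-adjoint extension of $A$ with $\mathrm T(\operatorname{dom}(\mathcal A_t))=\operatorname{ran}(Q_t)$, and $R_t(\zeta):=(\mathcal A_t-\zeta)^{-1}$ for $\zeta\notin\operatorname{Spec}(\mathcal A_t)$. Spectral objects: $\gamma:=\{z\in\mathbb C:2|z-\lambda|=\operatorname{dist}(\lambda,\operatorname{Spec}(\mathcal A_{t_0})\setminus\{\lambda\})\}$, oriented counterclockwise. For $t$ sufficiently close to $t_0$, $\gamma\cap\operatorname{Spec}(\mathcal A_t)=\emptyset$ and $\gamma$ encloses $m$ eigenvalues (counted with multiplicity) of $\mathcal A_t$, the $\lambda$-group; $P_t:=\frac{-1}{2\pi\mathbf i}\int_\gamma R_t(\zeta)\,d\zeta$ is the Riesz projection. The reduced resolvent is $S_{t_0}:=\frac{-1}{2\pi\mathbf i}\int_\gamma(\lambda-\zeta)^{-1}R_{t_0}(\zeta)\,d\zeta=\lim_{\zeta\to\lambda}R_{t_0}(\zeta)(I_{\mathcal H}-P_{t_0})$.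 Transformation operators: with $D_t:=P_t-P_{t_0}$ (which tends to $0$ in norm as $t\to t_0$), $U_t:=(I-D_t^2)^{-1/2}\big((I-P_t)(I-P_{t_0})+P_tP_{t_0}\big)$ with inverse $U_t^{-1}=\big((I-P_{t_0})(I-P_t)+P_{t_0}P_t\big)(I-D_t^2)^{-1/2}$, for $t$ near $t_0$; $U_t$ maps $\operatorname{ran}(P_{t_0})$ unitarily onto $\operatorname{ran}(P_t)$ and $U_tP_{t_0}=P_tU_t$. The operator $W_t=P_{t_0}U_t^{-1}\mathcal A_tU_tP_{t_0}$ is identified with its restriction to the $m$-dimensional space $\operatorname{ran}(P_{t_0})$, and $\operatorname{Spec}(W_t)=\operatorname{Spec}(\mathcal A_tP_t|_{\operatorname{ran}(P_t)})$. Further, $W_{t_0}=\lambda P_{t_0}$ and $\dot W_{t_0}:=(\mathrm TP_{t_0})^*J\dot Q_{t_0}\mathrm TP_{t_0}$, $\ddot W_{t_0}:=(\mathrm TP_{t_0})^*J\ddot Q_{t_0}\mathrm TP_{t_0}-2\big(\mathrm T(\mathrm TS_{t_0})^*\dot Q_{t_0}J\mathrm TP_{t_0}\big)^*\dot Q_{t_0}J\mathrm TP_{t_0}$; these are the coefficients in the expansion $W_t=W_{t_0}+\dot W_{t_0}(t-t_0)+\frac12\ddot W_{t_0}(t-t_0)^2+o((t-t_0)^2)$. The operators $P_{t_0},S_{t_0}$ belong to $\mathcal B(\mathcal H,\mathcal H_+)$, so $\mathrm TP_{t_0},\mathrm TS_{t_0}\in\mathcal B(\mathcal H,\mathfrak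 H\times\mathfrak H)$, and $(\cdot)^*$ denotes the adjoint of such operators, an element of $\mathcal B(\mathfrak H\times\mathfrak H,\mathcal H)$. The operator $(\mathrm TS_{t_0})^*\dot Q_{t_0}J\mathrm TP_{t_0}$ maps $\mathcal H$ boundedly into $\mathcal H_+$, so applying $\mathrm T$ to it is meaningful. A "labeling of eigenvalue curves" means functions $t\mapsto\lambda_{i,k}(t)$, defined for $t$ near $t_0$, with $\lambda_{i,k}(t)\in\operatorname{Spec}(W_t)$. *)

theory Defs
  imports "HOL-Complex_Analysis.Complex_Analysis" "HOL-Library.Landau_Symbols"
begin

section \<open>Complex Hilbert spaces\<close>

text \<open>
  The complex inner product is linear in its first argument.  Building the class on \<^class>\<open>real_inner\<close>,
  with the real inner product equal to the real part of the complex one, makes the library norm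
  and topology those of the complex inner product.
\<close>

class complex_inner = real_inner +
  fixes scaleC :: "complex \<Rightarrow> 'a \<Rightarrow> 'a" (infixr "*\<^sub>C" 75)
    and cinner :: "'a \<Rightarrow> 'a \<Rightarrow> complex" ("(\<langle>_,/ _\<rangle>)")
  assumes scaleC_add_right: "a *\<^sub>C (x + y) = a *\<^sub>C x + a *\<^sub>C y"
    and scaleC_add_left: "(a + b) *\<^sub>C x = a *\<^sub>C x + b *\<^sub>C x"
    and scaleC_scaleC: "a *\<^sub>C (b *\<^sub>C x) = (a * b) *\<^sub>C x"
    and scaleC_one: "1 *\<^sub>C x = x"
    and scaleR_scaleC: "r *\<^sub>R x = complex_of_real r *\<^sub>C x"
    and cinner_commute: "\<langle>x, y\<rangle> = cnj \<langle>y, x\<rangle>"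
    and cinner_add_left: "\<langle>x + y, z\<rangle> = \<langle>x, z\<rangle> + \<langle>y, z\<rangle>"
    and cinner_scaleC_left: "\<langle>a *\<^sub>C x, y\<rangle> = a * \<langle>x, y\<rangle>"
    and inner_eq_Re_cinner: "x \<bullet> y = Re \<langle>x, y\<rangle>"

class chilbert_space = complex_inner + banach

instantiation prod :: (complex_inner, complex_inner) complex_inner
begin

definition scaleC_prod :: "complex \<Rightarrow> 'a \<times> 'b \<Rightarrow> 'a \<times> 'b"
  where "scaleC_prod c p = (c *\<^sub>C fst p, c *\<^sub>C snd p)"

definition cinner_prod :: "'a \<times> 'b \<Rightarrow> 'a \<times> 'b \<Rightarrow> complex"
  where "cinner_prod p q = \<langle>fst p, fst q\<rangle> + \<langle>snd p, snd q\<rangle>"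

instance
proof
  fix x y :: "'a \<times> 'b"
  show "\<langle>x, y\<rangle> = cnj \<langle>y, x\<rangle>"
    unfolding cinner_prod_def complex_cnj_add
    by (metis cinner_commute)
qed (auto simp: scaleC_prod_def cinner_prod_def scaleC_add_right scaleC_add_left scaleC_scaleC
      scaleC_one scaleR_scaleC cinner_add_left cinner_scaleC_left inner_eq_Re_cinner
      inner_prod_def scaleR_prod_def algebra_simps prod_eq_iff)

end

instance prod :: (chilbert_space, chilbert_space) chilbert_space ..

global_interpretation complex_vector: vector_space "scaleC :: complex \<Rightarrow> 'a \<Rightarrow> 'a::complex_inner"
  by unfold_locales (simp_all add: scaleC_add_right scaleC_add_left scaleC_scaleC scaleC_one)

lemma norm_scaleC: "norm (c *\<^sub>C x) = cmod c * norm x" for x :: "'a::complex_inner"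
proof -
  have "\<langle>c *\<^sub>C x, c *\<^sub>C x\<rangle> = (c * cnj c) * \<langle>x, x\<rangle>"
    by (metis cinner_commute cinner_scaleC_left complex_cnj_mult mult.assoc)
  also have "\<dots> = complex_of_real ((cmod c)\<^sup>2) * \<langle>x, x\<rangle>"
    by (simp only: complex_norm_square)
  finally have "(norm (c *\<^sub>C x))\<^sup>2 = Re (complex_of_real ((cmod c)\<^sup>2) * \<langle>x, x\<rangle>)"
    by (simp only: power2_norm_eq_inner inner_eq_Re_cinner)
  also have "\<dots> = (cmod c)\<^sup>2 * (norm x)\<^sup>2"
    by (simp only: power2_norm_eq_inner[of x] inner_eq_Re_cinner) simp
  also have "\<dots> = (cmod c * norm x)\<^sup>2"
    by (simp only: power_mult_distrib)
  finally show ?thesis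
    by (simp add: power2_eq_iff_nonneg)
qed

abbreviation clinear :: "('a::complex_inner \<Rightarrow> 'b::complex_inner) \<Rightarrow> bool"
  where "clinear \<equiv> Vector_Spaces.linear scaleC scaleC"

definition cortho_basis :: "'a::complex_inner set \<Rightarrow> 'a set \<Rightarrow> bool"
  where "cortho_basis B V \<longleftrightarrow> B \<subseteq> V \<and>
    (\<forall>x\<in>B. \<forall>y\<in>B. \<langle>x, y\<rangle> = (if x = y then 1 else 0)) \<and> V \<subseteq> closure (complex_vector.span B)"

definition cadjoint :: "('a::complex_inner \<Rightarrow> 'b::complex_inner) \<Rightarrow> 'b \<Rightarrow> 'a"
  where "cadjoint F = (THE G. \<forall>x y. \<langle>F x, y\<rangle> = \<langle>x, G y\<rangle>)"

definition is_orthogonal_projection :: "('a::complex_inner \<Rightarrow>\<^sub>L 'a) \<Rightarrow> bool"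
  where "is_orthogonal_projection Q \<longleftrightarrow> clinear (blinfun_apply Q) \<and> Q o\<^sub>L Q = Q \<and>
    (\<forall>x y. \<langle>blinfun_apply Q x, y\<rangle> = \<langle>x, blinfun_apply Q y\<rangle>)"

definition orthogonal_projection_onto :: "'a::complex_inner set \<Rightarrow> 'a \<Rightarrow> 'a"
  where "orthogonal_projection_onto V x = (THE p. p \<in> V \<and> (\<forall>v\<in>V. \<langle>x - p, v\<rangle> = 0))"

section \<open>Unbounded operators\<close>

text \<open>
  An unbounded operator is represented by its graph, so that extension is inclusion and
  \<^term>\<open>Domain A\<close> is the domain of \<^term>\<open>A\<close>.
\<close>

type_synonym 'a uop = "('a \<times> 'a) set"

definition uapply :: "'a uop \<Rightarrow> 'a \<Rightarrow> 'a"
  where "uapply A u = (THE v. (u, v) \<in> A)"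

definition linear_uop :: "'a::complex_inner uop \<Rightarrow> bool"
  where "linear_uop A \<longleftrightarrow> complex_vector.subspace A \<and> single_valued A"

definition densely_defined :: "'a::complex_inner uop \<Rightarrow> bool"
  where "densely_defined A \<longleftrightarrow> closure (Domain A) = UNIV"

definition uadjoint :: "'a::complex_inner uop \<Rightarrow> 'a uop"
  where "uadjoint A = {(v, w). \<forall>(x, y)\<in>A. \<langle>y, v\<rangle> = \<langle>x, w\<rangle>}"

definition symmetric_uop :: "'a::complex_inner uop \<Rightarrow> bool"
  where "symmetric_uop A \<longleftrightarrow> (\<forall>u\<in>Domain A. \<forall>v\<in>Domain A. \<langle>uapply A u, v\<rangle> = \<langle>u, uapply A v\<rangle>)"

definition self_adjoint_uop :: "'a::complex_inner uop \<Rightarrow> bool"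
  where "self_adjoint_uop A \<longleftrightarrow> linear_uop A \<and> densely_defined A \<and> uadjoint A = A"

definition eigenspace_uop :: "'a::complex_inner uop \<Rightarrow> complex \<Rightarrow> 'a set"
  where "eigenspace_uop A z = {u. (u, z *\<^sub>C u) \<in> A}"

text \<open>Deficiency indices are Hilbert dimensions, compared as cardinals of orthonormal bases.\<close>

definition equal_deficiency_indices :: "'a::complex_inner uop \<Rightarrow> bool"
  where "equal_deficiency_indices A \<longleftrightarrow> (\<exists>B C f.
    cortho_basis B (eigenspace_uop (uadjoint A) \<i>) \<and>
    cortho_basis C (eigenspace_uop (uadjoint A) (- \<i>)) \<and> bij_betw f B C)"

definition is_resolvent :: "'a::complex_inner uop \<Rightarrow> complex \<Rightarrow> ('a \<Rightarrow>\<^sub>L 'a) \<Rightarrow> bool"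
  where "is_resolvent A z R \<longleftrightarrow>
    (\<forall>h. blinfun_apply R h \<in> Domain A \<and>
         uapply A (blinfun_apply R h) - z *\<^sub>C blinfun_apply R h = h) \<and>
    (\<forall>u\<in>Domain A. blinfun_apply R (uapply A u - z *\<^sub>C u) = u)"

definition Spec :: "'a::complex_inner uop \<Rightarrow> complex set"
  where "Spec A = {z. \<nexists>R. is_resolvent A z R}"

definition resolvent :: "'a::complex_inner uop \<Rightarrow> complex \<Rightarrow> 'a \<Rightarrow>\<^sub>L 'a"
  where "resolvent A z = (THE R. is_resolvent A z R)"

section \<open>Operators considered in a finite-dimensional subspace\<close>

text \<open>In \<open>Spec_in V L\<close> boundedness of the inverse is omitted because \<open>V\<close> is finite-dimensional.\<close>

definition Spec_in :: "'a::complex_inner set \<Rightarrow> ('a \<Rightarrow> 'a) \<Rightarrow> complex set"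
  where "Spec_in V L = {z. \<not> bij_betw (\<lambda>x. L x - z *\<^sub>C x) V V}"

definition eigenspace_in :: "'a::complex_inner set \<Rightarrow> ('a \<Rightarrow> 'a) \<Rightarrow> complex \<Rightarrow> 'a set"
  where "eigenspace_in V L z = {x\<in>V. L x = z *\<^sub>C x}"

definition eigenvalues_in :: "'a::complex_inner set \<Rightarrow> ('a \<Rightarrow> 'a) \<Rightarrow> complex set"
  where "eigenvalues_in V L = {z. \<exists>x\<in>eigenspace_in V L z. x \<noteq> 0}"

text \<open>
  Used for operators that are self-adjoint in \<open>V\<close>: the eigenprojection is the orthogonal
  projection onto the eigenspace, extended by zero to the orthogonal complement of \<open>V\<close>.
\<close>

definition eigenprojection_in :: "'a::complex_inner set \<Rightarrow> ('a \<Rightarrow> 'a) \<Rightarrow> complex \<Rightarrow> 'a \<Rightarrow> 'a"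
  where "eigenprojection_in V L z = orthogonal_projection_onto (eigenspace_in V L z)"

section \<open>Boundary triplets and the symplectic form\<close>

definition boundary_triplet ::
    "'a::complex_inner uop \<Rightarrow> ('a \<Rightarrow> 'b::complex_inner) \<Rightarrow> ('a \<Rightarrow> 'b) \<Rightarrow> bool"
  where "boundary_triplet A \<Gamma>\<^sub>0 \<Gamma>\<^sub>1 \<longleftrightarrow>
    (let A' = uadjoint A; Hp = Domain A'; T = (\<lambda>u. (\<Gamma>\<^sub>0 u, \<Gamma>\<^sub>1 u)) in
      (\<forall>u\<in>Hp. \<forall>v\<in>Hp. T (u + v) = T u + T v) \<and>
      (\<forall>c. \<forall>u\<in>Hp. T (c *\<^sub>C u) = c *\<^sub>C T u) \<and>
      (\<exists>K. \<forall>u\<in>Hp. norm (T u) \<le> K * sqrt ((norm u)\<^sup>2 + (norm (uapply A' u))\<^sup>2)) \<and>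
      T ` Hp = UNIV \<and>
      (\<forall>u\<in>Hp. \<forall>v\<in>Hp. \<langle>uapply A' u, v\<rangle> - \<langle>u, uapply A' v\<rangle> = \<langle>\<Gamma>\<^sub>1 u, \<Gamma>\<^sub>0 v\<rangle> - \<langle>\<Gamma>\<^sub>0 u, \<Gamma>\<^sub>1 v\<rangle>))"

definition sympl :: "'b::complex_inner \<times> 'b \<Rightarrow> 'b \<times> 'b \<Rightarrow> complex"
  where "sympl f g = \<langle>snd f, fst g\<rangle> - \<langle>fst f, snd g\<rangle>"

definition sympl_J :: "'b::complex_inner \<times> 'b \<Rightarrow> 'b \<times> 'b"
  where "sympl_J f = (snd f, - fst f)"

definition lagrangian :: "('b::complex_inner \<times> 'b) set \<Rightarrow> bool"
  where "lagrangian F \<longleftrightarrow> complex_vector.subspace F \<and> F = {f. \<forall>g\<in>F. sympl f g = 0}"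

section \<open>Riesz projections and reduced resolvents\<close>

lift_definition scaleC_blinfun ::
    "complex \<Rightarrow> ('a::real_normed_vector \<Rightarrow>\<^sub>L 'b::complex_inner) \<Rightarrow> 'a \<Rightarrow>\<^sub>L 'b"
  is "\<lambda>c F x. c *\<^sub>C F x"
proof -
  fix c and F :: "'a \<Rightarrow> 'b"
  assume F: "bounded_linear F"
  have "bounded_linear (\<lambda>y::'b. c *\<^sub>C y)"
    by (rule bounded_linear_intro[where K = "cmod c"])
      (auto simp: scaleC_add_right scaleR_scaleC scaleC_scaleC norm_scaleC mult.commute)
  from bounded_linear_compose[OF this F] show "bounded_linear (\<lambda>x. c *\<^sub>C F x)"
    by simp
qed

text \<open>
  The operator-valued counterpart of \<^const>\<open>contour_integral\<close>; the integral is taken with respect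
  to the operator norm.
\<close>

definition blinfun_contour_integral ::
    "(real \<Rightarrow> complex) \<Rightarrow> (complex \<Rightarrow> 'a::complex_inner \<Rightarrow>\<^sub>L 'a) \<Rightarrow> 'a \<Rightarrow>\<^sub>L 'a"
  where "blinfun_contour_integral g F =
    integral {0..1} (\<lambda>s. scaleC_blinfun (vector_derivative g (at s within {0..1})) (F (g s)))"

text \<open>
  If the spectrum is \<open>{\<lambda>}\<close>, the distance to the empty set is infinite and the radius may be
  any positive number; we take 1.  (\<^const>\<open>infdist\<close> to the empty set is 0.)  For a self-adjoint
  operator and finite multiplicity this only happens when the Hilbert space is finite-dimensional.
\<close>

definition isolating_radius :: "'a::complex_inner uop \<Rightarrow> complex \<Rightarrow> real"
  where "isolating_radius A z =
    (if Spec A - {z} = {} then 1 else infdist z (Spec A - {z}) / 2)"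

definition riesz_projection :: "(real \<Rightarrow> complex) \<Rightarrow> 'a::complex_inner uop \<Rightarrow> 'a \<Rightarrow>\<^sub>L 'a"
  where "riesz_projection g A =
    scaleC_blinfun (- 1 / (2 * of_real pi * \<i>)) (blinfun_contour_integral g (resolvent A))"

definition reduced_resolvent ::
    "(real \<Rightarrow> complex) \<Rightarrow> 'a::complex_inner uop \<Rightarrow> complex \<Rightarrow> 'a \<Rightarrow>\<^sub>L 'a"
  where "reduced_resolvent g A z =
    scaleC_blinfun (- 1 / (2 * of_real pi * \<i>))
      (blinfun_contour_integral g (\<lambda>\<zeta>. scaleC_blinfun (inverse (z - \<zeta>)) (resolvent A \<zeta>)))"

section \<open>Transformation operators\<close>

text \<open>\<open>B\<close> to the power \<open>-1/2\<close> is the positive operator whose square is the inverse of \<open>B\<close>.\<close>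

definition inverse_sqrt :: "('a::complex_inner \<Rightarrow>\<^sub>L 'a) \<Rightarrow> 'a \<Rightarrow>\<^sub>L 'a"
  where "inverse_sqrt B = (THE R. clinear (blinfun_apply R) \<and>
    (\<forall>x. \<langle>blinfun_apply R x, x\<rangle> \<in> \<real>\<^sub>\<ge>\<^sub>0) \<and>
    (R o\<^sub>L R) o\<^sub>L B = id_blinfun \<and> B o\<^sub>L (R o\<^sub>L R) = id_blinfun)"

definition transformation_op ::
    "('a::complex_inner \<Rightarrow>\<^sub>L 'a) \<Rightarrow> ('a \<Rightarrow>\<^sub>L 'a) \<Rightarrow> 'a \<Rightarrow>\<^sub>L 'a"
  where "transformation_op P\<^sub>0 P =
    inverse_sqrt (id_blinfun - ((P - P\<^sub>0) o\<^sub>L (P - P\<^sub>0))) o\<^sub>L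
    (((id_blinfun - P) o\<^sub>L (id_blinfun - P\<^sub>0)) + (P o\<^sub>L P\<^sub>0))"

end

theory Submission
  imports Defs "HOL-Computational_Algebra.Fundamental_Theorem_Algebra"
begin

text \<open>
  Each curve \<open>\<lambda>\<^sub>i\<^sub>k\<close> is obtained from one approximate eigenvector.  Put \<open>s = t - t\<^sub>0\<close> and
  \<open>z(t) = \<lambda> + \<mu>\<^sub>i s + \<nu>\<^sub>i\<^sub>k s\<^sup>2 / 2\<close>.  Suppose that \<open>v\<close> lies in the domain of \<open>A\<^sub>t\<close>, stays close to a unit
  eigenvector \<open>u\<close> of \<open>A\<^sub>t\<^sub>0\<close>, and satisfies \<open>(A\<^sub>t - z(t)) v = o(s\<^sup>2)\<close>.  The Riesz projection \<open>P\<^sub>t\<close> commutes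
  with \<open>A\<^sub>t\<close>, so \<open>P\<^sub>t v\<close> is an approximate eigenvector of a Hermitian operator in the finite-dimensional
  space \<open>ran P\<^sub>t\<close>, and an orthonormal eigenbasis there yields an eigenvalue at distance \<open>o(s\<^sup>2)\<close> from \<open>z(t)\<close>
  (\<open>eigenvalue_near\<close>).  It is also an eigenvalue of \<open>W\<^sub>t\<close>, because \<open>U\<^sub>t\<close> makes \<open>W\<^sub>t\<close>
  similar to \<open>A\<^sub>t\<close> in \<open>ran P\<^sub>t\<close> (\<open>Spec_in_Wt\<close>).

  The approximate eigenvector is \<open>u + s w\<^sub>1 + s\<^sup>2 w\<^sub>2\<close> with \<open>w\<^sub>1\<close>, \<open>w\<^sub>2\<close> in the domain of \<open>A\<^sup>*\<close>.  Comparing powers of \<open>s\<close>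
  gives two inhomogeneous problems \<open>(A\<^sup>* - \<lambda>) w = h\<close> with the boundary value \<open>T w\<close> prescribed modulo
  \<open>ran Q\<^sub>t\<^sub>0\<close>.  By Green's identity they are solvable exactly under orthogonality conditions on
  \<open>N = ker (A\<^sub>t\<^sub>0 - \<lambda>)\<close>.  The first of these is \<open>Wdot u = \<mu>\<^sub>i u\<close>.  The second is
  \<open>2 (Wdot - \<mu>\<^sub>i) n\<^sub>1 = (\<nu>\<^sub>i\<^sub>k - Wddot) u\<close> for the component \<open>n\<^sub>1\<close> of \<open>w\<^sub>1\<close> in \<open>N\<close>; this has a solution because \<open>u\<close> is
  an eigenvector of the compression of \<open>Wddot\<close> to the eigenspace of \<open>\<mu>\<^sub>i\<close>.  The component of \<open>w\<^sub>1\<close> orthogonal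
  to \<open>N\<close> is given by the adjoint of \<open>T S\<^sub>t\<^sub>0\<close>, which Green's identity makes explicit (\<open>TS_adj\<close>); it produces
  the quadratic term of \<open>Wddot\<close> (\<open>quasimode_coefficients\<close>).

  The boundary value of the truncated expansion lies in \<open>ran Q\<^sub>t\<close> only up to \<open>o(s\<^sup>2)\<close>.  It can be corrected by
  an element of \<open>ker (A\<^sup>* + \<i>)\<close> of comparable norm, uniformly over all self-adjoint extensions, because the
  resolvents at \<open>\<i>\<close> and \<open>-\<i>\<close> always have norm at most one (\<open>boundary_correction\<close>).  The same correction,
  applied to \<open>R\<^sub>t\<^sub>0(\<zeta>) h\<close>, shows that the resolvents converge in norm, uniformly on an annulus around the circle
  (\<open>resolvent_perturbation\<close>), hence \<open>P\<^sub>t\<close> tends to \<open>P\<^sub>t\<^sub>0\<close>.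

  What remains is spectral theory.  For self-adjoint operators a spectral gap bounds the resolvent
  (\<open>gap_lower_bound\<close>); the Riesz projection is an orthogonal projection commuting with the operator
  (\<open>riesz_idempotent\<close>), and at an isolated point of the spectrum its range is the eigenspace
  (\<open>riesz_isolated\<close>).  Since \<open>P\<^sub>t - P\<^sub>t\<^sub>0\<close> has finite rank, \<open>(I - D\<^sub>t\<^sup>2)\<^sup>-\<^sup>1\<^sup>/\<^sup>2\<close> exists, is unique, and can be computed on
  eigenvectors (\<open>inverse_sqrt_eigenvector\<close>).
\<close>

section \<open>Complex inner products\<close>

lemma clinear_iff:
  "clinear f \<longleftrightarrow> (\<forall>x y. f (x + y) = f x + f y) \<and> (\<forall>c x. f (c *\<^sub>C x) = c *\<^sub>C f x)"
  for f :: "'a::complex_inner \<Rightarrow> 'b::complex_inner"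
  by (simp add: Vector_Spaces.linear_iff complex_vector.vector_space_axioms)

lemma cinner_add_right: "\<langle>x, y + z\<rangle> = \<langle>x, y\<rangle> + \<langle>x, z\<rangle>" for x :: "'a::complex_inner"
  by (metis cinner_add_left cinner_commute complex_cnj_add)

lemma cinner_scaleC_right: "\<langle>x, c *\<^sub>C y\<rangle> = cnj c * \<langle>x, y\<rangle>" for x :: "'a::complex_inner"
  by (metis cinner_commute cinner_scaleC_left complex_cnj_mult)

lemma scaleC_minus1: "- x = (- 1) *\<^sub>C x" for x :: "'a::complex_inner"
  by (simp add: complex_vector.scale_minus_left scaleC_one)

lemma cinner_minus_left: "\<langle>- x, y\<rangle> = - \<langle>x, y\<rangle>" for x :: "'a::complex_inner"
  using cinner_scaleC_left[of "- 1" x y] by (simp flip: scaleC_minus1)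

lemma cinner_minus_right: "\<langle>x, - y\<rangle> = - \<langle>x, y\<rangle>" for x :: "'a::complex_inner"
  using cinner_scaleC_right[of x "- 1" y] by (simp flip: scaleC_minus1)

lemma cinner_diff_left: "\<langle>x - y, z\<rangle> = \<langle>x, z\<rangle> - \<langle>y, z\<rangle>" for x :: "'a::complex_inner"
  using cinner_add_left[of x "- y" z] by (simp add: cinner_minus_left)

lemma cinner_diff_right: "\<langle>x, y - z\<rangle> = \<langle>x, y\<rangle> - \<langle>x, z\<rangle>" for x :: "'a::complex_inner"
  using cinner_add_right[of x y "- z"] by (simp add: cinner_minus_right)

lemma cinner_zero_left [simp]: "\<langle>0, y\<rangle> = 0" for y :: "'a::complex_inner"
  using cinner_diff_left[of 0 0 y] by simp

lemma cinner_zero_right [simp]: "\<langle>y, 0\<rangle> = 0" for y :: "'a::complex_inner"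
  using cinner_diff_right[of y 0 0] by simp

lemma cinner_scaleR_left: "\<langle>r *\<^sub>R x, y\<rangle> = of_real r * \<langle>x, y\<rangle>" for x :: "'a::complex_inner"
  by (simp add: scaleR_scaleC cinner_scaleC_left)

lemma cinner_scaleR_right: "\<langle>x, r *\<^sub>R y\<rangle> = of_real r * \<langle>x, y\<rangle>" for x :: "'a::complex_inner"
  by (simp add: scaleR_scaleC cinner_scaleC_right)

lemma cinner_sum_left: "\<langle>\<Sum>i\<in>I. f i, y\<rangle> = (\<Sum>i\<in>I. \<langle>f i, y\<rangle>)" for y :: "'a::complex_inner"
  by (induction I rule: infinite_finite_induct) (auto simp: cinner_add_left)

lemma cinner_sum_right: "\<langle>y, \<Sum>i\<in>I. f i\<rangle> = (\<Sum>i\<in>I. \<langle>y, f i\<rangle>)" for y :: "'a::complex_inner"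
  by (induction I rule: infinite_finite_induct) (auto simp: cinner_add_right)

lemmas cinner_algebra = cinner_add_left cinner_add_right cinner_diff_left cinner_diff_right
  cinner_minus_left cinner_minus_right cinner_scaleC_left cinner_scaleC_right
  cinner_scaleR_left cinner_scaleR_right

lemma scaleC_scaleR_commute: "c *\<^sub>C r *\<^sub>R x = r *\<^sub>R c *\<^sub>C x" for x :: "'a::complex_inner"
  by (simp add: scaleR_scaleC scaleC_scaleC mult.commute)

lemmas scaleC_diff_right = complex_vector.scale_right_diff_distrib
lemmas scaleC_diff_left = complex_vector.scale_left_diff_distrib
lemmas scaleC_minus_right = complex_vector.scale_minus_right
lemmas scaleC_minus_left = complex_vector.scale_minus_left

lemma cinner_self: "\<langle>x, x\<rangle> = of_real ((norm x)\<^sup>2)" for x :: "'a::complex_inner"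
proof -
  have "Im \<langle>x, x\<rangle> = 0"
    using arg_cong[OF cinner_commute[of x x], of Im] by simp
  then show ?thesis
    by (simp add: complex_eq_iff power2_norm_eq_inner inner_eq_Re_cinner)
qed

lemma cinner_self_eq_0 [simp]: "\<langle>x, x\<rangle> = 0 \<longleftrightarrow> x = 0" for x :: "'a::complex_inner"
  by (simp add: cinner_self)

text \<open>
  Multiplying \<open>x\<close> by a phase makes \<open>\<langle>x, y\<rangle>\<close> real, which reduces the bound to the real inner product.
\<close>

lemma norm_cinner_le: "cmod \<langle>x, y\<rangle> \<le> norm x * norm y" for x :: "'a::complex_inner"
proof (cases "\<langle>x, y\<rangle> = 0")
  case False
  define c where "c = cnj \<langle>x, y\<rangle> / cmod \<langle>x, y\<rangle>"
  have c: "cmod c = 1"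
    using False by (simp add: c_def norm_divide)
  have "\<langle>c *\<^sub>C x, y\<rangle> = \<langle>x, y\<rangle> * cnj \<langle>x, y\<rangle> / cmod \<langle>x, y\<rangle>"
    by (simp add: cinner_scaleC_left c_def)
  also have "\<dots> = of_real (cmod \<langle>x, y\<rangle>)"
    using False by (simp add: complex_norm_square[symmetric] power2_eq_square)
  finally have "cmod \<langle>x, y\<rangle> = (c *\<^sub>C x) \<bullet> y"
    by (simp add: inner_eq_Re_cinner)
  also have "\<dots> \<le> norm (c *\<^sub>C x) * norm y"
    by (rule norm_cauchy_schwarz)
  finally show ?thesis
    by (simp add: norm_scaleC c)
qed auto

lemma cinner_eqI: "(\<And>z. \<langle>x, z\<rangle> = \<langle>y, z\<rangle>) \<Longrightarrow> x = y" for x :: "'a::complex_inner"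
  by (metis cinner_diff_left cinner_self_eq_0 eq_iff_diff_eq_0)

lemma cinner_eqI_right: "(\<And>z. \<langle>z, x\<rangle> = \<langle>z, y\<rangle>) \<Longrightarrow> x = y" for x :: "'a::complex_inner"
  by (metis cinner_diff_right cinner_self_eq_0 eq_iff_diff_eq_0)

lemma bounded_bilinear_cinner: "bounded_bilinear (cinner :: 'a::complex_inner \<Rightarrow> 'a \<Rightarrow> complex)"
proof
  show "\<exists>K. \<forall>a b. cmod \<langle>a::'a, b\<rangle> \<le> norm a * norm b * K"
    by (rule exI[of _ 1]) (simp add: norm_cinner_le)
qed (auto simp: cinner_algebra scaleR_conv_of_real)

lemma bounded_bilinear_scaleC:
  "bounded_bilinear (scaleC :: complex \<Rightarrow> 'a::complex_inner \<Rightarrow> 'a)"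
proof
  show "\<exists>K. \<forall>a b. norm (a *\<^sub>C b :: 'a) \<le> norm a * norm b * K"
    by (rule exI[of _ 1]) (simp add: norm_scaleC)
qed (auto simp: scaleC_add_left scaleC_add_right scaleC_scaleC scaleR_scaleC scaleR_conv_of_real
    mult.commute)

lemmas tendsto_cinner [tendsto_intros] = bounded_bilinear.tendsto[OF bounded_bilinear_cinner]
lemmas continuous_on_cinner [continuous_intros] =
  bounded_bilinear.continuous_on[OF bounded_bilinear_cinner]
lemmas tendsto_scaleC [tendsto_intros] = bounded_bilinear.tendsto[OF bounded_bilinear_scaleC]

lemma norm_diff_scaleR_square:
  "(norm (z - r *\<^sub>R w))\<^sup>2 = (norm z)\<^sup>2 - 2 * r * (z \<bullet> w) + r\<^sup>2 * (w \<bullet> w)"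
  for z :: "'a::real_inner"
  unfolding power2_norm_eq_inner
  by (simp add: inner_diff_left inner_diff_right inner_commute[of w z] power2_eq_square right_diff_distrib)

text \<open>
  The element of \<open>V\<close> nearest to a point outside \<open>V\<close> exists by the parallelogram identity and
  completeness, and the difference is orthogonal to \<open>V\<close>; so a closed subspace with trivial
  orthogonal complement leaves no point outside.
\<close>

lemma closed_subspace_eq_UNIV:
  fixes V :: "'a::chilbert_space set"
  assumes V: "complex_vector.subspace V" "closed V"
    and orth: "\<And>x. (\<And>v. v \<in> V \<Longrightarrow> \<langle>v, x\<rangle> = 0) \<Longrightarrow> x = 0"
  shows "V = UNIV"
proof (rule ccontr)
  assume "V \<noteq> UNIV"
  then obtain x where x: "x \<notin> V" by auto
  have ne: "V \<noteq> {}" using complex_vector.subspace_0[OF V(1)] by auto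
  define d where "d = infdist x V"
  have d0: "d \<ge> 0" by (simp add: d_def infdist_nonneg)
  have dle: "d \<le> dist x v" if "v \<in> V" for v
    unfolding d_def using that by (rule infdist_le)
  have "\<exists>v\<in>V. dist x v < d + 1 / real (Suc n)" for n
  proof (rule ccontr)
    assume "\<not> (\<exists>v\<in>V. dist x v < d + 1 / real (Suc n))"
    then have "d + 1 / real (Suc n) \<le> d"
      unfolding d_def infdist_notempty[OF ne]
      by (intro cINF_greatest ne) (auto simp: not_less)
    then show False by (simp add: field_simps)
  qed
  then obtain v where v: "\<And>n. v n \<in> V" "\<And>n. dist x (v n) < d + 1 / real (Suc n)"
    by metis
  have half: "(1/2) *\<^sub>R (a + b) \<in> V" if "a \<in> V" "b \<in> V" for a b
    using that V(1) by (simp add: scaleR_scaleC complex_vector.subspace_add complex_vector.subspace_scale)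
  have par: "(norm (v n - v k))\<^sup>2 \<le> 4 * (d + e)\<^sup>2 - 4 * d\<^sup>2"
    if "dist x (v n) \<le> d + e" "dist x (v k) \<le> d + e" for n k e
  proof -
    define a b where "a = x - v n" and "b = x - v k"
    have "(norm (a - b))\<^sup>2 + (norm (a + b))\<^sup>2 = 2 * (norm a)\<^sup>2 + 2 * (norm b)\<^sup>2"
      by (simp add: power2_norm_eq_inner algebra_simps inner_commute)
    moreover have "a - b = v k - v n" by (simp add: a_def b_def)
    moreover have "d \<le> norm (x - (1/2) *\<^sub>R (v n + v k))"
      using dle[OF half[OF v(1) v(1)]] by (simp add: dist_norm)
    then have "2 * d \<le> norm (a + b)"
    proof -
      have "a + b = 2 *\<^sub>R (x - (1/2) *\<^sub>R (v n + v k))"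
        by (simp add: a_def b_def algebra_simps scaleR_2)
      then have "norm (a + b) = 2 * norm (x - (1/2) *\<^sub>R (v n + v k))" by simp
      then show ?thesis using \<open>d \<le> norm (x - (1/2) *\<^sub>R (v n + v k))\<close> by linarith
    qed
    then have "(2 * d)\<^sup>2 \<le> (norm (a + b))\<^sup>2" using d0 by (intro power_mono) auto
    moreover have "(norm a)\<^sup>2 \<le> (d + e)\<^sup>2" "(norm b)\<^sup>2 \<le> (d + e)\<^sup>2"
      using that by (auto simp: a_def b_def dist_norm intro: power_mono)
    ultimately show ?thesis by (simp add: norm_minus_commute power_mult_distrib)
  qed
  have "Cauchy v"
  proof (rule metric_CauchyI)
    fix \<epsilon> :: real assume "\<epsilon> > 0"
    have "(\<lambda>n. 4 * (d + 1 / real (Suc n))\<^sup>2 - 4 * d\<^sup>2) \<longlonglongrightarrow> 4 * (d + 0)\<^sup>2 - 4 * d\<^sup>2"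
      by (intro tendsto_intros lim_1_over_n[THEN LIMSEQ_Suc])
    then have "\<forall>\<^sub>F n in sequentially. 4 * (d + 1 / real (Suc n))\<^sup>2 - 4 * d\<^sup>2 < \<epsilon>\<^sup>2"
      using \<open>\<epsilon> > 0\<close> by (intro order_tendstoD(2)) auto
    then obtain N where N: "4 * (d + 1 / real (Suc N))\<^sup>2 - 4 * d\<^sup>2 < \<epsilon>\<^sup>2"
      using eventually_sequentially by auto
    show "\<exists>M. \<forall>m\<ge>M. \<forall>n\<ge>M. dist (v m) (v n) < \<epsilon>"
    proof (intro exI[of _ N] allI impI)
      fix m n assume "m \<ge> N" "n \<ge> N"
      have "dist x (v k) \<le> d + 1 / real (Suc N)" if "k \<ge> N" for k
      proof -
        have "1 / real (Suc k) \<le> 1 / real (Suc N)" using that by (simp add: frac_le)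
        then show ?thesis using v(2)[of k] by linarith
      qed
      then have "(norm (v m - v n))\<^sup>2 < \<epsilon>\<^sup>2"
        using par[of m "1 / real (Suc N)" n] \<open>m \<ge> N\<close> \<open>n \<ge> N\<close> N by fastforce
      then show "dist (v m) (v n) < \<epsilon>"
        using \<open>\<epsilon> > 0\<close> by (simp add: dist_norm power2_less_imp_less)
    qed
  qed
  then obtain p where p: "v \<longlonglongrightarrow> p"
    using Cauchy_convergent convergent_def by blast
  have pV: "p \<in> V" using V(2) v(1) p closed_sequentially by blast
  have "(\<lambda>n. dist x (v n)) \<longlonglongrightarrow> dist x p" by (intro tendsto_intros p)
  moreover have "(\<lambda>n. d + 1 / real (Suc n)) \<longlonglongrightarrow> d + 0"
    by (intro tendsto_intros lim_1_over_n[THEN LIMSEQ_Suc])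
  ultimately have "dist x p \<le> d + 0"
    using v(2) by (intro LIMSEQ_le) (auto intro: less_imp_le)
  then have min: "norm (x - p) \<le> norm (x - w)" if "w \<in> V" for w
    using dle[OF that] by (simp add: dist_norm)
  have re: "(x - p) \<bullet> w = 0" if "w \<in> V" for w
  proof (cases "w = 0")
    case False
    define r where "r = ((x - p) \<bullet> w) / (w \<bullet> w)"
    have "p + r *\<^sub>R w \<in> V"
      using pV that V(1) by (simp add: scaleR_scaleC complex_vector.subspace_add complex_vector.subspace_scale)
    then have "(norm (x - p))\<^sup>2 \<le> (norm ((x - p) - r *\<^sub>R w))\<^sup>2"
      using min[of "p + r *\<^sub>R w"] by (simp add: diff_diff_eq power_mono)
    also have "\<dots> = (norm (x - p))\<^sup>2 - 2 * r * ((x - p) \<bullet> w) + r\<^sup>2 * (w \<bullet> w)"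
      by (rule norm_diff_scaleR_square)
    finally have "2 * r * ((x - p) \<bullet> w) \<le> r\<^sup>2 * (w \<bullet> w)" by simp
    then have "((x - p) \<bullet> w)\<^sup>2 \<le> 0"
      using False by (simp add: r_def power2_eq_square divide_simps split: if_splits)
    then show ?thesis by simp
  qed auto
  have "\<langle>w, x - p\<rangle> = 0" if "w \<in> V" for w
  proof -
    have "Re \<langle>x - p, w\<rangle> = 0" using re[OF that] by (simp add: inner_eq_Re_cinner)
    moreover have "Re \<langle>x - p, \<i> *\<^sub>C w\<rangle> = 0"
      using re[of "\<i> *\<^sub>C w"] that V(1) by (simp add: inner_eq_Re_cinner complex_vector.subspace_scale)
    ultimately have "\<langle>x - p, w\<rangle> = 0" by (simp add: cinner_scaleC_right complex_eq_iff)
    then show ?thesis using cinner_commute[of w "x - p"] by simp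
  qed
  then have "x = p" using orth[of "x - p"] by simp
  then show False using x pV by simp
qed

section \<open>The spectral theorem in a finite-dimensional subspace\<close>

definition orthonormal :: "'a::complex_inner set \<Rightarrow> bool"
  where "orthonormal E \<longleftrightarrow> (\<forall>x\<in>E. \<forall>y\<in>E. \<langle>x, y\<rangle> = (if x = y then 1 else 0))"

definition ortho_sum :: "'a::complex_inner set \<Rightarrow> 'a \<Rightarrow> 'a"
  where "ortho_sum E x = (\<Sum>e\<in>E. \<langle>x, e\<rangle> *\<^sub>C e)"

lemma ortho_sum_in_span: "ortho_sum E x \<in> complex_vector.span E"
  unfolding ortho_sum_def
  by (intro complex_vector.span_sum complex_vector.span_scale complex_vector.span_base)

lemma cinner_ortho_sum:
  assumes "finite E" "orthonormal E" "e \<in> E"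
  shows "\<langle>ortho_sum E x, e\<rangle> = \<langle>x, e\<rangle>"
proof -
  have "\<langle>ortho_sum E x, e\<rangle> = (\<Sum>e'\<in>E. if e' = e then \<langle>x, e\<rangle> else 0)"
    unfolding ortho_sum_def cinner_sum_left cinner_scaleC_left
    using assms by (intro sum.cong) (auto simp: orthonormal_def)
  then show ?thesis using assms by simp
qed

lemma orthogonal_span:
  assumes "\<And>e. e \<in> E \<Longrightarrow> \<langle>x, e\<rangle> = 0" "v \<in> complex_vector.span E"
  shows "\<langle>x, v\<rangle> = 0"
  using assms(2)
  by (induction rule: complex_vector.span_induct_alt) (auto simp: cinner_algebra assms(1))

lemma diff_ortho_sum_orthogonal:
  assumes "finite E" "orthonormal E" "v \<in> complex_vector.span E"
  shows "\<langle>x - ortho_sum E x, v\<rangle> = 0"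
  using assms by (rule_tac orthogonal_span[of E]) (auto simp: cinner_diff_left cinner_ortho_sum)

lemma ortho_sum_eq:
  assumes "finite E" "orthonormal E" "x \<in> complex_vector.span E"
  shows "ortho_sum E x = x"
proof -
  have "x - ortho_sum E x \<in> complex_vector.span E"
    by (intro complex_vector.span_diff assms ortho_sum_in_span)
  from diff_ortho_sum_orthogonal[OF assms(1,2) this, of x] show ?thesis by simp
qed

lemma orthonormal_independent:
  assumes "finite E" "orthonormal E"
  shows "complex_vector.independent E"
proof
  assume "complex_vector.dependent E"
  then obtain u v where uv: "v \<in> E" "u v \<noteq> 0" "(\<Sum>v\<in>E. u v *\<^sub>C v) = 0"
    using complex_vector.dependent_finite[OF assms(1)] by auto
  have "0 = \<langle>\<Sum>v\<in>E. u v *\<^sub>C v, v\<rangle>" using uv by simp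
  also have "\<dots> = (\<Sum>v'\<in>E. if v' = v then u v else 0)"
    unfolding cinner_sum_left cinner_scaleC_left
    using assms uv by (intro sum.cong) (auto simp: orthonormal_def)
  also have "\<dots> = u v" using assms uv by simp
  finally show False using uv by simp
qed

lemma norm_ortho_expansion:
  assumes "finite E" "orthonormal E"
  shows "(norm (\<Sum>e\<in>E. c e *\<^sub>C e))\<^sup>2 = (\<Sum>e\<in>E. (cmod (c e))\<^sup>2)"
proof -
  have "complex_of_real ((norm (\<Sum>e\<in>E. c e *\<^sub>C e))\<^sup>2) = (\<Sum>e\<in>E. \<Sum>e'\<in>E. c e * cnj (c e') * \<langle>e, e'\<rangle>)"
    unfolding cinner_self[symmetric] cinner_sum_left
    by (intro sum.cong refl) (simp add: cinner_sum_right cinner_algebra sum_distrib_left mult_ac)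
  also have "\<dots> = (\<Sum>e\<in>E. \<Sum>e'\<in>E. if e' = e then c e * cnj (c e) else 0)"
    using assms(2) by (intro sum.cong refl) (auto simp: orthonormal_def)
  also have "\<dots> = (\<Sum>e\<in>E. c e * cnj (c e))"
    using assms(1) by simp
  also have "\<dots> = of_real (\<Sum>e\<in>E. (cmod (c e))\<^sup>2)"
    by (simp only: of_real_sum complex_norm_square)
  finally show ?thesis by (simp only: of_real_eq_iff)
qed

text \<open>
  The value \<open>p(L) x\<close>.  A polynomial with \<open>p(L) x = 0\<close> is split into linear factors over the complex numbers;
  one of these factors \<open>L - z\<close> then has a kernel.
\<close>

definition poly_op :: "('a::complex_inner \<Rightarrow> 'a) \<Rightarrow> complex poly \<Rightarrow> 'a \<Rightarrow> 'a"
  where "poly_op L p x = (\<Sum>i\<le>degree p. coeff p i *\<^sub>C (L ^^ i) x)"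

lemma poly_op_bound:
  assumes "degree p \<le> n"
  shows "poly_op L p x = (\<Sum>i\<le>n. coeff p i *\<^sub>C (L ^^ i) x)"
  unfolding poly_op_def using assms
  by (intro sum.mono_neutral_left) (auto simp: coeff_eq_0)

text \<open>
  The iterates of \<open>x\<close> under \<open>L\<close> are linearly dependent in a finite-dimensional space, which provides
  a polynomial annihilating \<open>x\<close>.
\<close>

lemma eigenvector_exists:
  fixes V B :: "'a::complex_inner set"
  assumes V: "complex_vector.subspace V" and B: "finite B" "V \<subseteq> complex_vector.span B"
    and L: "\<And>x. x \<in> V \<Longrightarrow> L x \<in> V"
    and add: "\<And>x y. x \<in> V \<Longrightarrow> y \<in> V \<Longrightarrow> L (x + y) = L x + L y"
    and scale: "\<And>c x. x \<in> V \<Longrightarrow> L (c *\<^sub>C x) = c *\<^sub>C L x"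
    and x: "x \<in> V" "x \<noteq> 0"
  shows "\<exists>z y. y \<in> V \<and> y \<noteq> 0 \<and> L y = z *\<^sub>C y"
proof -
  have pow: "(L ^^ i) y \<in> V" if "y \<in> V" for i y
    using that L by (induction i) auto
  have mem: "(\<Sum>i\<in>I. c i *\<^sub>C (L ^^ i) y) \<in> V" if "y \<in> V" for I :: "nat set" and c y
    using that pow V
    by (intro complex_vector.subspace_sum complex_vector.subspace_scale) auto
  have Lsum: "L (\<Sum>i\<in>I. c i *\<^sub>C (L ^^ i) y) = (\<Sum>i\<in>I. c i *\<^sub>C (L ^^ Suc i) y)"
    if "y \<in> V" "finite I" for I :: "nat set" and c y
    using that(2)
  proof (induction I rule: finite_induct)
    case empty
    show ?case using scale[of 0 0] complex_vector.subspace_0[OF V] by simp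
  next
    case (insert i I)
    then show ?case
      using add[OF _ mem[OF that(1)], of "c i *\<^sub>C (L ^^ i) y" c I] scale[OF pow[OF that(1)]]
        V pow[OF that(1)]
      by (simp add: complex_vector.subspace_scale)
  qed
  have factor: "poly_op L ([:- z, 1:] * q) x = L (poly_op L q x) - z *\<^sub>C poly_op L q x" for z q
  proof -
    define n where "n = degree q"
    have cf: "coeff ([:- z, 1:] * q) i = (if i = 0 then 0 else coeff q (i - 1)) - z * coeff q i" for i
      by (cases i) auto
    have dg: "degree ([:- z, 1:] * q) \<le> Suc n"
      unfolding n_def by (rule order_trans[OF degree_mult_le]) simp
    have "poly_op L ([:- z, 1:] * q) x
        = (\<Sum>i\<le>Suc n. (if i = 0 then 0 else coeff q (i - 1)) *\<^sub>C (L ^^ i) x)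
          - (\<Sum>i\<le>Suc n. (z * coeff q i) *\<^sub>C (L ^^ i) x)"
      unfolding poly_op_bound[OF dg] cf by (simp add: scaleC_diff_left sum_subtractf)
    also have "(\<Sum>i\<le>Suc n. (if i = 0 then 0 else coeff q (i - 1)) *\<^sub>C (L ^^ i) x)
        = (\<Sum>i\<le>n. coeff q i *\<^sub>C (L ^^ Suc i) x)"
      by (subst sum.atMost_Suc_shift) simp
    also have "\<dots> = L (poly_op L q x)"
      unfolding poly_op_def n_def by (rule Lsum[symmetric]) (use x in auto)
    also have "(\<Sum>i\<le>Suc n. (z * coeff q i) *\<^sub>C (L ^^ i) x) = z *\<^sub>C poly_op L q x"
      by (subst poly_op_bound[of q "Suc n"])
        (simp_all only: n_def complex_vector.scale_sum_right scaleC_scaleC le_Suc_eq le_refl simp_thms)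
    finally show ?thesis .
  qed
  have main: "\<exists>z y. y \<in> V \<and> y \<noteq> 0 \<and> L y = z *\<^sub>C y" if "p \<noteq> 0" "poly_op L p x = 0" for p
    using that
  proof (induction "degree p" arbitrary: p rule: less_induct)
    case less
    show ?case
    proof (cases "degree p = 0")
      case True
      then obtain c where "p = [:c:]" using degree_eq_zeroE by blast
      then have False using less(2,3) x by (simp add: poly_op_def)
      then show ?thesis ..
    next
      case False
      then obtain z where "poly p z = 0"
        using Fundamental_Theorem_Algebra.fundamental_theorem_of_algebra[of p] constant_degree[of p] by auto
      then obtain q where q: "p = [:- z, 1:] * q"
        using poly_eq_0_iff_dvd[of p z] by (auto simp: dvd_def)
      have q0: "q \<noteq> 0" using q less(2) by auto
      have dq: "degree q < degree p"
        unfolding q by (subst degree_mult_eq) (use q0 in auto)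
      show ?thesis
      proof (cases "poly_op L q x = 0")
        case True
        then show ?thesis using less(1)[OF dq q0] by simp
      next
        case False
        have "poly_op L q x \<in> V" unfolding poly_op_def using mem x by simp
        moreover have "L (poly_op L q x) = z *\<^sub>C poly_op L q x"
          using factor[of z q] less(3) q by simp
        ultimately show ?thesis using False by blast
      qed
    qed
  qed
  show ?thesis
  proof (cases "inj_on (\<lambda>i. (L ^^ i) x) {..card B}")
    case False
    then obtain i j where ij: "i \<noteq> j" "(L ^^ i) x = (L ^^ j) x" by (auto simp: inj_on_def)
    \<comment> \<open>coinciding iterates\<close>
    define p where "p = monom (1::complex) i - monom 1 j"
    have "coeff p i = 1" using ij by (simp add: p_def)
    then have p0: "p \<noteq> 0" by auto
    have dg: "degree p \<le> i + j"
      unfolding p_def by (intro degree_diff_le) (auto intro: order_trans[OF degree_monom_le])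
    have "poly_op L p x = (\<Sum>k\<le>i + j. (if k = i then (L ^^ i) x else 0) - (if k = j then (L ^^ j) x else 0))"
      unfolding poly_op_bound[OF dg]
      by (intro sum.cong refl) (auto simp: p_def scaleC_one scaleC_minus1[symmetric])
    also have "\<dots> = 0" using ij by (simp add: sum_subtractf)
    finally show ?thesis using main[OF p0] by simp
  next
    case True
    define S where "S = (\<lambda>i. (L ^^ i) x) ` {..card B}"
    have cS: "card S = Suc (card B)" using True by (simp add: S_def card_image)
    have "complex_vector.dependent S"
    proof (rule ccontr)
      assume "complex_vector.independent S"
      moreover have "S \<subseteq> complex_vector.span B" using B(2) pow x by (auto simp: S_def)
      ultimately have "card S \<le> card B"
        using complex_vector.independent_span_bound[OF B(1)] by blast
      then show False using cS by simp
    qed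
    moreover have "finite S" by (simp add: S_def)
    ultimately obtain u v where u: "v \<in> S" "u v \<noteq> 0" "(\<Sum>v\<in>S. u v *\<^sub>C v) = 0"
      using complex_vector.dependent_finite[of S] by auto
    \<comment> \<open>the coefficients of a dependence between \<open>card B + 1\<close> distinct iterates\<close>
    from u(1) obtain k where k: "k \<le> card B" "v = (L ^^ k) x" by (auto simp: S_def)
    define p where "p = (\<Sum>i\<le>card B. monom (u ((L ^^ i) x)) i)"
    have cf: "coeff p i = (if i \<le> card B then u ((L ^^ i) x) else 0)" for i
      by (simp add: p_def coeff_sum)
    have "coeff p k \<noteq> 0" using cf k u by simp
    then have p0: "p \<noteq> 0" by auto
    have dg: "degree p \<le> card B" by (rule degree_le) (simp add: cf)
    have "poly_op L p x = (\<Sum>i\<le>card B. u ((L ^^ i) x) *\<^sub>C (L ^^ i) x)"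
      unfolding poly_op_bound[OF dg] by (intro sum.cong refl) (simp add: cf)
    also have "\<dots> = 0"
      using u(3) unfolding S_def by (subst (asm) sum.reindex[OF True]) simp
    finally show ?thesis using main[OF p0] by simp
  qed
qed

text \<open>
  A maximal orthonormal set of eigenvectors spans \<open>V\<close>: its orthogonal complement in \<open>V\<close> is
  invariant, so if it were nonzero it would contain a further eigenvector.
\<close>

theorem spectral_theorem:
  fixes V B :: "'a::complex_inner set"
  assumes V: "complex_vector.subspace V" and B: "finite B" "V \<subseteq> complex_vector.span B"
    and L: "\<And>x. x \<in> V \<Longrightarrow> L x \<in> V"
    and add: "\<And>x y. x \<in> V \<Longrightarrow> y \<in> V \<Longrightarrow> L (x + y) = L x + L y"
    and scale: "\<And>c x. x \<in> V \<Longrightarrow> L (c *\<^sub>C x) = c *\<^sub>C L x"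
    and herm: "\<And>x y. x \<in> V \<Longrightarrow> y \<in> V \<Longrightarrow> \<langle>L x, y\<rangle> = \<langle>x, L y\<rangle>"
  obtains E l where "finite E" "orthonormal E" "complex_vector.span E = V"
    "\<And>e. e \<in> E \<Longrightarrow> L e = complex_of_real (l e) *\<^sub>C e"
proof -
  define good where "good F \<longleftrightarrow> finite F \<and> F \<subseteq> V \<and> orthonormal F \<and> (\<forall>e\<in>F. \<exists>z. L e = z *\<^sub>C e)" for F
  have bound: "card F \<le> card B" if "good F" for F
    using complex_vector.independent_span_bound[OF B(1), of F] that B(2)
      orthonormal_independent[of F] by (auto simp: good_def)
  have "good {}" by (simp add: good_def orthonormal_def)
  then obtain F where F: "good F" "\<And>G. good G \<Longrightarrow> card G \<le> card F"
    using ex_has_greatest_nat[of good "{}" card "Suc (card B)"] bound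
    by (metis le_imp_less_Suc)
  have F': "finite F" "F \<subseteq> V" "orthonormal F" "\<And>e. e \<in> F \<Longrightarrow> \<exists>z. L e = z *\<^sub>C e"
    using F(1) by (auto simp: good_def)
  have sub: "complex_vector.span F \<subseteq> V"
    by (rule complex_vector.span_minimal[OF F'(2) V])
  have "V \<subseteq> complex_vector.span F"
  proof
    fix x assume x: "x \<in> V"
    define V' where "V' = {y \<in> V. \<forall>e\<in>F. \<langle>y, e\<rangle> = 0}"
    show "x \<in> complex_vector.span F"
    proof (rule ccontr)
      assume nx: "x \<notin> complex_vector.span F"
      define x' where "x' = x - ortho_sum F x"
      have x'0: "x' \<noteq> 0" using nx ortho_sum_in_span[of F x] by (auto simp: x'_def)
      have "x' \<in> V" unfolding x'_def using x sub ortho_sum_in_span[of F x]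
        by (intro complex_vector.subspace_diff[OF V]) auto
      then have x': "x' \<in> V'"
        unfolding V'_def x'_def
        using diff_ortho_sum_orthogonal[OF F'(1,3) complex_vector.span_base] by auto
      have V': "complex_vector.subspace V'"
        using V unfolding complex_vector.subspace_def V'_def
        by (auto simp: cinner_algebra)
      have L': "L y \<in> V'" if y: "y \<in> V'" for y
      proof -
        have "\<langle>L y, e\<rangle> = 0" if e: "e \<in> F" for e
        proof -
          obtain z where "L e = z *\<^sub>C e" using F'(4)[OF e] by blast
          then show ?thesis using herm[of y e] y e F'(2)
            by (auto simp: V'_def cinner_scaleC_right)
        qed
        then show ?thesis using y L by (auto simp: V'_def)
      qed
      have "\<exists>z y. y \<in> V' \<and> y \<noteq> 0 \<and> L y = z *\<^sub>C y"
        by (rule eigenvector_exists[OF V' B(1) _ L' _ _ x' x'0])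
          (use B(2) add scale in \<open>auto simp: V'_def\<close>)
      then obtain z y where y: "y \<in> V'" "y \<noteq> 0" "L y = z *\<^sub>C y" by blast
      define e where "e = (1 / complex_of_real (norm y)) *\<^sub>C y"
      have eV: "e \<in> V'" using y(1) V' by (simp add: e_def complex_vector.subspace_scale)
      have ee: "\<langle>e, e\<rangle> = 1"
        using y(2) by (simp add: e_def cinner_self norm_scaleC norm_divide)
      have "e \<notin> F" using eV ee by (auto simp: V'_def)
      have Le: "L e = z *\<^sub>C e"
        using scale[of y "1 / complex_of_real (norm y)"] y
        by (auto simp: V'_def e_def scaleC_scaleC)
      have "good (insert e F)"
        unfolding good_def
      proof (intro conjI)
        show "orthonormal (insert e F)"
          unfolding orthonormal_def
        proof (intro ballI)
          fix a b assume ab: "a \<in> insert e F" "b \<in> insert e F"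
          show "\<langle>a, b\<rangle> = (if a = b then 1 else 0)"
          proof (cases "a = e"; cases "b = e")
            assume "a \<noteq> e" "b = e"
            then show ?thesis using eV ab cinner_commute[of a e] by (auto simp: V'_def)
          qed (use eV ee ab F'(3) \<open>e \<notin> F\<close> in \<open>auto simp: V'_def orthonormal_def\<close>)
        qed
      qed (use F' eV Le in \<open>auto simp: V'_def\<close>)
      then show False using F(2)[of "insert e F"] \<open>e \<notin> F\<close> F'(1) by simp
    qed
  qed
  then have span: "complex_vector.span F = V" using sub by auto
  have "\<exists>r. L e = complex_of_real r *\<^sub>C e" if e: "e \<in> F" for e
  proof -
    obtain z where z: "L e = z *\<^sub>C e" using F'(4)[OF e] by blast
    have "\<langle>e, e\<rangle> = 1" using F'(3) e by (simp add: orthonormal_def)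
    then have "z = cnj z" using herm[of e e] F'(2) e z by (auto simp: cinner_algebra)
    then have "z = of_real (Re z)" by (metis Reals_cnj_iff of_real_Re)
    then show ?thesis using z by metis
  qed
  then obtain l where "\<And>e. e \<in> F \<Longrightarrow> L e = complex_of_real (l e) *\<^sub>C e" by metis
  then show ?thesis using that[of F l] F' span by blast
qed

lemma orthonormal_basis_exists:
  fixes V B :: "'a::complex_inner set"
  assumes "complex_vector.subspace V" "finite B" "V \<subseteq> complex_vector.span B"
  obtains E where "finite E" "orthonormal E" "complex_vector.span E = V"
  by (rule spectral_theorem[OF assms, where L = "\<lambda>x. x"]) (auto intro: that)

section \<open>Resolvents of self-adjoint operators\<close>

lemma uapply_eq: "linear_uop A \<Longrightarrow> (u, v) \<in> A \<Longrightarrow> uapply A u = v"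
  unfolding uapply_def linear_uop_def single_valued_def by blast

lemma uapply_mem: "linear_uop A \<Longrightarrow> u \<in> Domain A \<Longrightarrow> (u, uapply A u) \<in> A"
  by (auto simp: uapply_eq)

lemma uop_add: "linear_uop A \<Longrightarrow> (u, v) \<in> A \<Longrightarrow> (u', v') \<in> A \<Longrightarrow> (u + u', v + v') \<in> A"
  unfolding linear_uop_def using complex_vector.subspace_add[of A "(u, v)" "(u', v')"] by simp

lemma uop_scale: "linear_uop A \<Longrightarrow> (u, v) \<in> A \<Longrightarrow> (c *\<^sub>C u, c *\<^sub>C v) \<in> A"
  unfolding linear_uop_def using complex_vector.subspace_scale[of A "(u, v)" c]
  by (simp add: scaleC_prod_def)

lemma uop_diff: "linear_uop A \<Longrightarrow> (u, v) \<in> A \<Longrightarrow> (u', v') \<in> A \<Longrightarrow> (u - u', v - v') \<in> A"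
  unfolding linear_uop_def using complex_vector.subspace_diff[of A "(u, v)" "(u', v')"] by simp

lemma uop_zero: "linear_uop A \<Longrightarrow> (0, 0) \<in> A"
  unfolding linear_uop_def using complex_vector.subspace_0[of A] by (simp add: zero_prod_def)

lemma uop_functional: "linear_uop A \<Longrightarrow> (u, v) \<in> A \<Longrightarrow> (u, v') \<in> A \<Longrightarrow> v = v'"
  by (metis uapply_eq)

lemma self_adjoint_linear: "self_adjoint_uop A \<Longrightarrow> linear_uop A"
  by (simp add: self_adjoint_uop_def)

lemma self_adjoint_symmetric:
  "self_adjoint_uop A \<Longrightarrow> (u, v) \<in> A \<Longrightarrow> (x, y) \<in> A \<Longrightarrow> \<langle>v, x\<rangle> = \<langle>u, y\<rangle>"
  unfolding self_adjoint_uop_def uadjoint_def by blast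

lemma self_adjoint_memI:
  "self_adjoint_uop A \<Longrightarrow> (\<And>x y. (x, y) \<in> A \<Longrightarrow> \<langle>y, v\<rangle> = \<langle>x, w\<rangle>) \<Longrightarrow> (v, w) \<in> A"
  unfolding self_adjoint_uop_def uadjoint_def by blast

lemma self_adjoint_memI_left:
  assumes "self_adjoint_uop A" "\<And>x y. (x, y) \<in> A \<Longrightarrow> \<langle>v, y\<rangle> = \<langle>w, x\<rangle>"
  shows "(v, w) \<in> A"
proof (rule self_adjoint_memI[OF assms(1)])
  fix x y assume "(x, y) \<in> A"
  then show "\<langle>y, v\<rangle> = \<langle>x, w\<rangle>"
    using assms(2) cinner_commute[of y v] cinner_commute[of x w] by simp
qed

lemma is_resolvent_iff:
  assumes "linear_uop A"
  shows "is_resolvent A z R \<longleftrightarrow> (\<forall>h. (R h, h + z *\<^sub>C R h) \<in> A) \<and>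
    (\<forall>u v. (u, v) \<in> A \<longrightarrow> R (v - z *\<^sub>C u) = u)"
proof -
  have "(\<forall>h. R h \<in> Domain A \<and> uapply A (R h) - z *\<^sub>C R h = h)
      \<longleftrightarrow> (\<forall>h. (R h, h + z *\<^sub>C R h) \<in> A)"
  proof (intro all_cong1 iffI)
    fix h assume h: "R h \<in> Domain A \<and> uapply A (R h) - z *\<^sub>C R h = h"
    then have "uapply A (R h) = h + z *\<^sub>C R h"
      by (simp add: algebra_simps)
    then show "(R h, h + z *\<^sub>C R h) \<in> A"
      using h uapply_mem[OF assms] by metis
  next
    fix h assume h: "(R h, h + z *\<^sub>C R h) \<in> A"
    then show "R h \<in> Domain A \<and> uapply A (R h) - z *\<^sub>C R h = h"
      using uapply_eq[OF assms h] by auto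
  qed
  moreover have "(\<forall>u\<in>Domain A. R (uapply A u - z *\<^sub>C u) = u)
      \<longleftrightarrow> (\<forall>u v. (u, v) \<in> A \<longrightarrow> R (v - z *\<^sub>C u) = u)"
    using uapply_mem[OF assms] uapply_eq[OF assms] by (metis Domain.DomainI)
  ultimately show ?thesis unfolding is_resolvent_def by simp
qed

lemma resolvent_eqI:
  assumes "linear_uop A" "is_resolvent A z R"
  shows "resolvent A z = R"
  unfolding resolvent_def
proof (rule the_equality)
  fix R' assume "is_resolvent A z R'"
  show "R' = R"
  proof (rule blinfun_eqI)
    fix h
    have "(R h, h + z *\<^sub>C R h) \<in> A"
      using assms is_resolvent_iff by blast
    then have "R' (h + z *\<^sub>C R h - z *\<^sub>C R h) = R h"
      using \<open>is_resolvent A z R'\<close> assms is_resolvent_iff by blast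
    then show "R' h = R h" by simp
  qed
qed (rule assms)

lemma is_resolvent_resolvent:
  assumes "linear_uop A" "z \<notin> Spec A"
  shows "is_resolvent A z (resolvent A z)"
proof -
  obtain R where "is_resolvent A z R" using assms(2) by (auto simp: Spec_def)
  then show ?thesis using resolvent_eqI[OF assms(1)] by simp
qed

lemma resolvent_mem:
  assumes "linear_uop A" "z \<notin> Spec A"
  shows "(resolvent A z h, h + z *\<^sub>C resolvent A z h) \<in> A"
  using is_resolvent_resolvent[OF assms] unfolding is_resolvent_iff[OF assms(1)] by blast

lemma resolvent_left:
  assumes "linear_uop A" "z \<notin> Spec A" "(u, v) \<in> A"
  shows "resolvent A z (v - z *\<^sub>C u) = u"
  using is_resolvent_resolvent[OF assms(1,2)] assms(3) unfolding is_resolvent_iff[OF assms(1)] by blast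

lemma resolvent_scaleC:
  assumes "linear_uop A" "z \<notin> Spec A"
  shows "resolvent A z (c *\<^sub>C h) = c *\<^sub>C resolvent A z h"
proof -
  have "(c *\<^sub>C resolvent A z h, c *\<^sub>C (h + z *\<^sub>C resolvent A z h)) \<in> A"
    by (intro uop_scale resolvent_mem assms)
  from resolvent_left[OF assms this] show ?thesis
    by (simp add: scaleC_add_right scaleC_scaleC mult.commute)
qed

lemma resolvent_identity:
  assumes "linear_uop A" "z \<notin> Spec A" "w \<notin> Spec A"
  shows "resolvent A z h - resolvent A w h
    = (z - w) *\<^sub>C resolvent A z (resolvent A w h)"
proof -
  define u where "u = resolvent A w h"
  have "resolvent A z (h + w *\<^sub>C u - z *\<^sub>C u) = u"
    using resolvent_left[OF assms(1,2) resolvent_mem[OF assms(1,3)]] by (simp add: u_def)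
  moreover have "h + w *\<^sub>C u - z *\<^sub>C u = h - (z - w) *\<^sub>C u"
    by (simp add: scaleC_diff_left)
  ultimately have "resolvent A z h - (z - w) *\<^sub>C resolvent A z u = u"
    by (simp add: blinfun.diff_right resolvent_scaleC[OF assms(1,2)])
  then show ?thesis unfolding u_def by (simp add: algebra_simps)
qed

lemma resolvent_lower_bound:
  assumes "linear_uop A" "z \<notin> Spec A" "(u, v) \<in> A"
  shows "norm u \<le> norm (resolvent A z) * norm (v - z *\<^sub>C u)"
  using norm_blinfun[of "resolvent A z" "v - z *\<^sub>C u"] resolvent_left[OF assms] by simp

text \<open>
  A lower bound at \<open>z\<close> makes the range of \<open>A - z\<close> closed, and the one at the conjugate of \<open>z\<close> makes its
  orthogonal complement trivial, because that complement consists of eigenvectors of \<open>A\<close> for the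
  conjugate of \<open>z\<close>.
\<close>

lemma resolvent_of_lower_bounds:
  fixes A :: "'a::chilbert_space uop"
  assumes A: "self_adjoint_uop A" and c: "c > 0"
    and lb: "\<And>u v. (u, v) \<in> A \<Longrightarrow> c * norm u \<le> norm (v - z *\<^sub>C u)"
    and lb': "\<And>u v. (u, v) \<in> A \<Longrightarrow> c * norm u \<le> norm (v - cnj z *\<^sub>C u)"
  shows "z \<notin> Spec A" and "norm (resolvent A z) \<le> 1 / c"
proof -
  note lin = self_adjoint_linear[OF A]
  define V where "V = (\<lambda>(u, v). v - z *\<^sub>C u) ` A"
  have sub: "complex_vector.subspace V"
    unfolding complex_vector.subspace_def V_def
  proof (safe)
    show "0 \<in> (\<lambda>(u, v). v - z *\<^sub>C u) ` A" using uop_zero[OF lin] by force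
  next
    fix u v u' v' assume "(u, v) \<in> A" "(u', v') \<in> A"
    from uop_add[OF lin this] show "v - z *\<^sub>C u + (v' - z *\<^sub>C u') \<in> (\<lambda>(u, v). v - z *\<^sub>C u) ` A"
      by (rule rev_image_eqI) (simp add: scaleC_add_right)
  next
    fix b u v assume "(u, v) \<in> A"
    from uop_scale[OF lin this, of b] show "b *\<^sub>C (v - z *\<^sub>C u) \<in> (\<lambda>(u, v). v - z *\<^sub>C u) ` A"
      by (rule rev_image_eqI) (simp add: scaleC_diff_right scaleC_scaleC mult.commute)
  qed
  have clo: "closed V"
    unfolding closed_sequential_limits
  proof (intro allI impI, elim conjE)
    fix h l assume h: "\<forall>n::nat. h n \<in> V" and l: "h \<longlonglongrightarrow> l"
    have "\<exists>u v. (u, v) \<in> A \<and> h n = v - z *\<^sub>C u" for n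
      using h[rule_format, of n] unfolding V_def by auto
    then obtain u v where uv: "\<And>n. (u n, v n) \<in> A" "\<And>n. h n = v n - z *\<^sub>C u n" by metis
    have *: "norm (u m - u n) \<le> norm (h m - h n) / c" for m n
      using lb[OF uop_diff[OF lin uv(1)[of m] uv(1)[of n]]] c
      by (simp add: uv(2) scaleC_diff_right field_simps)
    have "Cauchy u"
    proof (rule metric_CauchyI)
      fix e :: real assume "e > 0"
      then obtain M where "\<And>m n. m \<ge> M \<Longrightarrow> n \<ge> M \<Longrightarrow> dist (h m) (h n) < e * c"
        using metric_CauchyD[OF LIMSEQ_imp_Cauchy[OF l], of "e * c"] c by auto
      then have "dist (u m) (u n) < e" if "m \<ge> M" "n \<ge> M" for m n
      proof -
        have "norm (h m - h n) / c < e"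
          using \<open>\<And>m n. m \<ge> M \<Longrightarrow> n \<ge> M \<Longrightarrow> dist (h m) (h n) < e * c\<close>[OF that] c
          by (simp add: dist_norm pos_divide_less_eq)
        then show ?thesis using *[of m n] by (simp add: dist_norm)
      qed
      then show "\<exists>M. \<forall>m\<ge>M. \<forall>n\<ge>M. dist (u m) (u n) < e" by blast
    qed
    then obtain u0 where u0: "u \<longlonglongrightarrow> u0" using Cauchy_convergent convergent_def by blast
    have "(\<lambda>n. h n + z *\<^sub>C u n) \<longlonglongrightarrow> l + z *\<^sub>C u0" by (intro tendsto_intros u0 l)
    then have v0: "v \<longlonglongrightarrow> l + z *\<^sub>C u0" by (simp add: uv(2))
    have "(u0, l + z *\<^sub>C u0) \<in> A"
    proof (rule self_adjoint_memI[OF A])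
      fix x y assume xy: "(x, y) \<in> A"
      have "(\<lambda>n. \<langle>y, u n\<rangle>) \<longlonglongrightarrow> \<langle>y, u0\<rangle>" by (intro tendsto_intros u0)
      moreover have "(\<lambda>n. \<langle>x, v n\<rangle>) \<longlonglongrightarrow> \<langle>x, l + z *\<^sub>C u0\<rangle>" by (intro tendsto_intros v0)
      moreover have "\<langle>y, u n\<rangle> = \<langle>x, v n\<rangle>" for n
        by (rule self_adjoint_symmetric[OF A xy uv(1)])
      ultimately show "\<langle>y, u0\<rangle> = \<langle>x, l + z *\<^sub>C u0\<rangle>" using LIMSEQ_unique by simp
    qed
    then show "l \<in> V" unfolding V_def by (rule rev_image_eqI) simp
  qed
  have "V = UNIV"
  proof (rule closed_subspace_eq_UNIV[OF sub clo])
    fix x assume x: "\<And>v. v \<in> V \<Longrightarrow> \<langle>v, x\<rangle> = 0"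
    have "(x, cnj z *\<^sub>C x) \<in> A"
    proof (rule self_adjoint_memI[OF A])
      fix u v assume "(u, v) \<in> A"
      then have "\<langle>v - z *\<^sub>C u, x\<rangle> = 0" by (intro x) (force simp: V_def)
      then show "\<langle>v, x\<rangle> = \<langle>u, cnj z *\<^sub>C x\<rangle>" by (simp add: cinner_algebra)
    qed
    from lb'[OF this] c have "norm x \<le> 0" by (simp add: mult_le_0_iff)
    then show "x = 0" by simp
  qed
  then have "\<exists>u. (u, h + z *\<^sub>C u) \<in> A" for h
  proof -
    have "h \<in> V" using \<open>V = UNIV\<close> by simp
    then obtain a b where "(a, b) \<in> A" "h = b - z *\<^sub>C a" by (auto simp: V_def)
    then show ?thesis by (intro exI[of _ a]) simp
  qed
  then obtain f where f: "\<And>h. (f h, h + z *\<^sub>C f h) \<in> A" by metis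
  have f_left: "f (v - z *\<^sub>C u) = u" if "(u, v) \<in> A" for u v
    using lb[OF uop_diff[OF lin f[of "v - z *\<^sub>C u"] that]] c
    by (simp add: scaleC_diff_right mult_le_0_iff algebra_simps)
  have f_bound: "norm (f h) \<le> norm h * (1 / c)" for h
    using lb[OF f[of h]] c by (simp add: field_simps)
  have "bounded_linear f"
  proof (rule bounded_linear_intro[where K = "1 / c"])
    fix x y :: 'a
    show "f (x + y) = f x + f y"
      using f_left[OF uop_add[OF lin f[of x] f[of y]]] by (simp add: algebra_simps scaleC_add_right)
  next
    fix r and x :: 'a
    show "f (r *\<^sub>R x) = r *\<^sub>R f x"
      using f_left[OF uop_scale[OF lin f[of x], of "of_real r"]]
      by (simp add: scaleR_add_right scaleC_scaleR_commute flip: scaleR_scaleC)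
  qed (rule f_bound)
  then have ap: "blinfun_apply (Blinfun f) = f" by (rule bounded_linear_Blinfun_apply)
  have res: "is_resolvent A z (Blinfun f)"
    unfolding is_resolvent_iff[OF lin] ap using f f_left by simp
  then show "z \<notin> Spec A" by (auto simp: Spec_def)
  show "norm (resolvent A z) \<le> 1 / c"
    unfolding resolvent_eqI[OF lin res]
    by (rule norm_blinfun_bound) (use c f_bound in \<open>auto simp: ap mult.commute\<close>)
qed

text \<open>
  The two parts of \<open>v - z u = (v - Re z u) - \<i> Im z u\<close> are orthogonal in the real inner product, because
  \<open>\<langle>v - Re z u, u\<rangle>\<close> is real.
\<close>

lemma norm_shift_square:
  assumes A: "self_adjoint_uop A" and uv: "(u, v) \<in> A"
  shows "(norm (v - z *\<^sub>C u))\<^sup>2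
    = (norm (v - complex_of_real (Re z) *\<^sub>C u))\<^sup>2 + (Im z)\<^sup>2 * (norm u)\<^sup>2"
proof -
  define w where "w = v - complex_of_real (Re z) *\<^sub>C u"
  define s where "s = \<i> * complex_of_real (Im z)"
  have "Im \<langle>v, u\<rangle> = Im \<langle>u, v\<rangle>"
    by (rule arg_cong[OF self_adjoint_symmetric[OF A uv uv]])
  moreover have "Im \<langle>v, u\<rangle> = - Im \<langle>u, v\<rangle>"
    using arg_cong[OF cinner_commute[of v u], of Im] by simp
  ultimately have im: "Im \<langle>w, u\<rangle> = 0"
    by (simp add: w_def cinner_algebra cinner_self)
  have "v - z *\<^sub>C u = w - s *\<^sub>C u"
    by (subst complex_eq[of z]) (simp add: w_def s_def scaleC_add_left)
  moreover have "w \<bullet> (s *\<^sub>C u) = 0"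
    using im by (simp add: inner_eq_Re_cinner cinner_scaleC_right s_def)
  ultimately have "(norm (v - z *\<^sub>C u))\<^sup>2 = (norm w)\<^sup>2 + (norm (s *\<^sub>C u))\<^sup>2"
    using norm_diff_scaleR_square[of w 1 "s *\<^sub>C u"] by (simp add: dot_square_norm)
  then show ?thesis by (simp add: w_def s_def norm_scaleC norm_mult power_mult_distrib)
qed

lemma Im_lower_bound:
  assumes A: "self_adjoint_uop A" and uv: "(u, v) \<in> A"
  shows "\<bar>Im z\<bar> * norm u \<le> norm (v - z *\<^sub>C u)"
proof (rule power2_le_imp_le)
  show "(\<bar>Im z\<bar> * norm u)\<^sup>2 \<le> (norm (v - z *\<^sub>C u))\<^sup>2"
    unfolding norm_shift_square[OF assms, of z] by (simp add: power_mult_distrib)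
qed auto

lemma nonreal_notin_Spec:
  fixes A :: "'a::chilbert_space uop"
  assumes A: "self_adjoint_uop A" and z: "Im z \<noteq> 0"
  shows "z \<notin> Spec A" "norm (resolvent A z) \<le> 1 / \<bar>Im z\<bar>"
  using resolvent_of_lower_bounds[OF A, of "\<bar>Im z\<bar>" z] z Im_lower_bound[OF A, of _ _ z]
    Im_lower_bound[OF A, of _ _ "cnj z"] by auto

lemma cnj_notin_Spec:
  fixes A :: "'a::chilbert_space uop"
  assumes "self_adjoint_uop A" "z \<notin> Spec A"
  shows "cnj z \<notin> Spec A"
proof (cases "Im z = 0")
  case True
  then have "cnj z = z" by (simp add: complex_eq_iff)
  then show ?thesis using assms by simp
next
  case False
  then show ?thesis using nonreal_notin_Spec[OF assms(1), of "cnj z"] by simp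
qed

lemma resolvent_adjoint:
  fixes A :: "'a::chilbert_space uop"
  assumes A: "self_adjoint_uop A" and z: "z \<notin> Spec A"
  shows "\<langle>resolvent A z x, y\<rangle> = \<langle>x, resolvent A (cnj z) y\<rangle>"
proof -
  note lin = self_adjoint_linear[OF A]
  show ?thesis
    using self_adjoint_symmetric[OF A resolvent_mem[OF lin z, of x]
        resolvent_mem[OF lin cnj_notin_Spec[OF A z], of y]]
    by (simp add: cinner_algebra)
qed

text \<open>
  For a bounded self-adjoint \<open>R\<close> of norm \<open>q\<close>, the operator \<open>R\<^sup>2 - q\<^sup>2 = (R - q) (R + q)\<close> is not bounded
  below, so one of its factors is not.  For the resolvent \<open>R = (A - a)\<^sup>-\<^sup>1\<close> this places \<open>a + 1/q\<close>
  or \<open>a - 1/q\<close> in the spectrum; hence a spectral gap of radius \<open>d\<close> around \<open>a\<close> forces \<open>q \<le> 1/d\<close>.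
\<close>

lemma gap_lower_bound:
  fixes A :: "'a::chilbert_space uop"
  assumes A: "self_adjoint_uop A"
    and gap: "\<And>x. \<bar>x - a\<bar> < d \<Longrightarrow> complex_of_real x \<notin> Spec A"
    and uv: "(u, v) \<in> A"
  shows "d * norm u \<le> norm (v - complex_of_real a *\<^sub>C u)"
proof (rule ccontr)
  assume neg: "\<not> ?thesis"
  note lin = self_adjoint_linear[OF A]
  have "d > 0"
  proof (rule ccontr)
    assume "\<not> d > 0"
    then have "d * norm u \<le> 0" by (simp add: mult_le_0_iff)
    then show False using neg by (meson norm_ge_zero order_trans)
  qed
  define R where "R = resolvent A (complex_of_real a)"
  define q where "q = norm R"
  have a: "complex_of_real a \<notin> Spec A" using gap[of a] \<open>d > 0\<close> by simp
  have u0: "norm u > 0" using neg by (cases "u = 0") auto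
  have "norm u \<le> q * norm (v - complex_of_real a *\<^sub>C u)"
    using resolvent_lower_bound[OF lin a uv] by (simp add: R_def q_def)
  moreover have q0: "q \<ge> 0" by (simp add: q_def)
  ultimately have "norm u \<le> q * (d * norm u)" using neg
    by (meson less_imp_le mult_left_mono not_le order_trans)
  moreover have "q \<noteq> 0" using \<open>norm u \<le> q * norm _\<close> u0 by auto
  ultimately have qpos: "q > 0" and "q * d > 1"
  proof -
    show "q > 0" using q0 \<open>q \<noteq> 0\<close> by simp
    have "q * norm (v - complex_of_real a *\<^sub>C u) < q * (d * norm u)"
      using neg \<open>q > 0\<close> by simp
    then have "norm u < q * d * norm u"
      using \<open>norm u \<le> q * norm (v - complex_of_real a *\<^sub>C u)\<close> by simp
    then show "q * d > 1" using u0 by simp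
  qed
  then have inv: "1 / q < d" by (simp add: field_simps)
  \<comment> \<open>a constant for the lower bounds at both points \<open>a + 1/q\<close> and \<open>a - 1/q\<close>\<close>
  define N where "N = 1 + norm (resolvent A (complex_of_real (a + 1 / q)))
    + norm (resolvent A (complex_of_real (a - 1 / q)))"
  have N: "N > 0" unfolding N_def by (simp add: add_pos_nonneg)
  have lbp: "norm u \<le> N * norm (v - complex_of_real (a + 1 / q) *\<^sub>C u)" if "(u, v) \<in> A" for u v
  proof -
    have "complex_of_real (a + 1 / q) \<notin> Spec A" using inv qpos by (intro gap) simp
    from resolvent_lower_bound[OF lin this that] show ?thesis
      by (rule order_trans) (intro mult_right_mono, simp_all add: N_def)
  qed
  have lbm: "norm u \<le> N * norm (v - complex_of_real (a - 1 / q) *\<^sub>C u)" if "(u, v) \<in> A" for u v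
  proof -
    have "complex_of_real (a - 1 / q) \<notin> Spec A" using inv qpos by (intro gap) simp
    from resolvent_lower_bound[OF lin this that] show ?thesis
      by (rule order_trans) (intro mult_right_mono, simp_all add: N_def)
  qed
  have mem: "(R h, h + complex_of_real a *\<^sub>C R h) \<in> A" for h
    unfolding R_def by (rule resolvent_mem[OF lin a])
  have minus: "norm (R h) \<le> (N / q) * norm (R h - q *\<^sub>R h)" for h
  proof -
    have e: "h + complex_of_real a *\<^sub>C R h - complex_of_real (a + 1 / q) *\<^sub>C R h
        = (- 1 / q) *\<^sub>R (R h - q *\<^sub>R h)"
      using qpos by (simp add: scaleC_add_left scaleC_diff_right scaleC_minus_left scaleC_scaleC scaleR_scaleC scaleC_one)
    show ?thesis using lbp[OF mem[of h]] qpos unfolding e by simp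
  qed
  have plus: "norm (R h) \<le> (N / q) * norm (R h + q *\<^sub>R h)" for h
  proof -
    have e: "h + complex_of_real a *\<^sub>C R h - complex_of_real (a - 1 / q) *\<^sub>C R h
        = (1 / q) *\<^sub>R (R h + q *\<^sub>R h)"
      using qpos by (simp add: scaleC_diff_left scaleC_add_right scaleC_scaleC scaleR_scaleC scaleC_one)
    show ?thesis using lbm[OF mem[of h]] qpos unfolding e by simp
  qed
  have Radj: "\<langle>R x, y\<rangle> = \<langle>x, R y\<rangle>" for x y
    unfolding R_def using resolvent_adjoint[OF A a] by simp
  \<comment> \<open>The lower bounds for \<open>R - q\<close> and \<open>R + q\<close> improve \<open>norm (R x) \<le> q norm x\<close> by a fixed amount \<open>\<epsilon>\<close>,
    which contradicts the definition of \<open>q\<close>.\<close>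
  define \<kappa> where "\<kappa> = (q / N) ^ 4"
  have \<kappa>: "\<kappa> > 0" using qpos N by (simp add: \<kappa>_def)
  define \<epsilon> where "\<epsilon> = min (q\<^sup>2 / 2) (\<kappa> * q\<^sup>2 / 4)"
  have \<epsilon>: "\<epsilon> > 0" "\<epsilon> \<le> q\<^sup>2 / 2" "\<epsilon> \<le> \<kappa> * q\<^sup>2 / 4" using qpos \<kappa> by (auto simp: \<epsilon>_def)
  have key: "(norm (R x))\<^sup>2 \<le> (q\<^sup>2 - \<epsilon>) * (norm x)\<^sup>2" for x
  proof (cases "x = 0")
    case False
    define n s where "n = (norm x)\<^sup>2" and "s = (norm (R x))\<^sup>2"
    define y where "y = R (R x)"
    have n: "n > 0" using False by (simp add: n_def)
    have yx: "\<langle>y, x\<rangle> = complex_of_real s"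
      unfolding s_def y_def cinner_self[symmetric] by (rule Radj)
    then have ip: "Re \<langle>y, x\<rangle> = s" by simp
    have s_le: "s \<le> norm y * norm x"
      using norm_cinner_le[of y x] abs_ge_self[of s] unfolding yx norm_of_real by linarith
    have "(norm (y - q\<^sup>2 *\<^sub>R x))\<^sup>2 = (norm y)\<^sup>2 - 2 * q\<^sup>2 * s + q^4 * n"
      using norm_diff_scaleR_square[of y "q\<^sup>2" x] ip
      by (simp add: inner_eq_Re_cinner[of y x] n_def dot_square_norm flip: power_mult)
    moreover have "(norm y)\<^sup>2 \<le> q\<^sup>2 * s"
      using power_mono[OF norm_blinfun[of R "R x"], of 2]
      by (simp add: y_def q_def s_def power_mult_distrib)
    ultimately have up: "(norm (y - q\<^sup>2 *\<^sub>R x))\<^sup>2 \<le> q\<^sup>2 * (q\<^sup>2 * n - s)"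
      by (simp add: algebra_simps power4_eq_xxxx power2_eq_square)
    have fac: "y - q\<^sup>2 *\<^sub>R x = R (R x + q *\<^sub>R x) - q *\<^sub>R (R x + q *\<^sub>R x)"
      by (simp add: y_def blinfun.add_right blinfun.scaleR_right scaleR_add_right power2_eq_square)
    have "norm y \<le> (N / q) * norm (y + q *\<^sub>R R x)"
      using plus[of "R x"] by (simp add: y_def)
    also have "y + q *\<^sub>R R x = R (R x + q *\<^sub>R x)"
      by (simp add: y_def blinfun.add_right blinfun.scaleR_right)
    also have "(N / q) * norm \<dots> \<le> (N / q) * ((N / q) * norm (y - q\<^sup>2 *\<^sub>R x))"
      unfolding fac using N qpos by (intro mult_left_mono minus) auto
    finally have "norm y \<le> (N / q)\<^sup>2 * norm (y - q\<^sup>2 *\<^sub>R x)"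
      by (simp add: power2_eq_square mult.assoc)
    then have "(q / N)\<^sup>2 * norm y \<le> norm (y - q\<^sup>2 *\<^sub>R x)"
      using N qpos by (simp add: field_simps power_divide)
    then have "((q / N)\<^sup>2 * norm y)\<^sup>2 \<le> (norm (y - q\<^sup>2 *\<^sub>R x))\<^sup>2"
      using N qpos by (intro power_mono) auto
    then have "\<kappa> * (norm y)\<^sup>2 \<le> q\<^sup>2 * (q\<^sup>2 * n - s)"
      using up by (simp add: \<kappa>_def power_mult_distrib flip: power_mult)
    moreover have "s\<^sup>2 \<le> (norm y)\<^sup>2 * n"
      using power_mono[OF s_le, of 2] by (simp add: n_def power_mult_distrib s_def)
    ultimately have main: "\<kappa> * s\<^sup>2 \<le> q\<^sup>2 * (q\<^sup>2 * n - s) * n"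
    proof -
      assume a: "\<kappa> * (norm y)\<^sup>2 \<le> q\<^sup>2 * (q\<^sup>2 * n - s)" and b: "s\<^sup>2 \<le> (norm y)\<^sup>2 * n"
      have "\<kappa> * s\<^sup>2 \<le> \<kappa> * ((norm y)\<^sup>2 * n)" using b \<kappa> by (intro mult_left_mono) auto
      also have "\<dots> = (\<kappa> * (norm y)\<^sup>2) * n" by simp
      also have "\<dots> \<le> q\<^sup>2 * (q\<^sup>2 * n - s) * n" using a n by (intro mult_right_mono) auto
      finally show ?thesis .
    qed
    have "s \<le> (q\<^sup>2 - \<epsilon>) * n"
    proof (cases "s \<le> q\<^sup>2 / 2 * n")
      case True
      have "q\<^sup>2 / 2 * n \<le> (q\<^sup>2 - \<epsilon>) * n" using \<epsilon>(2) n by (intro mult_right_mono) auto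
      then show ?thesis using True by linarith
    next
      case False
      then have "(q\<^sup>2 / 2 * n)\<^sup>2 \<le> s\<^sup>2" using n by (intro power_mono) auto
      then have "\<kappa> * (q\<^sup>2 / 2 * n)\<^sup>2 \<le> \<kappa> * s\<^sup>2" using \<kappa> by (intro mult_left_mono) auto
      then have "\<kappa> * (q\<^sup>2 / 2 * n)\<^sup>2 \<le> q\<^sup>2 * (q\<^sup>2 * n - s) * n" using main by linarith
      moreover have "\<kappa> * (q\<^sup>2 / 2 * n)\<^sup>2 = q\<^sup>2 * (\<kappa> * q\<^sup>2 / 4 * n) * n"
        by (simp add: power2_eq_square)
      ultimately have "q\<^sup>2 * (\<kappa> * q\<^sup>2 / 4 * n) * n \<le> q\<^sup>2 * (q\<^sup>2 * n - s) * n"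
        by (simp only:)
      then have "\<kappa> * q\<^sup>2 / 4 * n \<le> q\<^sup>2 * n - s"
        using n qpos by (simp only: mult_le_cancel_right_pos mult_le_cancel_left_pos zero_less_power)
      moreover have "\<epsilon> * n \<le> \<kappa> * q\<^sup>2 / 4 * n" using \<epsilon>(3) n by (intro mult_right_mono) auto
      ultimately show ?thesis by (simp add: algebra_simps)
    qed
    then show ?thesis by (simp add: n_def s_def)
  qed simp
  have nn: "q\<^sup>2 - \<epsilon> \<ge> 0" using \<epsilon>(2) zero_le_power2[of q] by linarith
  have "norm R \<le> sqrt (q\<^sup>2 - \<epsilon>)"
  proof (rule norm_blinfun_bound)
    show "norm (R x) \<le> sqrt (q\<^sup>2 - \<epsilon>) * norm x" for x
      using real_sqrt_le_mono[OF key[of x]] by (simp add: real_sqrt_mult)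
  qed (use nn in simp)
  then have "q\<^sup>2 \<le> q\<^sup>2 - \<epsilon>" unfolding q_def[symmetric]
    using power_mono[of q "sqrt (q\<^sup>2 - \<epsilon>)" 2] q0 nn by simp
  then show False using \<epsilon>(1) by simp
qed

text \<open>
  The real part of \<open>z\<close> is the centre of a spectral gap, because it keeps a distance from \<open>l\<close>; the imaginary
  part contributes by orthogonality (\<open>norm_shift_square\<close>).
\<close>

lemma punctured_disc_lower_bound:
  fixes A :: "'a::chilbert_space uop"
  assumes A: "self_adjoint_uop A" and l: "Im l = 0"
    and gap: "\<And>z. z \<noteq> l \<Longrightarrow> dist l z < \<rho> \<Longrightarrow> z \<notin> Spec A"
    and z: "dist l z < \<rho>" and uv: "(u, v) \<in> A"
  shows "min (dist l z) (\<rho> - dist l z) * norm u \<le> norm (v - z *\<^sub>C u)"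
proof (rule power2_le_imp_le)
  define a where "a = \<bar>Re z - Re l\<bar>"
  have dl: "(dist l z)\<^sup>2 = a\<^sup>2 + (Im z)\<^sup>2"
    using l by (simp add: dist_norm cmod_power2 a_def power2_commute)
  have a0: "a \<ge> 0" by (simp add: a_def)
  have ad: "a \<le> dist l z"
    by (rule power2_le_imp_le) (auto simp: dl)
  define d where "d = min a (\<rho> - a)"
  have d0: "d \<ge> 0" using a0 ad z by (auto simp: d_def)
  have "d * norm u \<le> norm (v - complex_of_real (Re z) *\<^sub>C u)"
  proof (rule gap_lower_bound[OF A _ uv])
    fix x assume x: "\<bar>x - Re z\<bar> < d"
    have ll: "l = complex_of_real (Re l)" using l by (simp add: complex_eq_iff)
    have "complex_of_real x \<noteq> l"
      using x by (auto simp: d_def a_def complex_eq_iff)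
    moreover have "dist l (complex_of_real x) < \<rho>"
    proof -
      have "dist l (complex_of_real x) = \<bar>Re l - x\<bar>"
        by (subst ll) (simp only: dist_norm of_real_diff[symmetric] norm_of_real)
      then show ?thesis using x by (auto simp: d_def a_def)
    qed
    ultimately show "complex_of_real x \<notin> Spec A" by (rule gap)
  qed
  then have "(d * norm u)\<^sup>2 \<le> (norm (v - complex_of_real (Re z) *\<^sub>C u))\<^sup>2"
    using d0 by (intro power_mono) auto
  then have low: "(d\<^sup>2 + (Im z)\<^sup>2) * (norm u)\<^sup>2 \<le> (norm (v - z *\<^sub>C u))\<^sup>2"
    unfolding norm_shift_square[OF A uv, of z] by (simp add: power_mult_distrib algebra_simps)
  have "(min (dist l z) (\<rho> - dist l z))\<^sup>2 \<le> d\<^sup>2 + (Im z)\<^sup>2"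
  proof (cases "a \<le> \<rho> - a")
    case True
    have "(min (dist l z) (\<rho> - dist l z))\<^sup>2 \<le> (dist l z)\<^sup>2"
      using z by (intro power_mono) auto
    then show ?thesis using dl True by (simp add: d_def)
  next
    case False
    have "(min (dist l z) (\<rho> - dist l z))\<^sup>2 \<le> (\<rho> - a)\<^sup>2"
      using z ad by (intro power_mono) auto
    also have "\<dots> \<le> (\<rho> - a)\<^sup>2 + (Im z)\<^sup>2" by simp
    finally show ?thesis using False by (simp add: d_def)
  qed
  from mult_right_mono[OF this, of "(norm u)\<^sup>2"]
  show "(min (dist l z) (\<rho> - dist l z) * norm u)\<^sup>2 \<le> (norm (v - z *\<^sub>C u))\<^sup>2"
    using low by (simp add: power_mult_distrib)
qed simp

section \<open>Operator-valued contour integrals\<close>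

lemma scaleC_blinfun_apply [simp]: "scaleC_blinfun c F x = c *\<^sub>C F x"
  by transfer simp

lemma norm_scaleC_blinfun_le: "norm (scaleC_blinfun c F) \<le> cmod c * norm F"
proof (rule norm_blinfun_bound)
  show "norm (scaleC_blinfun c F x) \<le> cmod c * norm F * norm x" for x
    using mult_left_mono[OF norm_blinfun[of F x], of "cmod c"] by (simp add: norm_scaleC mult.assoc)
qed simp

lemma bounded_bilinear_scaleC_blinfun:
  "bounded_bilinear (scaleC_blinfun :: complex \<Rightarrow> ('a::real_normed_vector \<Rightarrow>\<^sub>L 'b::complex_inner) \<Rightarrow> _)"
proof
  show "\<exists>K. \<forall>a b. norm (scaleC_blinfun a b :: 'a \<Rightarrow>\<^sub>L 'b) \<le> norm a * norm b * K"
    by (rule exI[of _ 1]) (simp add: norm_scaleC_blinfun_le)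
qed (auto intro!: blinfun_eqI simp: blinfun.add_left blinfun.scaleR_left scaleC_add_left
    scaleC_add_right scaleC_scaleC scaleR_scaleC scaleR_conv_of_real mult.commute)

lemma bounded_linear_cinner_blinfun:
  fixes x :: "'a::real_normed_vector" and y :: "'b::complex_inner"
  shows "bounded_linear (\<lambda>F :: 'a \<Rightarrow>\<^sub>L 'b. \<langle>F x, y\<rangle>)"
  using bounded_linear_compose[OF bounded_bilinear.bounded_linear_left[OF bounded_bilinear_cinner]
      bounded_bilinear.bounded_linear_left[OF bounded_bilinear_blinfun_apply]] .

lemma blinfun_contour_integrable:
  fixes F :: "complex \<Rightarrow> 'a::chilbert_space \<Rightarrow>\<^sub>L 'a"
  assumes "continuous_on (sphere l r) F" "r > 0"
  shows "(\<lambda>s. scaleC_blinfun (vector_derivative (circlepath l r) (at s within {0..1}))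
    (F (circlepath l r s))) integrable_on {0..1}"
proof -
  have "continuous_on {0..1} (\<lambda>s. scaleC_blinfun (2 * of_real pi * \<i> * of_real r * exp (2 * of_real pi * \<i> * of_real s))
    (F (circlepath l r s)))"
  proof (intro bounded_bilinear.continuous_on[OF bounded_bilinear_scaleC_blinfun])
    have "continuous_on {0..1} (circlepath l r)"
      using path_circlepath by (simp add: path_def)
    moreover have "circlepath l r ` {0..1} \<subseteq> sphere l r"
      using path_image_circlepath[of l r] assms(2) by (simp add: path_image_def)
    ultimately show "continuous_on {0..1} (\<lambda>s. F (circlepath l r s))"
      by (rule continuous_on_compose2[OF assms(1)])
  qed (intro continuous_intros)
  then have "(\<lambda>s. scaleC_blinfun (2 * of_real pi * \<i> * of_real r * exp (2 * of_real pi * \<i> * of_real s))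
    (F (circlepath l r s))) integrable_on {0..1}"
    by (rule integrable_continuous_interval)
  then show ?thesis
    by (rule integrable_eq) (simp add: vector_derivative_circlepath01)
qed

lemma cinner_blinfun_contour_integral:
  fixes F :: "complex \<Rightarrow> 'a::chilbert_space \<Rightarrow>\<^sub>L 'a"
  assumes "continuous_on (sphere l r) F" "r > 0"
  shows "((\<lambda>z. \<langle>F z x, y\<rangle>) has_contour_integral
    \<langle>blinfun_contour_integral (circlepath l r) F x, y\<rangle>) (circlepath l r)"
  using has_integral_linear[OF integrable_integral[OF blinfun_contour_integrable[OF assms]]
      bounded_linear_cinner_blinfun[of x y]]
  unfolding has_contour_integral_def blinfun_contour_integral_def
  by (simp add: o_def cinner_scaleC_left mult.commute)

lemma norm_blinfun_contour_integral_diff: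
  fixes F G :: "complex \<Rightarrow> 'a::chilbert_space \<Rightarrow>\<^sub>L 'a"
  assumes F: "continuous_on (sphere l r) F" and G: "continuous_on (sphere l r) G" and r: "r > 0"
    and M: "\<And>z. dist l z = r \<Longrightarrow> norm (F z - G z) \<le> M"
  shows "norm (blinfun_contour_integral (circlepath l r) F - blinfun_contour_integral (circlepath l r) G)
    \<le> 2 * pi * r * M"
proof -
  let ?d = "\<lambda>s. vector_derivative (circlepath l r) (at s within {0..1})"
  have "((\<lambda>s. scaleC_blinfun (?d s) (F (circlepath l r s)) - scaleC_blinfun (?d s) (G (circlepath l r s)))
      has_integral (blinfun_contour_integral (circlepath l r) F - blinfun_contour_integral (circlepath l r) G))
      (cbox 0 1)"
    unfolding blinfun_contour_integral_def cbox_interval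
    by (intro has_integral_diff integrable_integral blinfun_contour_integrable F G r)
  then have "norm (blinfun_contour_integral (circlepath l r) F - blinfun_contour_integral (circlepath l r) G)
    \<le> (2 * pi * r * M) * measure lborel (cbox 0 (1::real))"
  proof (rule has_integral_bound[rotated])
    fix s :: real assume s: "s \<in> cbox 0 1"
    have "circlepath l r s \<in> path_image (circlepath l r)"
      using s by (auto simp: path_image_def)
    then have "dist l (circlepath l r s) = r" using r by (simp add: path_image_circlepath)
    from M[OF this] have "cmod (?d s) * norm (F (circlepath l r s) - G (circlepath l r s)) \<le> (2 * pi * r) * M"
      using s r by (intro mult_mono) (auto simp: vector_derivative_circlepath01 norm_mult)
    then show "norm (scaleC_blinfun (?d s) (F (circlepath l r s)) - scaleC_blinfun (?d s) (G (circlepath l r s)))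
      \<le> 2 * pi * r * M"
      using norm_scaleC_blinfun_le[of "?d s" "F (circlepath l r s) - G (circlepath l r s)"]
      by (simp add: bounded_bilinear.diff_right[OF bounded_bilinear_scaleC_blinfun])
  next
    have "norm (F (l + of_real r) - G (l + of_real r)) \<le> M" using r by (intro M) (simp add: dist_norm)
    then have "M \<ge> 0" using norm_ge_zero order_trans by blast
    then show "0 \<le> 2 * pi * r * M" using r by simp
  qed
  then show ?thesis by simp
qed

lemma has_contour_integral_cong:
  "(f has_contour_integral I) g \<Longrightarrow> (\<And>z. z \<in> path_image g \<Longrightarrow> f z = h z) \<Longrightarrow> I = J \<Longrightarrow>
    (h has_contour_integral J) g"
  using has_contour_integral_eq by blast

text \<open>
  Conjugation reverses a circle whose centre is real.
\<close>

lemma has_contour_integral_circlepath_cnj: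
  assumes "(f has_contour_integral I) (circlepath l r)" and l: "Im l = 0"
    and J: "((\<lambda>z. cnj (f (cnj z))) has_contour_integral J) (circlepath l r)"
  shows "J = - cnj I"
proof -
  have "cnj \<circ> circlepath l r = reversepath (circlepath l r)"
  proof
    fix s :: real
    have "cnj l = l" using l by (simp add: complex_eq_iff)
    moreover have "exp (2 * of_real pi * \<i> * complex_of_real (1 - s)) = exp (- (2 * of_real pi * \<i> * complex_of_real s))"
    proof -
      have "2 * of_real pi * \<i> * complex_of_real (1 - s)
        = - (2 * of_real pi * \<i> * complex_of_real s) + 2 * of_real pi * \<i>"
        by (simp add: algebra_simps)
      then show ?thesis by (simp only: exp_add exp_two_pi_i mult_1_right)
    qed
    ultimately show "(cnj \<circ> circlepath l r) s = reversepath (circlepath l r) s"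
      by (simp add: circlepath reversepath_def exp_cnj)
  qed
  then have "- contour_integral (circlepath l r) f = cnj J"
    using contour_integral_cnj[of "circlepath l r" f] contour_integral_unique[OF J]
    by (simp add: contour_integral_reversepath o_def)
  then show ?thesis using contour_integral_unique[OF assms(1)]
    by (metis complex_cnj_cnj complex_cnj_minus)
qed

section \<open>Riesz projections of self-adjoint operators\<close>

lemma resolvent_lipschitz:
  assumes "linear_uop A" "z \<notin> Spec A" "w \<notin> Spec A"
    "norm (resolvent A z) \<le> M" "norm (resolvent A w) \<le> M"
  shows "norm (resolvent A z - resolvent A w) \<le> M * M * dist z w"
proof (rule norm_blinfun_bound)
  have M: "M \<ge> 0" using assms(4) norm_ge_zero order_trans by blast
  show "0 \<le> M * M * dist z w" using M by simp
  fix x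
  have "norm (resolvent A z (resolvent A w x)) \<le> M * (M * norm x)"
    by (rule order_trans[OF norm_blinfun])
      (intro mult_mono assms order_trans[OF norm_blinfun] mult_right_mono M norm_ge_zero)
  then have "dist z w * norm (resolvent A z (resolvent A w x))
      \<le> dist z w * (M * (M * norm x))"
    by (rule mult_left_mono) simp
  then show "norm ((resolvent A z - resolvent A w) x) \<le> M * M * dist z w * norm x"
    by (simp add: blinfun.diff_left resolvent_identity[OF assms(1-3)] norm_scaleC dist_norm mult_ac)
qed

lemma continuous_on_resolvent:
  assumes "linear_uop A" "\<And>z. z \<in> S \<Longrightarrow> z \<notin> Spec A" "\<And>z. z \<in> S \<Longrightarrow> norm (resolvent A z) \<le> M"
  shows "continuous_on S (resolvent A)"
proof (cases "S = {}")
  case False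
  then have "M \<ge> 0" using assms(3) norm_ge_zero order_trans by (metis all_not_in_conv)
  then have "(M * M)-lipschitz_on S (resolvent A)"
    using resolvent_lipschitz[OF assms(1)] assms(2,3) by (intro lipschitz_onI) (auto simp: dist_norm)
  then show ?thesis by (rule lipschitz_on_continuous_on)
qed simp

lemma annulus_path:
  fixes l :: complex
  assumes "0 \<le> a" "a < r" "r < b" "a < r'" "r' < b"
  shows "homotopic_loops {z. a < dist l z \<and> dist l z < b} (circlepath l r) (circlepath l r')"
proof (rule homotopic_loops_linear)
  fix t :: real assume t: "t \<in> {0..1}"
  define e where "e = exp (2 * of_real pi * \<i> * complex_of_real t)"
  have e: "cmod e = 1" by (simp add: e_def)
  show "closed_segment (circlepath l r t) (circlepath l r' t) \<subseteq> {z. a < dist l z \<and> dist l z < b}"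
  proof
    fix z assume "z \<in> closed_segment (circlepath l r t) (circlepath l r' t)"
    then obtain u where u: "0 \<le> u" "u \<le> 1"
      and z: "z = (1 - u) *\<^sub>R (l + of_real r * e) + u *\<^sub>R (l + of_real r' * e)"
      by (auto simp: closed_segment_def circlepath e_def)
    define \<rho> where "\<rho> = (1 - u) * r + u * r'"
    have "z = l + of_real \<rho> * e"
      by (simp add: z \<rho>_def scaleR_conv_of_real algebra_simps)
    moreover have "a < \<rho>" "\<rho> < b"
      using convex_bound_lt[of "- r" "- a" "- r'" "1 - u" u] convex_bound_lt[of r b r' "1 - u" u] u assms
      by (auto simp: \<rho>_def)
    ultimately show "z \<in> {z. a < dist l z \<and> dist l z < b}"
      using e assms(1) by (simp add: dist_norm norm_mult)
  qed
qed (auto simp: path_circlepath)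

text \<open>
  A circle around a real point inside an annulus on which the resolvent exists and is bounded.  The
  annulus leaves room for a second, smaller circle in the proof that the Riesz projection is idempotent.
\<close>

locale spectral_circle =
  fixes A :: "'a::chilbert_space uop" and l :: complex and r a b M :: real
  assumes self_adjoint: "self_adjoint_uop A" and real_center: "Im l = 0"
    and radii: "0 \<le> a" "a < r" "r < b"
    and annulus_notin: "\<And>z. a < dist l z \<Longrightarrow> dist l z < b \<Longrightarrow> z \<notin> Spec A"
    and annulus_bound: "\<And>z. a < dist l z \<Longrightarrow> dist l z < b \<Longrightarrow> norm (resolvent A z) \<le> M"
begin

abbreviation "P \<equiv> riesz_projection (circlepath l r) A"
abbreviation "S \<equiv> reduced_resolvent (circlepath l r) A l"
abbreviation "R \<equiv> resolvent A"

lemma linear: "linear_uop A"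
  by (rule self_adjoint_linear[OF self_adjoint])

lemma r_pos: "r > 0"
  using radii by simp

lemma abs_r [simp]: "\<bar>r\<bar> = r"
  using r_pos by simp

lemma continuous_on_R: "continuous_on {z. a < dist l z \<and> dist l z < b} R"
  by (rule continuous_on_resolvent[OF linear]) (use annulus_notin annulus_bound in auto)

lemma continuous_on_R_sphere: "continuous_on (sphere l r) R"
  by (rule continuous_on_subset[OF continuous_on_R]) (use radii in auto)

lemma circle_notin: "z \<in> sphere l r \<Longrightarrow> z \<notin> Spec A"
  using annulus_notin radii by simp

lemma circle_path_image: "z \<in> path_image (circlepath l r) \<longleftrightarrow> z \<in> sphere l r"
  using r_pos by (simp add: path_image_circlepath)

lemma riesz_cinner:
  "((\<lambda>z. \<langle>R z x, y\<rangle>) has_contour_integral - (2 * of_real pi * \<i>) * \<langle>P x, y\<rangle>)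
    (circlepath l r)"
  using cinner_blinfun_contour_integral[OF continuous_on_R_sphere r_pos, of x y]
  unfolding riesz_projection_def scaleC_blinfun_apply cinner_scaleC_left by simp

lemma reduced_cinner:
  "((\<lambda>z. \<langle>R z x, y\<rangle> / (l - z)) has_contour_integral
    - (2 * of_real pi * \<i>) * \<langle>S x, y\<rangle>) (circlepath l r)"
proof -
  have "continuous_on (sphere l r) (\<lambda>z. scaleC_blinfun (inverse (l - z)) (R z))"
    by (intro bounded_bilinear.continuous_on[OF bounded_bilinear_scaleC_blinfun] continuous_on_R_sphere
        continuous_intros) (use r_pos in auto)
  from cinner_blinfun_contour_integral[OF this r_pos, of x y] show ?thesis
  proof (rule has_contour_integral_cong)
    show "\<langle>scaleC_blinfun (inverse (l - z)) (R z) x, y\<rangle> = \<langle>R z x, y\<rangle> / (l - z)"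
      for z by (simp add: cinner_scaleC_left divide_inverse_commute)
  qed (simp only: reduced_resolvent_def scaleC_blinfun_apply cinner_scaleC_left, simp)
qed

lemma riesz_eqI:
  assumes "((\<lambda>z. \<langle>R z x, y\<rangle>) has_contour_integral - (2 * of_real pi * \<i>) * c) (circlepath l r)"
  shows "\<langle>P x, y\<rangle> = c"
  using has_contour_integral_unique[OF riesz_cinner assms] by simp

lemma reduced_eqI:
  assumes "((\<lambda>z. \<langle>R z x, y\<rangle> / (l - z)) has_contour_integral - (2 * of_real pi * \<i>) * c)
    (circlepath l r)"
  shows "\<langle>S x, y\<rangle> = c"
  using has_contour_integral_unique[OF reduced_cinner assms] by simp

lemma R_scaleC: "z \<in> sphere l r \<Longrightarrow> R z (c *\<^sub>C x) = c *\<^sub>C R z x"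
  by (rule resolvent_scaleC[OF linear circle_notin])

lemma riesz_scaleC: "P (c *\<^sub>C x) = c *\<^sub>C P x"
proof (rule cinner_eqI, rule riesz_eqI)
  fix y
  have "((\<lambda>z. c * \<langle>R z x, y\<rangle>) has_contour_integral
      c * (- (2 * of_real pi * \<i>) * \<langle>P x, y\<rangle>)) (circlepath l r)"
    by (intro has_contour_integral_lmul riesz_cinner)
  then show "((\<lambda>z. \<langle>R z (c *\<^sub>C x), y\<rangle>) has_contour_integral
      - (2 * of_real pi * \<i>) * \<langle>c *\<^sub>C P x, y\<rangle>) (circlepath l r)"
    by (rule has_contour_integral_cong)
      (simp_all add: circle_path_image R_scaleC cinner_scaleC_left)
qed

lemma clinear_riesz: "clinear (blinfun_apply P)"
  by (simp add: clinear_iff blinfun.add_right riesz_scaleC)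

lemma R_adjoint_cnj:
  assumes "z \<in> sphere l r"
  shows "\<langle>R z x, y\<rangle> = cnj \<langle>R (cnj z) y, x\<rangle>"
  using resolvent_adjoint[OF self_adjoint circle_notin[OF assms], of x y]
    cinner_commute[of x "R (cnj z) y"] by simp

lemma riesz_self_adjoint: "\<langle>P x, y\<rangle> = \<langle>x, P y\<rangle>"
proof -
  have "((\<lambda>z. cnj \<langle>R (cnj z) y, x\<rangle>) has_contour_integral
      - (2 * of_real pi * \<i>) * \<langle>P x, y\<rangle>) (circlepath l r)"
    by (rule has_contour_integral_eq[OF riesz_cinner]) (simp add: circle_path_image R_adjoint_cnj)
  from has_contour_integral_circlepath_cnj[OF riesz_cinner real_center this]
  have "\<langle>P x, y\<rangle> = cnj \<langle>P y, x\<rangle>" by simp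
  then show ?thesis using cinner_commute[of x "P y"] by simp
qed

lemma reduced_self_adjoint: "\<langle>S x, y\<rangle> = \<langle>x, S y\<rangle>"
proof -
  have l: "cnj l = l" using real_center by (simp add: complex_eq_iff)
  have "((\<lambda>z. cnj (\<langle>R (cnj z) y, x\<rangle> / (l - cnj z))) has_contour_integral
      - (2 * of_real pi * \<i>) * \<langle>S x, y\<rangle>) (circlepath l r)"
    by (rule has_contour_integral_eq[OF reduced_cinner]) (simp add: circle_path_image R_adjoint_cnj l)
  from has_contour_integral_circlepath_cnj[OF reduced_cinner real_center this]
  have "\<langle>S x, y\<rangle> = cnj \<langle>S y, x\<rangle>" by simp
  then show ?thesis using cinner_commute[of x "S y"] by simp
qed

text \<open>
  Under the integral sign this turns the action of \<open>A\<close>, tested against its graph, into multiplication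
  by \<open>z\<close>.
\<close>

lemma R_graph:
  assumes "z \<in> sphere l r" "(u, v) \<in> A"
  shows "\<langle>R z x, v\<rangle> = \<langle>x, u\<rangle> + z * \<langle>R z x, u\<rangle>"
  using self_adjoint_symmetric[OF self_adjoint resolvent_mem[OF linear circle_notin[OF assms(1)], of x] assms(2)]
  by (simp add: cinner_algebra)

lemma const_has_contour_integral_0: "((\<lambda>z. c) has_contour_integral 0) (circlepath l r)"
  by (rule Cauchy_theorem_disc_simple[where e = b and a = l])
    (use r_pos radii in \<open>auto simp: path_image_circlepath dist_commute\<close>)

text \<open>
  The value of \<open>A P x\<close> is the contour integral of \<open>z R z x\<close>, up to the factor of the Riesz projection;
  membership in the graph follows from \<open>A = A\<^sup>*\<close>.
\<close>

lemma riesz_in_domain: "\<exists>w. (P x, w) \<in> A"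
proof -
  define B where "B = scaleC_blinfun (- 1 / (2 * of_real pi * \<i>))
    (blinfun_contour_integral (circlepath l r) (\<lambda>z. scaleC_blinfun z (R z)))"
  have "continuous_on (sphere l r) (\<lambda>z. scaleC_blinfun z (R z))"
    by (intro bounded_bilinear.continuous_on[OF bounded_bilinear_scaleC_blinfun] continuous_on_R_sphere
        continuous_intros)
  from cinner_blinfun_contour_integral[OF this r_pos, of x]
  have B: "((\<lambda>z. z * \<langle>R z x, y\<rangle>) has_contour_integral
    - (2 * of_real pi * \<i>) * \<langle>B x, y\<rangle>) (circlepath l r)" for y
    unfolding B_def scaleC_blinfun_apply cinner_scaleC_left by simp
  have "(P x, B x) \<in> A"
  proof (rule self_adjoint_memI_left[OF self_adjoint], rule riesz_eqI)
    fix u v assume uv: "(u, v) \<in> A"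
    have "((\<lambda>z. \<langle>x, u\<rangle> + z * \<langle>R z x, u\<rangle>) has_contour_integral
        0 + - (2 * of_real pi * \<i>) * \<langle>B x, u\<rangle>) (circlepath l r)"
      by (intro has_contour_integral_add const_has_contour_integral_0 B)
    then show "((\<lambda>z. \<langle>R z x, v\<rangle>) has_contour_integral
        - (2 * of_real pi * \<i>) * \<langle>B x, u\<rangle>) (circlepath l r)"
      by (rule has_contour_integral_cong)
        (simp_all add: circle_path_image R_graph[OF _ uv])
  qed
  then show ?thesis by blast
qed

lemma riesz_commutes:
  assumes "(u, v) \<in> A"
  shows "(P u, P v) \<in> A"
proof (rule self_adjoint_memI_left[OF self_adjoint], rule riesz_eqI)
  fix x y assume xy: "(x, y) \<in> A"
  show "((\<lambda>z. \<langle>R z u, y\<rangle>) has_contour_integral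
      - (2 * of_real pi * \<i>) * \<langle>P v, x\<rangle>) (circlepath l r)"
  proof (rule has_contour_integral_eq[OF riesz_cinner])
    fix z assume "z \<in> path_image (circlepath l r)"
    then have z: "z \<in> sphere l r" by (simp add: circle_path_image)
    have "R z v = u + z *\<^sub>C R z u"
      using resolvent_left[OF linear circle_notin[OF z] assms]
      by (simp add: blinfun.diff_right R_scaleC[OF z] algebra_simps)
    then show "\<langle>R z v, x\<rangle> = \<langle>R z u, y\<rangle>"
      using R_graph[OF z xy, of u] by (simp add: cinner_algebra)
  qed
qed

lemma R_holomorphic:
  "(\<lambda>z. \<langle>R z x, y\<rangle>) holomorphic_on {z. a < dist l z \<and> dist l z < b}"
    (is "?f holomorphic_on ?D")
proof -
  have op: "open ?D"
    by (intro open_Collect_conj open_Collect_less continuous_intros)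
  have "(?f has_field_derivative \<langle>R w (R w x), y\<rangle>) (at w)" if w: "w \<in> ?D" for w
    unfolding has_field_derivative_iff
  proof (rule Lim_transform_within_open[OF _ op w])
    have "(R \<longlongrightarrow> R w) (at w)"
      using continuous_on_R op w by (simp add: continuous_on_eq_continuous_at isCont_def)
    then show "((\<lambda>z. \<langle>R z (R w x), y\<rangle>)
      \<longlongrightarrow> \<langle>R w (R w x), y\<rangle>) (at w)"
      by (intro tendsto_intros)
    fix z assume z: "z \<in> ?D" "z \<noteq> w"
    have "\<langle>R z x, y\<rangle> - \<langle>R w x, y\<rangle>
      = (z - w) * \<langle>R z (R w x), y\<rangle>"
      using resolvent_identity[OF linear annulus_notin annulus_notin, of z w x] z w
      by (simp flip: cinner_diff_left add: cinner_scaleC_left)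
    then show "\<langle>R z (R w x), y\<rangle> = (?f z - ?f w) / (z - w)"
      using z(2) by simp
  qed
  then show ?thesis
    using op by (auto simp: holomorphic_on_open)
qed

text \<open>
  The difference \<open>x - P x\<close> has \<open>\<langle>R (x - P x), y\<rangle>\<close> equal, on a smaller circle, to a Cauchy integral over
  the given circle; this is holomorphic in the whole disc, so integrating it over the smaller
  circle gives zero.
\<close>

lemma riesz_idempotent: "P (P x) = P x"
proof -
  have "\<langle>P (x - P x), y\<rangle> = 0" for y
  proof (rule riesz_eqI)
    define c where "c = 2 * of_real pi * \<i>"
    have c0: "c \<noteq> 0" by (simp add: c_def)
    define f where "f = (\<lambda>z. \<langle>R z x, y\<rangle>)"
    define g where "g = (\<lambda>z. \<langle>R z (x - P x), y\<rangle>)"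
    define H where "H = (\<lambda>z. contour_integral (circlepath l r) (\<lambda>w. f w / (w - z)))"
    define s where "s = (a + r) / 2"
    have s: "a < s" "s < r" "s > 0" using radii by (auto simp: s_def)
    have D: "z \<in> sphere l r \<or> z \<in> sphere l s \<Longrightarrow> a < dist l z \<and> dist l z < b" for z
      using radii s by auto
    have fcont: "continuous_on (path_image (circlepath l r)) f"
      unfolding f_def
      by (rule continuous_on_subset[OF holomorphic_on_imp_continuous_on[OF R_holomorphic]])
        (use D in \<open>auto simp: circle_path_image\<close>)
    have Hint: "((\<lambda>w. f w / (w - z) ^ 1) has_contour_integral H z) (circlepath l r)" if "z \<in> ball l r" for z
      unfolding H_def power_one_right
    proof (intro has_contour_integral_integral contour_integrable_continuous_circlepath)
      show "continuous_on (path_image (circlepath l r)) (\<lambda>w. f w / (w - z))"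
        by (intro continuous_intros fcont) (use that r_pos in \<open>auto simp: path_image_circlepath\<close>)
    qed
    have Hhol: "H holomorphic_on ball l r"
      unfolding holomorphic_on_open[OF open_ball]
    proof (intro ballI exI)
      fix z assume "z \<in> ball l r"
      then show "(H has_field_derivative complex_of_nat 1 * contour_integral (circlepath l r) (\<lambda>u. f u / (u - z) ^ Suc 1)) (at z)"
        by (intro Cauchy_next_derivative_circlepath(2)[OF fcont Hint]) auto
    qed
    have gH: "g z = H z / c" if z: "z \<in> sphere l s" for z
    proof -
      have zn: "z \<notin> Spec A" and zb: "z \<in> ball l r" using annulus_notin D z s by auto
      have "((\<lambda>w. f w / (w - z) - f z / (w - z)) has_contour_integral H z - c * f z) (circlepath l r)"
      proof (rule has_contour_integral_diff)
        show "((\<lambda>w. f w / (w - z)) has_contour_integral H z) (circlepath l r)"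
          using Hint[OF zb] by simp
        show "((\<lambda>w. f z / (w - z)) has_contour_integral c * f z) (circlepath l r)"
          unfolding c_def
          by (rule Cauchy_integral_circlepath_simple) (use zb in \<open>auto simp: dist_norm norm_minus_commute\<close>)
      qed
      moreover have "((\<lambda>w. f w / (w - z) - f z / (w - z)) has_contour_integral
          - c * \<langle>P x, R (cnj z) y\<rangle>) (circlepath l r)"
        unfolding c_def
      proof (rule has_contour_integral_eq[OF riesz_cinner])
        fix w assume "w \<in> path_image (circlepath l r)"
        then have w: "w \<in> sphere l r" by (simp add: circle_path_image)
        have wz: "w \<noteq> z" using w z s by auto
        have "\<langle>R w x, R (cnj z) y\<rangle>
            = \<langle>R z (R w x), y\<rangle>"
          by (rule resolvent_adjoint[OF self_adjoint zn, symmetric])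
        moreover have "f z - f w = (z - w) * \<langle>R z (R w x), y\<rangle>"
          unfolding f_def cinner_diff_left[symmetric]
          by (simp add: resolvent_identity[OF linear zn circle_notin[OF w]] cinner_scaleC_left)
        moreover have "f w - f z = (w - z) * \<langle>R z (R w x), y\<rangle>"
          using calculation(2) by (simp add: algebra_simps)
        ultimately show "\<langle>R w x, R (cnj z) y\<rangle> = f w / (w - z) - f z / (w - z)"
          using wz by (simp flip: diff_divide_distrib)
      qed
      ultimately have e: "- c * \<langle>P x, R (cnj z) y\<rangle> = H z - c * f z"
        using has_contour_integral_unique by blast
      have "g z = f z - \<langle>P x, R (cnj z) y\<rangle>"
        by (simp add: g_def f_def blinfun.diff_right cinner_diff_left resolvent_adjoint[OF self_adjoint zn])
      then have "c * g z = c * f z - c * \<langle>P x, R (cnj z) y\<rangle>"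
        by (simp only: right_diff_distrib)
      also have "\<dots> = H z" using e by (simp add: algebra_simps)
      finally have "c * g z = H z" .
      then show ?thesis using c0 by (simp add: eq_divide_eq mult.commute)
    qed
    have "((\<lambda>z. H z / c) has_contour_integral 0) (circlepath l s)"
      by (rule Cauchy_theorem_disc_simple[where e = r and a = l])
        (use Hhol c0 s in \<open>auto intro!: holomorphic_intros simp: path_image_circlepath dist_commute\<close>)
    then have g0: "(g has_contour_integral 0) (circlepath l s)"
      by (rule has_contour_integral_eq) (use gH s in \<open>auto simp: path_image_circlepath\<close>)
    have gs: "contour_integral (circlepath l s) g = contour_integral (circlepath l r) g"
      unfolding g_def
      by (rule Cauchy_theorem_homotopic_loops[OF annulus_path _ R_holomorphic])
        (use radii s in \<open>auto intro!: open_Collect_conj open_Collect_less continuous_intros\<close>)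
    have "(g has_contour_integral contour_integral (circlepath l r) g) (circlepath l r)"
      using riesz_cinner has_contour_integral_integrable has_contour_integral_integral
      unfolding g_def by blast
    then show "(g has_contour_integral - (2 * of_real pi * \<i>) * 0) (circlepath l r)"
      using gs contour_integral_unique[OF g0] by simp
  qed
  then have "P (x - P x) = 0"
    by (intro cinner_eqI) (simp only: cinner_zero_left)
  then show ?thesis by (simp add: blinfun.diff_right)
qed

lemma reduced_graph:
  "(S x, l *\<^sub>C S x + x - P x) \<in> A"
proof (rule self_adjoint_memI_left[OF self_adjoint])
  fix u v assume uv: "(u, v) \<in> A"
  have "((\<lambda>w. \<langle>x, u\<rangle> / (w - l)) has_contour_integral 2 * of_real pi * \<i> * \<langle>x, u\<rangle>) (circlepath l r)"
    by (rule Cauchy_integral_circlepath_simple) (use r_pos in auto)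
  from has_contour_integral_neg[OF this]
  have 1: "((\<lambda>w. \<langle>x, u\<rangle> / (l - w)) has_contour_integral - (2 * of_real pi * \<i> * \<langle>x, u\<rangle>)) (circlepath l r)"
    by (rule has_contour_integral_eq) (simp add: minus_divide_right)
  have "\<langle>S x, v\<rangle> = l * \<langle>S x, u\<rangle> + (\<langle>x, u\<rangle> - \<langle>P x, u\<rangle>)"
  proof (rule reduced_eqI)
    have "((\<lambda>z. l * (\<langle>R z x, u\<rangle> / (l - z)) + (\<langle>x, u\<rangle> / (l - z) - \<langle>R z x, u\<rangle>))
        has_contour_integral l * (- (2 * of_real pi * \<i>) * \<langle>S x, u\<rangle>)
          + (- (2 * of_real pi * \<i> * \<langle>x, u\<rangle>) - (- (2 * of_real pi * \<i>) * \<langle>P x, u\<rangle>)))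
        (circlepath l r)"
      by (intro has_contour_integral_add has_contour_integral_diff has_contour_integral_lmul 1
          reduced_cinner riesz_cinner)
    then show "((\<lambda>z. \<langle>R z x, v\<rangle> / (l - z)) has_contour_integral
        - (2 * of_real pi * \<i>) * (l * \<langle>S x, u\<rangle> + (\<langle>x, u\<rangle> - \<langle>P x, u\<rangle>)))
        (circlepath l r)"
    proof (rule has_contour_integral_cong)
      fix z assume "z \<in> path_image (circlepath l r)"
      then have z: "z \<in> sphere l r" by (simp add: circle_path_image)
      define c where "c = l - z"
      have c: "c \<noteq> 0" "z = l - c" using z r_pos by (auto simp: c_def)
      have "l * (F / c) + (X / c - F) = (X + (l - c) * F) / c" for F X
        using c(1) by (simp add: field_simps)
      then show "l * (\<langle>R z x, u\<rangle> / (l - z)) + (\<langle>x, u\<rangle> / (l - z) - \<langle>R z x, u\<rangle>)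
          = \<langle>R z x, v\<rangle> / (l - z)"
        unfolding R_graph[OF z uv] c_def[symmetric] c(2)[symmetric] .
    qed (simp add: algebra_simps)
  qed
  then show "\<langle>S x, v\<rangle> = \<langle>l *\<^sub>C S x + x - P x, u\<rangle>"
    by (simp add: cinner_algebra)
qed

lemma R_eigenvector:
  assumes "z \<in> sphere l r" "(u, l *\<^sub>C u) \<in> A"
  shows "(l - z) *\<^sub>C R z u = u"
  using resolvent_left[OF linear circle_notin[OF assms(1)] assms(2)]
  by (simp add: R_scaleC[OF assms(1)] flip: scaleC_diff_left)

lemma R_eigenvector_cinner:
  assumes "z \<in> sphere l r" "(u, l *\<^sub>C u) \<in> A"
  shows "\<langle>R z u, y\<rangle> = \<langle>u, y\<rangle> / (l - z)"
proof -
  have "l - z \<noteq> 0" using assms(1) r_pos by auto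
  then show ?thesis using R_eigenvector[OF assms]
    by (metis cinner_scaleC_left nonzero_mult_div_cancel_left)
qed

lemma riesz_eigenvector:
  assumes "(u, l *\<^sub>C u) \<in> A"
  shows "P u = u"
proof (rule cinner_eqI, rule riesz_eqI)
  fix y
  have "((\<lambda>w. \<langle>u, y\<rangle> / (w - l)) has_contour_integral 2 * of_real pi * \<i> * \<langle>u, y\<rangle>) (circlepath l r)"
    by (rule Cauchy_integral_circlepath_simple) (use r_pos in auto)
  from has_contour_integral_neg[OF this]
  show "((\<lambda>z. \<langle>R z u, y\<rangle>) has_contour_integral - (2 * of_real pi * \<i>) * \<langle>u, y\<rangle>) (circlepath l r)"
    by (rule has_contour_integral_cong)
      (simp_all add: circle_path_image R_eigenvector_cinner[OF _ assms] minus_divide_right)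
qed

lemma reduced_eigenvector:
  assumes "(u, l *\<^sub>C u) \<in> A"
  shows "S u = 0"
proof (rule cinner_eqI, simp, rule reduced_eqI)
  fix y
  have "((\<lambda>w. \<langle>u, y\<rangle> * (1 / (l - w))) has_field_derivative \<langle>u, y\<rangle> / (l - z)\<^sup>2) (at z within path_image (circlepath l r))"
    if "z \<in> path_image (circlepath l r)" for z
  proof -
    have "l - z \<noteq> 0" using that r_pos by (auto simp: path_image_circlepath)
    then show ?thesis
      by (auto intro!: derivative_eq_intros simp: power2_eq_square field_simps)
  qed
  from contour_integral_primitive[OF this, of "circlepath l r"]
  have "((\<lambda>z. \<langle>u, y\<rangle> / (l - z)\<^sup>2) has_contour_integral 0) (circlepath l r)" by simp
  then show "((\<lambda>z. \<langle>R z u, y\<rangle> / (l - z)) has_contour_integral - (2 * of_real pi * \<i>) * 0) (circlepath l r)"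
    by (rule has_contour_integral_cong)
      (simp_all add: circle_path_image R_eigenvector_cinner[OF _ assms] power2_eq_square)
qed

end

lemma punctured_disc_spectral_circle:
  fixes A :: "'a::chilbert_space uop"
  assumes A: "self_adjoint_uop A" "Im l = 0" and e: "0 < e" "e < r" "r < b"
    and gap: "\<And>z. z \<noteq> l \<Longrightarrow> dist l z < b \<Longrightarrow> z \<notin> Spec A"
    and bound: "\<And>z. z \<noteq> l \<Longrightarrow> dist l z < b \<Longrightarrow> norm (resolvent A z) * dist l z \<le> C"
  shows "spectral_circle A l r e b (C / e)"
proof
  fix z assume z: "e < dist l z" "dist l z < b"
  then have "z \<noteq> l" using e by auto
  then show "z \<notin> Spec A" using gap z by blast
  have "norm (resolvent A z) * e \<le> norm (resolvent A z) * dist l z"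
    using z by (intro mult_left_mono) auto
  also have "\<dots> \<le> C" using bound \<open>z \<noteq> l\<close> z by blast
  finally show "norm (resolvent A z) \<le> C / e" using e by (simp add: field_simps)
qed (use A e in auto)

text \<open>
  The integral of \<open>(z - l) R z\<close> represents \<open>(A - l) P\<close> and does not depend on the radius of the circle.  Its
  integrand is bounded near \<open>l\<close>, so the integrals over small circles tend to zero and the range of \<open>P\<close>
  consists of eigenvectors.
\<close>

lemma riesz_isolated:
  fixes A :: "'a::chilbert_space uop"
  assumes A: "self_adjoint_uop A" "Im l = 0" and r: "0 < r" "r < b"
    and gap: "\<And>z. z \<noteq> l \<Longrightarrow> dist l z < b \<Longrightarrow> z \<notin> Spec A"
    and bound: "\<And>z. z \<noteq> l \<Longrightarrow> dist l z < b \<Longrightarrow> norm (resolvent A z) * dist l z \<le> C"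
  shows "(riesz_projection (circlepath l r) A x,
    l *\<^sub>C riesz_projection (circlepath l r) A x) \<in> A"
proof -
  have sc: "spectral_circle A l r e b (C / e)" if "0 < e" "e < r" for e
    by (rule punctured_disc_spectral_circle[OF A that r(2) gap bound])
  interpret spectral_circle A l r "r / 2" b "C / (r / 2)" by (rule sc) (use r in auto)
  show ?thesis
proof (rule self_adjoint_memI_left[OF self_adjoint])
  fix u v assume uv: "(u, v) \<in> A"
  define f where "f = (\<lambda>z. (z - l) * \<langle>R z x, u\<rangle>)"
  define I where "I = - (2 * of_real pi * \<i>) * \<langle>P x, v\<rangle>
      - l * (- (2 * of_real pi * \<i>) * \<langle>P x, u\<rangle>)"
  have "((\<lambda>z. \<langle>R z x, v\<rangle> - l * \<langle>R z x, u\<rangle> - \<langle>x, u\<rangle>) has_contour_integral I - 0)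
      (circlepath l r)"
    unfolding I_def by (intro has_contour_integral_diff has_contour_integral_lmul riesz_cinner
        const_has_contour_integral_0)
  then have I: "(f has_contour_integral I) (circlepath l r)"
    by (rule has_contour_integral_cong)
      (simp_all add: circle_path_image R_graph[OF _ uv] f_def algebra_simps)
  define K where "K = C * norm x * norm u"
  have hol: "f holomorphic_on ball l b - {l}"
  proof -
    have "f holomorphic_on {z. e < dist l z \<and> dist l z < b}" if e: "0 < e" "e < r" for e
      using spectral_circle.R_holomorphic[OF sc[OF e]] unfolding f_def by (intro holomorphic_intros)
    then have "f holomorphic_on (\<Union>e\<in>{0<..<r}. {z. e < dist l z \<and> dist l z < b})"
      by (intro holomorphic_on_UN_open open_Collect_conj open_Collect_less continuous_intros) auto
    moreover have "ball l b - {l} \<subseteq> (\<Union>e\<in>{0<..<r}. {z. e < dist l z \<and> dist l z < b})"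
    proof
      fix z assume z: "z \<in> ball l b - {l}"
      then have "min (dist l z) r / 2 \<in> {0<..<r}" "min (dist l z) r / 2 < dist l z" "dist l z < b"
        using r_pos by (auto simp: min_def)
      then show "z \<in> (\<Union>e\<in>{0<..<r}. {z. e < dist l z \<and> dist l z < b})" by blast
    qed
    ultimately show ?thesis using holomorphic_on_subset by blast
  qed
  have fb: "cmod (f z) \<le> K" if "z \<noteq> l" "dist l z \<le> r" for z
  proof -
    have "cmod (f z) \<le> dist l z * (norm (R z) * norm x * norm u)"
      unfolding f_def norm_mult
      by (intro mult_mono order_trans[OF norm_cinner_le] mult_right_mono norm_blinfun)
        (auto simp: dist_norm norm_minus_commute)
    also have "\<dots> = (norm (R z) * dist l z) * (norm x * norm u)" by simp
    also have "\<dots> \<le> C * (norm x * norm u)"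
      using that r(2) by (intro mult_right_mono bound) auto
    also have "\<dots> = K" by (simp add: K_def)
    finally show ?thesis .
  qed
  have "cmod I \<le> K * (2 * pi * e)" if e: "0 < e" "e \<le> r" for e
  proof -
    have ci: "f contour_integrable_on circlepath l e"
      "contour_integral (circlepath l r) f = contour_integral (circlepath l e) f"
      using contour_integral_circlepath_eq[OF open_ball hol e] radii by (auto simp: subset_eq)
    have "cmod (f (l + of_real r)) \<le> K" using r by (intro fb) (auto simp: dist_norm)
    then have "K \<ge> 0" using norm_ge_zero order_trans by blast
    have "cmod (contour_integral (circlepath l e) f) \<le> K * (2 * pi * e)"
      by (rule has_contour_integral_bound_circlepath[OF has_contour_integral_integral[OF ci(1)] \<open>K \<ge> 0\<close> e(1)])
        (use fb e in \<open>auto simp: dist_norm norm_minus_commute\<close>)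
    then show ?thesis using ci(2) contour_integral_unique[OF I] by simp
  qed
  then have "eventually (\<lambda>e. cmod I \<le> K * (2 * pi * e)) (at_right 0)"
    using eventually_at_right_less[of 0] r_pos
    by (auto simp: eventually_at_right_field intro!: exI[of _ r])
  moreover have "((\<lambda>e::real. K * (2 * pi * e)) \<longlongrightarrow> K * (2 * pi * 0)) (at_right 0)"
    by (intro tendsto_intros)
  ultimately have "cmod I \<le> K * (2 * pi * 0)"
    by (intro tendsto_lowerbound) auto
  then have "I = 0" by simp
  then have "\<langle>P x, v\<rangle> = l * \<langle>P x, u\<rangle>"
    unfolding I_def by (simp add: algebra_simps)
  then show "\<langle>P x, v\<rangle> = \<langle>l *\<^sub>C P x, u\<rangle>" by (simp add: cinner_scaleC_left)
  qed
qed

section \<open>Transformation operators between nearby projections\<close>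

definition is_inverse_sqrt :: "('a::complex_inner \<Rightarrow>\<^sub>L 'a) \<Rightarrow> ('a \<Rightarrow>\<^sub>L 'a) \<Rightarrow> bool"
  where "is_inverse_sqrt B R \<longleftrightarrow> clinear (blinfun_apply R) \<and>
    (\<forall>x. \<langle>R x, x\<rangle> \<in> \<real>\<^sub>\<ge>\<^sub>0) \<and>
    (R o\<^sub>L R) o\<^sub>L B = id_blinfun \<and> B o\<^sub>L (R o\<^sub>L R) = id_blinfun"

lemma clinear_zero: "clinear f \<Longrightarrow> f 0 = 0"
  unfolding clinear_iff by (metis complex_vector.scale_zero_left)

lemma clinear_ortho_sum:
  assumes "clinear F" "finite E"
  shows "F (ortho_sum E x) = (\<Sum>e\<in>E. \<langle>x, e\<rangle> *\<^sub>C F e)"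
  unfolding ortho_sum_def using assms(2)
  by (induction E rule: finite_induct) (use assms(1) clinear_zero[OF assms(1)] in \<open>auto simp: clinear_iff\<close>)

text \<open>
  For \<open>s = c\<^sup>-\<^sup>1\<^sup>/\<^sup>2\<close> the equation \<open>(R\<^sup>2 - c\<^sup>-\<^sup>1) v = 0\<close> reads \<open>(R + s) (R - s) v = 0\<close>, and \<open>R + s\<close> is injective because \<open>R\<close> is positive.  If the
  eigenvectors of \<open>B\<close> span, this determines \<open>R\<close>.
\<close>

lemma inverse_sqrt_eigenvector:
  assumes R: "is_inverse_sqrt B R" and c: "c > 0"
    and v: "B v = complex_of_real c *\<^sub>C v"
  shows "R v = complex_of_real (1 / sqrt c) *\<^sub>C v"
proof -
  define s where "s = 1 / sqrt c"
  have s: "s > 0" "s * s * c = 1" using c by (simp_all add: s_def)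
  have lin: "R (a *\<^sub>C x) = a *\<^sub>C R x" for a x
    using R by (simp add: is_inverse_sqrt_def clinear_iff)
  have "((R o\<^sub>L R) o\<^sub>L B) v = v" using R by (simp add: is_inverse_sqrt_def)
  then have "complex_of_real c *\<^sub>C R (R v) = v"
    by (simp add: v lin)
  then have "complex_of_real (s * s) *\<^sub>C (complex_of_real c *\<^sub>C R (R v))
      = complex_of_real (s * s) *\<^sub>C v" by simp
  moreover have "complex_of_real (s * s) * complex_of_real c = 1"
    using s(2) by (simp only: of_real_mult[symmetric] of_real_1)
  ultimately have RR: "R (R v) = complex_of_real (s * s) *\<^sub>C v"
    by (simp only: scaleC_scaleC scaleC_one)
  define w where "w = R v - complex_of_real s *\<^sub>C v"
  have "R w = - (complex_of_real s *\<^sub>C w)"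
    by (simp add: w_def blinfun.diff_right RR lin scaleC_diff_right scaleC_scaleC)
  then have "\<langle>R w, w\<rangle> = - of_real (s * (norm w)\<^sup>2)"
    by (simp add: cinner_algebra cinner_self)
  moreover have "\<langle>R w, w\<rangle> \<in> \<real>\<^sub>\<ge>\<^sub>0" using R by (simp add: is_inverse_sqrt_def)
  ultimately have "s * (norm w)\<^sup>2 \<le> 0" by (simp add: complex_nonneg_Reals_iff)
  then have "w = 0" using s(1) by (simp add: mult_le_0_iff)
  then show ?thesis by (simp add: w_def s_def)
qed

text \<open>The operator \<open>P - P\<^sub>0\<close> has finite rank, so its square is diagonalised by finitely many vectors.\<close>

locale near_projections =
  fixes P\<^sub>0 P :: "'a::complex_inner \<Rightarrow>\<^sub>L 'a" and G :: "'a set"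
  assumes proj0: "is_orthogonal_projection P\<^sub>0" and proj: "is_orthogonal_projection P"
    and near: "norm (P - P\<^sub>0) < 1"
    and finite_rank: "finite G" "range (blinfun_apply P\<^sub>0) \<subseteq> complex_vector.span G"
begin

abbreviation "D \<equiv> P - P\<^sub>0"
abbreviation "B \<equiv> id_blinfun - (D o\<^sub>L D)"

lemma idem0 [simp]: "P\<^sub>0 (P\<^sub>0 x) = P\<^sub>0 x"
  using proj0 unfolding is_orthogonal_projection_def by (metis blinfun_apply_blinfun_compose)

lemma idem [simp]: "P (P x) = P x"
  using proj unfolding is_orthogonal_projection_def by (metis blinfun_apply_blinfun_compose)

lemma self_adj: "\<langle>P x, y\<rangle> = \<langle>x, P y\<rangle>"
  "\<langle>P\<^sub>0 x, y\<rangle> = \<langle>x, P\<^sub>0 y\<rangle>"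
  using proj proj0 unfolding is_orthogonal_projection_def by auto

lemma scale: "P (c *\<^sub>C x) = c *\<^sub>C P x"
  "P\<^sub>0 (c *\<^sub>C x) = c *\<^sub>C P\<^sub>0 x"
  using proj proj0 unfolding is_orthogonal_projection_def clinear_iff by auto

lemma D_self_adj: "\<langle>D x, y\<rangle> = \<langle>x, D y\<rangle>"
  by (simp add: blinfun.diff_left cinner_algebra self_adj)

lemma subspace_range: "complex_vector.subspace (range (blinfun_apply P))"
  unfolding complex_vector.subspace_def
proof (intro conjI ballI allI)
  show "0 \<in> range (blinfun_apply P)" by (metis blinfun.zero_right rangeI)
qed (auto simp flip: blinfun.add_right scale)

text \<open>
  \<open>P\<^sub>0\<close> is injective on the range of \<open>P\<close>: a vector \<open>v = P v\<close> with \<open>P\<^sub>0 v = 0\<close> satisfies \<open>v = (P - P\<^sub>0) v\<close>, and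
  the norm of \<open>P - P\<^sub>0\<close> is less than one.
\<close>

lemma finite_rank_near: "\<exists>G'. finite G' \<and> range (blinfun_apply P) \<subseteq> complex_vector.span G'"
proof -
  interpret vector_space_pair "scaleC :: complex \<Rightarrow> 'a \<Rightarrow> 'a" "scaleC :: complex \<Rightarrow> 'a \<Rightarrow> 'a" ..
  obtain C where C: "C \<subseteq> range (blinfun_apply P)" "complex_vector.independent C"
    "range (blinfun_apply P) \<subseteq> complex_vector.span C"
    using complex_vector.maximal_independent_subset by blast
  have span: "complex_vector.span C \<subseteq> range (blinfun_apply P)"
    by (rule complex_vector.span_minimal[OF C(1) subspace_range])
  have inj: "inj_on (blinfun_apply P\<^sub>0) (complex_vector.span C)"
  proof (rule inj_onI)
    fix x y assume xy: "x \<in> complex_vector.span C" "y \<in> complex_vector.span C"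
      "P\<^sub>0 x = P\<^sub>0 y"
    define v where "v = x - y"
    have "v \<in> range (blinfun_apply P)"
      using span xy complex_vector.span_diff[OF xy(1,2)] by (auto simp: v_def)
    then have "P v = v" by auto
    then have "v = D v" using xy(3) by (simp add: blinfun.diff_left v_def blinfun.diff_right)
    then have "norm v \<le> norm D * norm v" using norm_blinfun[of D v] by simp
    then have "norm v * (1 - norm D) \<le> 0" by (simp add: algebra_simps)
    then have "v = 0" using near by (auto simp: mult_le_0_iff)
    then show "x = y" by (simp add: v_def)
  qed
  have "complex_vector.independent (blinfun_apply P\<^sub>0 ` C)"
    by (rule linear_independent_injective_image[OF _ C(2) inj])
      (use proj0 in \<open>simp add: is_orthogonal_projection_def\<close>)
  moreover have "blinfun_apply P\<^sub>0 ` C \<subseteq> complex_vector.span G" using finite_rank(2) by auto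
  ultimately have "finite (blinfun_apply P\<^sub>0 ` C)"
    using complex_vector.independent_span_bound[OF finite_rank(1)] by blast
  then have "finite C"
    using inj_on_subset[OF inj complex_vector.span_superset] finite_imageD by blast
  then show ?thesis using C(3) by blast
qed

text \<open>
  \<open>D\<^sup>2\<close> is Hermitian on the sum of the ranges of \<open>P\<close> and \<open>P\<^sub>0\<close>, and it vanishes on the orthogonal complement.
  Its eigenvalues on unit vectors are \<open>(norm (D e))\<^sup>2 < 1\<close>.
\<close>

lemma diagonalisation:
  obtains E d where "finite E" "orthonormal E"
    "\<And>e. e \<in> E \<Longrightarrow> B e = complex_of_real (d e) *\<^sub>C e"
    "\<And>e. e \<in> E \<Longrightarrow> 0 < d e" "\<And>e. e \<in> E \<Longrightarrow> d e \<le> 1"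
    "\<And>x. B (x - ortho_sum E x) = x - ortho_sum E x"
proof -
  obtain G' where G': "finite G'" "range (blinfun_apply P) \<subseteq> complex_vector.span G'"
    using finite_rank_near by blast
  define V where "V = complex_vector.span (range (blinfun_apply P) \<union> range (blinfun_apply P\<^sub>0))"
  have V: "complex_vector.subspace V" by (simp add: V_def)
  have VG: "V \<subseteq> complex_vector.span (G \<union> G')"
    unfolding V_def
    by (rule complex_vector.span_minimal)
      (use G'(2) finite_rank(2) complex_vector.span_mono[of G' "G \<union> G'"]
        complex_vector.span_mono[of G "G \<union> G'"] in auto)
  have inV: "P x \<in> V" "P\<^sub>0 x \<in> V" for x
    unfolding V_def by (auto intro: complex_vector.span_base)
  have DV: "D x \<in> V" for x
    using complex_vector.subspace_diff[OF V inV(1) inV(2), of x x] by (simp add: blinfun.diff_left)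
  have Dscale: "D (c *\<^sub>C x) = c *\<^sub>C D x" for c x
    by (simp add: blinfun.diff_left scale scaleC_diff_right)
  obtain E q where E: "finite E" "orthonormal E" "complex_vector.span E = V"
    and q: "\<And>e. e \<in> E \<Longrightarrow> D (D e) = complex_of_real (q e) *\<^sub>C e"
    by (rule spectral_theorem[OF V _ VG, where L = "\<lambda>x. D (D x)"])
      (use finite_rank(1) G'(1) DV in \<open>auto simp: blinfun.add_right Dscale D_self_adj\<close>)
  have qe: "0 \<le> q e \<and> q e < 1" if "e \<in> E" for e
  proof -
    have ee: "\<langle>e, e\<rangle> = 1" using E(2) that by (simp add: orthonormal_def)
    then have "(norm e)\<^sup>2 = 1\<^sup>2" by (simp add: cinner_self flip: of_real_power)
    then have ne: "norm e = 1" by (rule power2_eq_imp_eq) auto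
    have "complex_of_real (q e) = \<langle>D (D e), e\<rangle>"
      by (simp add: q[OF that] cinner_scaleC_left ee)
    also have "\<dots> = of_real ((norm (D e))\<^sup>2)" by (simp only: D_self_adj cinner_self)
    finally have qn: "q e = (norm (D e))\<^sup>2" by (simp only: of_real_eq_iff)
    have "norm (D e) < 1" using norm_blinfun[of D e] near ne by simp
    then show ?thesis unfolding qn by (simp add: power_less_one_iff)
  qed
  have zero: "D (x - ortho_sum E x) = 0" for x
  proof -
    define y where "y = x - ortho_sum E x"
    have orth: "\<langle>y, v\<rangle> = 0" if "v \<in> V" for v
      using diff_ortho_sum_orthogonal[OF E(1,2)] that by (simp add: y_def E(3))
    have "P y = 0"
      by (rule cinner_eqI) (simp only: self_adj(1) orth[OF inV(1)] cinner_zero_left)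
    moreover have "P\<^sub>0 y = 0"
      by (rule cinner_eqI) (simp only: self_adj(2) orth[OF inV(2)] cinner_zero_left)
    ultimately have "P y = 0" "P\<^sub>0 y = 0" by blast+
    then show ?thesis by (simp add: y_def blinfun.diff_left)
  qed
  show thesis
    by (rule that[OF E(1,2), of "\<lambda>e. 1 - q e"])
      (use q qe zero in \<open>auto simp: blinfun.diff_left scaleC_diff_left scaleC_one\<close>)
qed

lemma B_scale: "B (c *\<^sub>C x) = c *\<^sub>C B x"
  by (simp add: blinfun.diff_left blinfun.diff_right scale scaleC_diff_right)

lemma clinear_B: "clinear (blinfun_apply B)"
  unfolding clinear_iff using B_scale by (simp add: blinfun.add_right)

lemma inverse_sqrt_exists: "\<exists>R. is_inverse_sqrt B R"
proof -
  obtain E d where E: "finite E" "orthonormal E"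
    and d: "\<And>e. e \<in> E \<Longrightarrow> B e = complex_of_real (d e) *\<^sub>C e"
      "\<And>e. e \<in> E \<Longrightarrow> 0 < d e" "\<And>e. e \<in> E \<Longrightarrow> d e \<le> 1"
    and perp: "\<And>x. B (x - ortho_sum E x) = x - ortho_sum E x"
    by (rule diagonalisation) blast
  define s where "s e = 1 / sqrt (d e)" for e
  have s1: "s e \<ge> 1" if "e \<in> E" for e using d(2,3)[OF that] by (simp add: s_def)
  have sd: "s e * s e * d e = 1" if "e \<in> E" for e using d(2)[OF that] by (simp add: s_def)
  \<comment> \<open>\<open>f\<close> multiplies each \<open>e\<close> by \<open>s e\<close> and is the identity on the orthogonal complement of \<open>E\<close>.\<close>
  define f where "f x = x + (\<Sum>e\<in>E. (complex_of_real (s e - 1) * \<langle>x, e\<rangle>) *\<^sub>C e)" for x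
  have "bounded_linear f"
    unfolding f_def
    by (intro bounded_linear_add bounded_linear_ident bounded_linear_sum
        bounded_linear_compose[OF bounded_bilinear.bounded_linear_left[OF bounded_bilinear_scaleC]]
        bounded_linear_compose[OF bounded_linear_mult_right]
        bounded_bilinear.bounded_linear_left[OF bounded_bilinear_cinner])
  then have f: "blinfun_apply (Blinfun f) = f" by (rule bounded_linear_Blinfun_apply)
  have lin: "clinear f"
    unfolding clinear_iff
    by (auto simp: f_def cinner_algebra sum.distrib scaleC_add_left scaleC_add_right distrib_left
        complex_vector.scale_sum_right scaleC_scaleC mult.left_commute)
  have fe: "f e = complex_of_real (s e) *\<^sub>C e" if "e \<in> E" for e
  proof -
    have "(\<Sum>e'\<in>E. (complex_of_real (s e' - 1) * \<langle>e, e'\<rangle>) *\<^sub>C e')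
        = (\<Sum>e'\<in>E. if e' = e then complex_of_real (s e - 1) *\<^sub>C e else 0)"
      using E(2) that by (intro sum.cong) (auto simp: orthonormal_def)
    then show ?thesis using E(1) that by (simp add: f_def scaleC_diff_left scaleC_one)
  qed
  have fperp: "f (x - ortho_sum E x) = x - ortho_sum E x" for x
    using diff_ortho_sum_orthogonal[OF E complex_vector.span_base, of _ x] by (simp add: f_def)
  have agree: "F x = x"
    if "clinear F" "\<And>e. e \<in> E \<Longrightarrow> F e = e" "\<And>x. F (x - ortho_sum E x) = x - ortho_sum E x" for F x
  proof -
    have "F (ortho_sum E x) = ortho_sum E x"
      by (subst clinear_ortho_sum[OF that(1) E(1)]) (auto simp: ortho_sum_def that(2) intro!: sum.cong)
    moreover have "F x = F (ortho_sum E x) + F (x - ortho_sum E x)"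
      using that(1) by (metis clinear_iff add.commute diff_add_cancel)
    ultimately show ?thesis using that(3) by simp
  qed
  have sc: "f (c *\<^sub>C x) = c *\<^sub>C f x" for c x using lin by (simp add: clinear_iff)
  have sd': "complex_of_real (d e) * (complex_of_real (s e) * complex_of_real (s e)) = 1" if "e \<in> E" for e
    using sd[OF that] by (metis mult.commute of_real_1 of_real_mult)
  have cl: "clinear (\<lambda>x. f (f (B x)))" "clinear (\<lambda>x. B (f (f x)))"
    using lin clinear_B unfolding clinear_iff by auto
  have "f (f (B x)) = x" for x
    by (rule agree[OF cl(1)]) (simp_all add: d sc fe perp fperp scaleC_scaleC sd' scaleC_one mult.assoc)
  moreover have "B (f (f x)) = x" for x
    by (rule agree[OF cl(2)])
      (simp_all add: d sc fe perp fperp B_scale scaleC_scaleC sd' scaleC_one mult_ac)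
  moreover have "\<langle>f x, x\<rangle> \<in> \<real>\<^sub>\<ge>\<^sub>0" for x
  proof -
    have "\<langle>f x, x\<rangle> = of_real ((norm x)\<^sup>2) + (\<Sum>e\<in>E. complex_of_real (s e - 1) * (\<langle>x, e\<rangle> * \<langle>e, x\<rangle>))"
      by (simp add: f_def cinner_algebra cinner_sum_left cinner_self mult.assoc)
    also have "\<dots> = of_real ((norm x)\<^sup>2 + (\<Sum>e\<in>E. (s e - 1) * (cmod \<langle>x, e\<rangle>)\<^sup>2))"
      unfolding of_real_add of_real_sum of_real_mult complex_norm_square
      by (intro arg_cong2[where f = "(+)"] refl sum.cong arg_cong2[where f = "(*)"] cinner_commute)
    finally have "\<langle>f x, x\<rangle> = \<dots>" .
    moreover have "(norm x)\<^sup>2 + (\<Sum>e\<in>E. (s e - 1) * (cmod \<langle>x, e\<rangle>)\<^sup>2) \<ge> 0"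
      using s1 by (intro add_nonneg_nonneg sum_nonneg mult_nonneg_nonneg) auto
    ultimately show ?thesis by (simp only: nonneg_Reals_of_real_iff)
  qed
  ultimately have "is_inverse_sqrt B (Blinfun f)"
    unfolding is_inverse_sqrt_def f using lin
    by (auto intro!: blinfun_eqI simp: f)
  then show ?thesis by blast
qed

text \<open>
  \<open>F\<close> preserves the eigenspaces of \<open>B\<close>, and on each of them an inverse square root is a scalar that depends
  only on the eigenvalue.  The case \<open>F = id\<close> is uniqueness.
\<close>

lemma inverse_sqrt_commutes:
  assumes R: "is_inverse_sqrt B R" and F: "clinear F" "\<And>x. F (B x) = B (F x)"
    and R': "is_inverse_sqrt B R'"
  shows "R (F x) = F (R' x)"
proof -
  obtain E d where E: "finite E" "orthonormal E"
    and d: "\<And>e. e \<in> E \<Longrightarrow> B e = complex_of_real (d e) *\<^sub>C e"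
      "\<And>e. e \<in> E \<Longrightarrow> 0 < d e" "\<And>e. e \<in> E \<Longrightarrow> d e \<le> 1"
    and perp: "\<And>x. B (x - ortho_sum E x) = x - ortho_sum E x"
    by (rule diagonalisation) blast
  have Fsc: "F (c *\<^sub>C y) = c *\<^sub>C F y" for c y using F(1) by (simp add: clinear_iff)
  have eig: "R (F v) = F (R' v)"
    if "B v = complex_of_real c *\<^sub>C v" "c > 0" for v c
  proof -
    have "B (F v) = complex_of_real c *\<^sub>C F v"
      using F(2)[of v] that(1) Fsc by simp
    then show ?thesis
      using inverse_sqrt_eigenvector[OF R that(2)] inverse_sqrt_eigenvector[OF R' that(2,1)] Fsc by simp
  qed
  have cl: "clinear (\<lambda>x. R (F x))" "clinear (\<lambda>x. F (R' x))"
    using R R' F(1) unfolding is_inverse_sqrt_def clinear_iff by auto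
  have "R (F (ortho_sum E x)) = F (R' (ortho_sum E x))"
    unfolding clinear_ortho_sum[OF cl(1) E(1)] clinear_ortho_sum[OF cl(2) E(1)]
    using eig[OF d(1,2)] by (intro sum.cong) auto
  moreover have "R (F (x - ortho_sum E x)) = F (R' (x - ortho_sum E x))"
    by (rule eig[where c = 1]) (simp_all add: perp scaleC_one)
  moreover have "y (ortho_sum E x) + y (x - ortho_sum E x) = y x" if "clinear y" for y :: "'a \<Rightarrow> 'a"
    using that by (metis clinear_iff add.commute diff_add_cancel)
  ultimately show ?thesis using cl by metis
qed

lemma is_inverse_sqrt_inverse_sqrt: "is_inverse_sqrt B (inverse_sqrt B)"
proof -
  obtain R where R: "is_inverse_sqrt B R" using inverse_sqrt_exists by blast
  have unique: "R' = R" if "is_inverse_sqrt B R'" for R'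
    by (rule blinfun_eqI) (rule inverse_sqrt_commutes[OF that _ _ R], simp_all add: clinear_iff)
  have "inverse_sqrt B = R"
    unfolding inverse_sqrt_def is_inverse_sqrt_def[symmetric] by (rule the_equality[where P = "is_inverse_sqrt B", OF R unique])
  then show ?thesis using R by simp
qed

abbreviation "U \<equiv> transformation_op P\<^sub>0 P"

lemma transformation_apply:
  "U x = inverse_sqrt B
    ((x - P\<^sub>0 x) - P (x - P\<^sub>0 x) + P (P\<^sub>0 x))"
  by (simp add: transformation_op_def blinfun.add_left blinfun.diff_left)

lemma B_apply: "B x = x - P x + P (P\<^sub>0 x)
    + P\<^sub>0 (P x) - P\<^sub>0 x"
  by (simp add: blinfun.diff_left blinfun.diff_right)

lemma clinear_transformation: "clinear (blinfun_apply U)"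
  using is_inverse_sqrt_inverse_sqrt unfolding is_inverse_sqrt_def clinear_iff
  by (auto simp: transformation_apply blinfun.add_right blinfun.diff_right scale algebra_simps
      simp flip: scaleC_add_right scaleC_diff_right)

text \<open>
  With \<open>V = (I - P) (I - P\<^sub>0) + P P\<^sub>0\<close> and \<open>V' = (I - P\<^sub>0) (I - P) + P\<^sub>0 P\<close> both products \<open>V' V\<close> and \<open>V V'\<close> are
  equal to \<open>B = I - D\<^sup>2\<close>, which is invertible.
\<close>

lemma bij_transformation: "bij (blinfun_apply U)"
proof -
  define V where "V = (\<lambda>x. (x - P\<^sub>0 x) - P (x - P\<^sub>0 x)
    + P (P\<^sub>0 x))"
  define V' where "V' = (\<lambda>x. (x - P x) - P\<^sub>0 (x - P x)
    + P\<^sub>0 (P x))"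
  define R where "R = inverse_sqrt B"
  have "(R o\<^sub>L R) o\<^sub>L B = id_blinfun" "B o\<^sub>L (R o\<^sub>L R) = id_blinfun"
    using is_inverse_sqrt_inverse_sqrt by (simp_all add: R_def is_inverse_sqrt_def)
  then have R: "R (R (B x)) = x"
    "B (R (R x)) = x" for x
    by (metis blinfun_apply_blinfun_compose blinfun_apply_id_blinfun id_apply)+
  have V: "V' (V x) = B x" "V (V' x) = B x" for x
    unfolding V_def V'_def B_apply by (simp_all add: blinfun.diff_right blinfun.add_right)
  have "bij (blinfun_apply R)"
    using R by (intro bijI injI surjI[of _ "\<lambda>x. R (B x)"]) metis+
  moreover have "bij V"
  proof (intro bijI injI)
    show "x = y" if "V x = V y" for x y using V(1) R(1) that by metis
    show "surj V" by (rule surjI[of _ "\<lambda>x. V' (R (R x))"]) (simp add: V R)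
  qed
  ultimately have "bij (blinfun_apply R \<circ> V)" by (rule bij_comp[rotated])
  moreover have "blinfun_apply R \<circ> V = blinfun_apply U"
    by (simp add: fun_eq_iff transformation_apply V_def R_def)
  ultimately show ?thesis by simp
qed

text \<open>
  \<open>R\<close> commutes with \<open>P\<close>, so \<open>U\<close> maps the range of \<open>P\<^sub>0\<close> into that of \<open>P\<close>, and the range of \<open>I - P\<^sub>0\<close> into the
  kernel of \<open>P\<close>; surjectivity of \<open>U\<close> gives equality.
\<close>

lemma transformation_range: "blinfun_apply U ` range (blinfun_apply P\<^sub>0) = range (blinfun_apply P)"
proof -
  define R where "R = inverse_sqrt B"
  have RP: "R (P x) = P (R x)" for x
    unfolding R_def
    by (rule inverse_sqrt_commutes[OF is_inverse_sqrt_inverse_sqrt _ _ is_inverse_sqrt_inverse_sqrt])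
      (simp_all add: clinear_iff scale blinfun.add_right blinfun.diff_right B_apply)
  have 1: "U (P\<^sub>0 x) = P (R (P\<^sub>0 x))" for x
    by (simp add: transformation_apply R_def[symmetric] RP)
  have 2: "P (U (x - P\<^sub>0 x)) = 0" for x
    by (simp add: transformation_apply R_def[symmetric] RP[symmetric] blinfun.diff_right blinfun.add_right)
  show ?thesis
  proof (intro equalityI subsetI)
    fix y assume "y \<in> blinfun_apply U ` range (blinfun_apply P\<^sub>0)"
    then show "y \<in> range (blinfun_apply P)" using 1 by auto
  next
    fix y assume "y \<in> range (blinfun_apply P)"
    then have Py: "P y = y" by auto
    obtain x where x: "y = U x" using bij_transformation by (metis bij_pointE)
    have "U (x - P\<^sub>0 x) = y - U (P\<^sub>0 x)"
      by (simp add: x blinfun.diff_right)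
    then have "y - U (P\<^sub>0 x) = 0"
      using 2[of x] by (simp add: blinfun.diff_right Py 1)
    then show "y \<in> blinfun_apply U ` range (blinfun_apply P\<^sub>0)" by simp
  qed
qed

end

lemma transformation_op_self:
  assumes "is_orthogonal_projection P" "finite G" "range (blinfun_apply P) \<subseteq> complex_vector.span G"
  shows "transformation_op P P = id_blinfun"
proof -
  interpret near_projections P P G by unfold_locales (use assms in auto)
  have "inverse_sqrt B x = x" for x
    using inverse_sqrt_eigenvector[OF is_inverse_sqrt_inverse_sqrt, of 1 x]
    by (simp add: scaleC_one blinfun.diff_left)
  then show ?thesis by (intro blinfun_eqI) (simp add: transformation_apply blinfun.diff_right)
qed

lemma Spec_in_similar:
  fixes U :: "'a::complex_inner \<Rightarrow> 'a"
  assumes U: "bij U" "clinear U" "U ` V\<^sub>0 = V" and L: "\<And>y. y \<in> V \<Longrightarrow> L y \<in> V"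
    and W: "\<And>x. x \<in> V\<^sub>0 \<Longrightarrow> W x = inv U (L (U x))"
  shows "Spec_in V L = Spec_in V\<^sub>0 W"
proof -
  have Uadd: "inv U y - z *\<^sub>C x = inv U (y - z *\<^sub>C U x)" for x y z
  proof -
    have "U (inv U y - z *\<^sub>C x) = y - z *\<^sub>C U x"
    proof -
      have "U (inv U y) = U (inv U y - z *\<^sub>C x) + z *\<^sub>C U x"
        using U(2) by (metis clinear_iff diff_add_cancel)
      then show ?thesis using U(1) by (simp add: bij_is_surj surj_f_inv_f eq_diff_eq)
    qed
    then show ?thesis using U(1) by (metis bij_inv_eq_iff)
  qed
  have bU: "bij_betw U V\<^sub>0 V" using U(1,3) by (simp add: bij_betw_def inj_on_subset[OF bij_is_inj])
  then have bI: "bij_betw (inv U) V V\<^sub>0"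
    using U(1,3) bij_betw_subset[OF bij_imp_bij_inv[OF U(1)], of V V\<^sub>0]
    by (metis bij_is_inj image_inv_f_f subset_UNIV)
  have "bij_betw (\<lambda>x. W x - z *\<^sub>C x) V\<^sub>0 V\<^sub>0 \<longleftrightarrow> bij_betw (\<lambda>y. L y - z *\<^sub>C y) V V" for z
  proof -
    have "bij_betw (\<lambda>x. W x - z *\<^sub>C x) V\<^sub>0 V\<^sub>0
      \<longleftrightarrow> bij_betw (inv U \<circ> (\<lambda>y. L y - z *\<^sub>C y) \<circ> U) V\<^sub>0 V\<^sub>0"
      by (rule bij_betw_cong) (simp add: W Uadd)
    also have "\<dots> \<longleftrightarrow> bij_betw (inv U \<circ> (\<lambda>y. L y - z *\<^sub>C y)) V V\<^sub>0"
      using bij_betw_comp_iff[OF bU] by blast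
    also have "\<dots> \<longleftrightarrow> bij_betw (\<lambda>y. L y - z *\<^sub>C y) V V"
    proof
      assume b: "bij_betw (inv U \<circ> (\<lambda>y. L y - z *\<^sub>C y)) V V\<^sub>0"
      have "bij_betw (U \<circ> (inv U \<circ> (\<lambda>y. L y - z *\<^sub>C y))) V V" by (rule bij_betw_trans[OF b bU])
      moreover have "U \<circ> (inv U \<circ> (\<lambda>y. L y - z *\<^sub>C y)) = (\<lambda>y. L y - z *\<^sub>C y)"
        using U(1) by (auto simp: fun_eq_iff bij_is_surj surj_f_inv_f)
      ultimately show "bij_betw (\<lambda>y. L y - z *\<^sub>C y) V V" by simp
    next
      assume "bij_betw (\<lambda>y. L y - z *\<^sub>C y) V V"
      then show "bij_betw (inv U \<circ> (\<lambda>y. L y - z *\<^sub>C y)) V V\<^sub>0" by (rule bij_betw_trans[OF _ bI])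
    qed
    finally show ?thesis .
  qed
  then show ?thesis by (simp add: Spec_in_def)
qed

section \<open>The symplectic form and Lagrangian projections\<close>

lemma sympl_eq_cinner: "sympl f g = \<langle>sympl_J f, g\<rangle>"
  by (simp add: sympl_def sympl_J_def cinner_prod_def cinner_algebra)

lemma sympl_J_add: "sympl_J (f + g) = sympl_J f + sympl_J g"
  by (simp add: sympl_J_def)

lemma sympl_J_diff: "sympl_J (f - g) = sympl_J f - sympl_J g"
  by (simp add: sympl_J_def)

lemma sympl_J_scaleC: "sympl_J (c *\<^sub>C f) = c *\<^sub>C sympl_J f"
  by (simp add: sympl_J_def scaleC_prod_def scaleC_minus_right)

lemma sympl_J_scaleR: "sympl_J (c *\<^sub>R f) = c *\<^sub>R sympl_J f"
  by (simp add: sympl_J_def scaleR_prod_def)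

lemma sympl_J_minus: "sympl_J (- f) = - sympl_J f"
  by (simp add: sympl_J_def)

lemma sympl_J_J [simp]: "sympl_J (sympl_J f) = - f"
  by (simp add: sympl_J_def prod_eq_iff)

lemma cinner_sympl_J: "\<langle>sympl_J f, g\<rangle> = - \<langle>f, sympl_J g\<rangle>"
  by (simp add: sympl_J_def cinner_prod_def cinner_algebra)

lemma norm_sympl_J [simp]: "norm (sympl_J f) = norm f"
  by (simp add: sympl_J_def norm_prod_def add.commute)

lemma bounded_linear_sympl_J: "bounded_linear (sympl_J :: 'b::complex_inner \<times> 'b \<Rightarrow> _)"
  by (rule bounded_linear_intro[where K = 1]) (simp_all add: sympl_J_add sympl_J_scaleR)

lemma norm_sympl_le: "cmod (sympl f g) \<le> norm f * norm g"
  using norm_cinner_le[of "sympl_J f" g] by (simp add: sympl_eq_cinner)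

lemma sympl_diff_right: "sympl f (g - h) = sympl f g - sympl f h"
  by (simp add: sympl_eq_cinner cinner_diff_right)

lemma sympl_add_left: "sympl (f + g) h = sympl f h + sympl g h"
  by (simp add: sympl_eq_cinner sympl_J_add cinner_add_left)

lemma sympl_diff_left: "sympl (f - g) h = sympl f h - sympl g h"
  by (simp add: sympl_eq_cinner sympl_J_diff cinner_diff_left)

lemma sympl_scaleC_left: "sympl (c *\<^sub>C f) h = c * sympl f h"
  by (simp add: sympl_eq_cinner sympl_J_scaleC cinner_scaleC_left)

lemma lagrangian_isotropic: "lagrangian F \<Longrightarrow> f \<in> F \<Longrightarrow> g \<in> F \<Longrightarrow> sympl f g = 0"
  unfolding lagrangian_def by blast

lemma lagrangian_maximal: "lagrangian F \<Longrightarrow> (\<And>g. g \<in> F \<Longrightarrow> sympl f g = 0) \<Longrightarrow> f \<in> F"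
  unfolding lagrangian_def by blast

lemma lagrangian_subspace: "lagrangian F \<Longrightarrow> complex_vector.subspace F"
  unfolding lagrangian_def by blast

lemma lagrangian_add: "lagrangian F \<Longrightarrow> f \<in> F \<Longrightarrow> g \<in> F \<Longrightarrow> f + g \<in> F"
  by (rule complex_vector.subspace_add[OF lagrangian_subspace])

lemma lagrangian_diff: "lagrangian F \<Longrightarrow> f \<in> F \<Longrightarrow> g \<in> F \<Longrightarrow> f - g \<in> F"
  by (rule complex_vector.subspace_diff[OF lagrangian_subspace])

lemma lagrangian_minus: "lagrangian F \<Longrightarrow> f \<in> F \<Longrightarrow> - f \<in> F"
  by (rule complex_vector.subspace_neg[OF lagrangian_subspace])

lemma orthogonal_projection_idem:
  "is_orthogonal_projection Q \<Longrightarrow> Q (Q x) = Q x"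
  unfolding is_orthogonal_projection_def by (metis blinfun_apply_blinfun_compose)

lemma orthogonal_projection_self_adjoint:
  "is_orthogonal_projection Q \<Longrightarrow> \<langle>Q x, y\<rangle> = \<langle>x, Q y\<rangle>"
  unfolding is_orthogonal_projection_def by blast

lemma orthogonal_projection_range:
  "is_orthogonal_projection Q \<Longrightarrow> f \<in> range (blinfun_apply Q) \<longleftrightarrow> Q f = f"
  by (metis orthogonal_projection_idem rangeE rangeI)

text \<open>\<open>J\<close> exchanges a Lagrangian subspace and its orthogonal complement.\<close>

lemma lagrangian_projection_J:
  assumes Q: "is_orthogonal_projection Q" "lagrangian (range (blinfun_apply Q))"
  shows "sympl_J (Q f) + Q (sympl_J f) = sympl_J f"
proof -
  define g where "g = f - Q f"
  have g: "\<langle>g, Q h\<rangle> = 0" for h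
    using orthogonal_projection_self_adjoint[OF Q(1), of g h]
    by (simp add: g_def blinfun.diff_right orthogonal_projection_idem[OF Q(1)])
  have "sympl_J g \<in> range (blinfun_apply Q)"
    by (rule lagrangian_maximal[OF Q(2)]) (auto simp: sympl_eq_cinner cinner_minus_left g)
  then have 1: "Q (sympl_J g) = sympl_J g"
    using orthogonal_projection_range[OF Q(1)] by blast
  have 2: "Q (sympl_J (Q f)) = 0"
  proof (rule cinner_eqI)
    fix h
    have "sympl (Q f) (Q h) = 0"
      by (rule lagrangian_isotropic[OF Q(2)]) auto
    then show "\<langle>Q (sympl_J (Q f)), h\<rangle> = \<langle>0, h\<rangle>"
      unfolding orthogonal_projection_self_adjoint[OF Q(1)] by (simp add: sympl_eq_cinner)
  qed
  have "Q (sympl_J f) = Q (sympl_J (Q f) + sympl_J g)"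
    by (simp add: g_def sympl_J_diff)
  also have "\<dots> = sympl_J g" by (simp add: blinfun.add_right 1 2)
  finally show ?thesis by (simp add: g_def sympl_J_diff)
qed

section \<open>Boundary triplets\<close>

lemma cadjoint_eqI:
  assumes "\<And>x y. \<langle>F x, y\<rangle> = \<langle>x, G y\<rangle>"
  shows "cadjoint F = G"
  unfolding cadjoint_def
proof (rule the_equality)
  fix G' assume "\<forall>x y. \<langle>F x, y\<rangle> = \<langle>x, G' y\<rangle>"
  then have "\<langle>x, G' y\<rangle> = \<langle>x, G y\<rangle>" for x y using assms by metis
  then show "G' = G" by (intro ext cinner_eqI_right)
qed (use assms in blast)

lemma mem_uadjoint: "(v, w) \<in> uadjoint A \<longleftrightarrow> (\<forall>x y. (x, y) \<in> A \<longrightarrow> \<langle>y, v\<rangle> = \<langle>x, w\<rangle>)"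
  by (auto simp: uadjoint_def)

lemma linear_uadjoint:
  fixes A :: "'a::complex_inner uop"
  assumes "densely_defined A"
  shows "linear_uop (uadjoint A)"
  unfolding linear_uop_def
proof
  show "complex_vector.subspace (uadjoint A)"
    unfolding complex_vector.subspace_def
    by (auto simp: mem_uadjoint zero_prod_def scaleC_prod_def cinner_algebra)
  have "w = 0" if "(0, w) \<in> uadjoint A" for w
  proof -
    have "Domain A \<subseteq> {x. \<langle>x, w\<rangle> = 0}" using that by (auto simp: uadjoint_def)
    moreover have "closed {x. \<langle>x, w\<rangle> = 0}"
      by (intro closed_Collect_eq continuous_intros)
    ultimately have "closure (Domain A) \<subseteq> {x. \<langle>x, w\<rangle> = 0}" by (rule closure_minimal)
    then have "w \<in> {x. \<langle>x, w\<rangle> = 0}" using assms unfolding densely_defined_def by blast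
    then show ?thesis by simp
  qed
  moreover have "(0, w - w') \<in> uadjoint A" if "(v, w) \<in> uadjoint A" "(v, w') \<in> uadjoint A" for v w w'
    using that by (fastforce simp: uadjoint_def cinner_algebra)
  ultimately show "single_valued (uadjoint A)"
    unfolding single_valued_def by (metis eq_iff_diff_eq_0)
qed

text \<open>
  The graph norm is replaced by the equivalent sum of the norms of \<open>u\<close> and \<open>A\<^sup>* u\<close>, and Green's identity is
  stated for pairs in the graph of \<open>A\<^sup>*\<close>.
\<close>

locale triplet =
  fixes A :: "'a::chilbert_space uop" and T :: "'a \<Rightarrow> 'b::chilbert_space \<times> 'b" and K :: real
  assumes dense: "densely_defined A"
    and T_add: "\<And>u v. u \<in> Domain (uadjoint A) \<Longrightarrow> v \<in> Domain (uadjoint A) \<Longrightarrow> T (u + v) = T u + T v"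
    and T_scaleC: "\<And>c u. u \<in> Domain (uadjoint A) \<Longrightarrow> T (c *\<^sub>C u) = c *\<^sub>C T u"
    and K_nonneg: "K \<ge> 0"
    and T_bound: "\<And>u u'. (u, u') \<in> uadjoint A \<Longrightarrow> norm (T u) \<le> K * (norm u + norm u')"
    and T_surj: "\<And>y. \<exists>u u'. (u, u') \<in> uadjoint A \<and> T u = y"
    and green: "\<And>u u' v v'. (u, u') \<in> uadjoint A \<Longrightarrow> (v, v') \<in> uadjoint A \<Longrightarrow>
      \<langle>u', v\<rangle> - \<langle>u, v'\<rangle> = sympl (T u) (T v)"

lemma boundary_triplet_imp_triplet:
  assumes A: "densely_defined A" and triplet: "boundary_triplet A \<Gamma>\<^sub>0 \<Gamma>\<^sub>1"
    and T: "T = (\<lambda>u. (\<Gamma>\<^sub>0 u, \<Gamma>\<^sub>1 u))"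
  shows "\<exists>K. triplet A T K"
proof -
  note lin = linear_uadjoint[OF A]
  let ?H = "Domain (uadjoint A)"
  have tr: "\<forall>u\<in>?H. \<forall>v\<in>?H. T (u + v) = T u + T v" "\<forall>c. \<forall>u\<in>?H. T (c *\<^sub>C u) = c *\<^sub>C T u"
    "\<exists>K. \<forall>u\<in>?H. norm (T u) \<le> K * sqrt ((norm u)\<^sup>2 + (norm (uapply (uadjoint A) u))\<^sup>2)"
    "T ` ?H = UNIV"
    "\<forall>u\<in>?H. \<forall>v\<in>?H. \<langle>uapply (uadjoint A) u, v\<rangle> - \<langle>u, uapply (uadjoint A) v\<rangle>
        = \<langle>\<Gamma>\<^sub>1 u, \<Gamma>\<^sub>0 v\<rangle> - \<langle>\<Gamma>\<^sub>0 u, \<Gamma>\<^sub>1 v\<rangle>"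
    using triplet unfolding boundary_triplet_def Let_def T by auto
  obtain K where K: "\<forall>u\<in>?H. norm (T u) \<le> K * sqrt ((norm u)\<^sup>2 + (norm (uapply (uadjoint A) u))\<^sup>2)"
    using tr(3) by blast
  have "triplet A T \<bar>K\<bar>"
  proof
    fix u u' assume u: "(u, u') \<in> uadjoint A"
    have "norm (T u) \<le> K * sqrt ((norm u)\<^sup>2 + (norm u')\<^sup>2)"
      using K u uapply_eq[OF lin u] by fastforce
    also have "\<dots> \<le> \<bar>K\<bar> * sqrt ((norm u)\<^sup>2 + (norm u')\<^sup>2)" by (intro mult_right_mono) auto
    also have "\<dots> \<le> \<bar>K\<bar> * (norm u + norm u')"
      by (intro mult_left_mono sqrt_sum_squares_le_sum) auto
    finally show "norm (T u) \<le> \<bar>K\<bar> * (norm u + norm u')" .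
  next
    fix y
    have "y \<in> T ` ?H" using tr(4) by simp
    then show "\<exists>u u'. (u, u') \<in> uadjoint A \<and> T u = y" by auto
  next
    fix u u' v v' assume uv: "(u, u') \<in> uadjoint A" "(v, v') \<in> uadjoint A"
    have "u \<in> ?H" "v \<in> ?H" using uv by auto
    then have "\<langle>uapply (uadjoint A) u, v\<rangle> - \<langle>u, uapply (uadjoint A) v\<rangle> = \<langle>\<Gamma>\<^sub>1 u, \<Gamma>\<^sub>0 v\<rangle> - \<langle>\<Gamma>\<^sub>0 u, \<Gamma>\<^sub>1 v\<rangle>"
      using tr(5) by blast
    then show "\<langle>u', v\<rangle> - \<langle>u, v'\<rangle> = sympl (T u) (T v)"
      unfolding uapply_eq[OF lin uv(1)] uapply_eq[OF lin uv(2)] by (simp add: sympl_def T)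
  qed (use A tr in auto)
  then show ?thesis by blast
qed

context triplet
begin

lemma linear_adjoint: "linear_uop (uadjoint A)"
  by (rule linear_uadjoint[OF dense])

lemma T_diff: "u \<in> Domain (uadjoint A) \<Longrightarrow> v \<in> Domain (uadjoint A) \<Longrightarrow> T (u - v) = T u - T v"
  using T_add[of u "(- 1) *\<^sub>C v"] T_scaleC[of v "- 1"] uop_scale[OF linear_adjoint, of v _ "- 1"]
  by (auto simp: scaleC_minus1[symmetric])

definition extension :: "'a uop \<Rightarrow> ('b \<times> 'b) set \<Rightarrow> bool"
  where "extension H F \<longleftrightarrow> self_adjoint_uop H \<and> A \<subseteq> H \<and> T ` Domain H = F \<and> lagrangian F"

lemma extension_subset:
  assumes "extension H F"
  shows "H \<subseteq> uadjoint A"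
proof -
  have "uadjoint H \<subseteq> uadjoint A" using assms by (auto simp: extension_def uadjoint_def)
  then show ?thesis using assms by (simp add: extension_def self_adjoint_uop_def)
qed

lemma extension_T: "extension H F \<Longrightarrow> (u, u') \<in> H \<Longrightarrow> T u \<in> F"
  by (auto simp: extension_def)

text \<open>
  By Green's identity \<open>u\<close> is in the domain of the adjoint of \<open>H\<close>, since its boundary value is
  \<open>\<omega>\<close>-orthogonal to those of the domain of \<open>H\<close>.
\<close>

lemma extension_memI:
  assumes H: "extension H F" and u: "(u, u') \<in> uadjoint A" "T u \<in> F"
  shows "(u, u') \<in> H"
proof (rule self_adjoint_memI_left)
  show "self_adjoint_uop H" using H by (simp add: extension_def)
  fix x y assume xy: "(x, y) \<in> H"
  have "sympl (T u) (T x) = 0"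
    using H u(2) extension_T[OF H xy] by (intro lagrangian_isotropic[of F]) (auto simp: extension_def)
  then show "\<langle>u, y\<rangle> = \<langle>u', x\<rangle>"
    using green[OF u(1), of x y] xy extension_subset[OF H] by auto
qed

text \<open>
  The correcting element lies in the deficiency space at \<open>-\<i>\<close>.  The constant does not depend on the extension,
  because \<open>norm (resolvent H \<i>) \<le> 1\<close> for every self-adjoint \<open>H\<close>.
\<close>

lemma boundary_correction:
  assumes H: "extension H F"
  shows "\<exists>c. (c, - (\<i> *\<^sub>C c)) \<in> uadjoint A \<and> T c - y \<in> F \<and> norm c \<le> 3 * K * norm y"
proof -
  have sa: "self_adjoint_uop H" and F: "lagrangian F" using H by (auto simp: extension_def)
  note lin = self_adjoint_linear[OF sa]
  obtain w w' where w: "(w, w') \<in> uadjoint A" "T w = y" using T_surj by blast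
  have mi: "- \<i> \<notin> Spec H" and pi: "\<i> \<notin> Spec H" and npi: "norm (resolvent H \<i>) \<le> 1"
    using nonreal_notin_Spec[OF sa, of "- \<i>"] nonreal_notin_Spec[OF sa, of \<i>] by auto
  \<comment> \<open>Subtracting \<open>x\<close> removes \<open>(A\<^sup>* + \<i>) w\<close> and changes the boundary value by an element of \<open>F\<close>.\<close>
  define x where "x = resolvent H (- \<i>) (w' + \<i> *\<^sub>C w)"
  define c where "c = w - x"
  have x: "(x, w' + \<i> *\<^sub>C w - \<i> *\<^sub>C x) \<in> H"
    using resolvent_mem[OF lin mi, of "w' + \<i> *\<^sub>C w"] by (simp add: x_def scaleC_minus_left)
  have "(c, w' - (w' + \<i> *\<^sub>C w - \<i> *\<^sub>C x)) \<in> uadjoint A"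
    unfolding c_def using w(1) x extension_subset[OF H] by (intro uop_diff linear_adjoint) auto
  then have c: "(c, - (\<i> *\<^sub>C c)) \<in> uadjoint A" by (simp add: c_def scaleC_diff_right)
  have "w \<in> Domain (uadjoint A)" "x \<in> Domain (uadjoint A)" using w(1) x extension_subset[OF H] by auto
  then have "T c - y = - T x" by (simp add: T_diff c_def w(2))
  then have Tc: "T c - y \<in> F" using extension_T[OF H x] lagrangian_minus[OF F] by simp
  \<comment> \<open>For \<open>z = (H - \<i>)\<^sup>-\<^sup>1 c\<close> Green's identity expresses \<open>(norm c)\<^sup>2\<close> by boundary values.\<close>
  define z where "z = resolvent H \<i> c"
  have z: "(z, c + \<i> *\<^sub>C z) \<in> H" using resolvent_mem[OF lin pi] by (simp add: z_def)
  then have zA: "(z, c + \<i> *\<^sub>C z) \<in> uadjoint A" using extension_subset[OF H] by auto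
  have zn: "norm z \<le> norm c"
    using norm_blinfun[of "resolvent H \<i>" c] mult_right_mono[OF npi, of "norm c"] by (simp add: z_def)
  have "sympl (T z) (T c) = sympl (T z) y"
    using lagrangian_isotropic[OF F extension_T[OF H z] Tc] by (simp add: sympl_diff_right)
  moreover have "\<langle>c + \<i> *\<^sub>C z, c\<rangle> - \<langle>z, - (\<i> *\<^sub>C c)\<rangle> = \<langle>c, c\<rangle>" by (simp add: cinner_algebra)
  ultimately have "complex_of_real ((norm c)\<^sup>2) = sympl (T z) y"
    using green[OF zA c] by (simp add: cinner_self)
  then have "(norm c)\<^sup>2 = cmod (sympl (T z) y)" by (metis norm_of_real abs_of_nonneg zero_le_power2)
  also have "\<dots> \<le> norm (T z) * norm y" by (rule norm_sympl_le)
  also have "\<dots> \<le> (K * (3 * norm c)) * norm y"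
  proof (intro mult_right_mono order_trans[OF T_bound[OF zA]] mult_left_mono K_nonneg)
    have "norm (c + \<i> *\<^sub>C z) \<le> norm c + norm z"
      by (rule order_trans[OF norm_triangle_ineq]) (simp add: norm_scaleC)
    then show "norm z + norm (c + \<i> *\<^sub>C z) \<le> 3 * norm c" using zn by simp
  qed simp
  finally have "norm c * norm c \<le> norm c * (3 * K * norm y)" by (simp add: power2_eq_square mult_ac)
  then have "norm c \<le> 3 * K * norm y" using K_nonneg
    by (cases "c = 0") (auto simp: mult_le_cancel_left_pos)
  then show ?thesis using c Tc by blast
qed

lemma correct_to_extension:
  assumes H: "extension H F" and w: "(w, w') \<in> uadjoint A" and y: "T w - y \<in> F"
  shows "\<exists>v v'. (v, v') \<in> H \<and> norm (v - w) \<le> 3 * K * norm y \<and> norm (v' - w') \<le> 3 * K * norm y"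
proof -
  have F: "lagrangian F" using H by (auto simp: extension_def)
  obtain c where c: "(c, - (\<i> *\<^sub>C c)) \<in> uadjoint A" "T c - y \<in> F" "norm c \<le> 3 * K * norm y"
    using boundary_correction[OF H] by blast
  have m: "(w - c, w' - (- (\<i> *\<^sub>C c))) \<in> uadjoint A" by (intro uop_diff linear_adjoint w c)
  have "T (w - c) = (T w - y) - (T c - y)" using T_diff[of w c] w c by auto
  then have "T (w - c) \<in> F" using lagrangian_diff[OF F y c(2)] by simp
  from extension_memI[OF H m this] show ?thesis
    using c(3) by (intro exI[of _ "w - c"] exI[of _ "w' - (- (\<i> *\<^sub>C c))"]) (simp add: norm_scaleC)
qed

text \<open>
  The factor \<open>3 K\<close> comes from the boundary correction, \<open>K (M + (1 + Z M))\<close> bounds \<open>T R\<^sub>0\<close> when \<open>M\<close> bounds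
  the resolvent \<open>R\<^sub>0\<close> at \<open>z\<close> and \<open>Z\<close> bounds \<open>z\<close>, and \<open>1 + Z\<close> accounts for applying \<open>H - z\<close> to the correction.
\<close>

definition pert_const :: "real \<Rightarrow> real \<Rightarrow> real"
  where "pert_const M Z = 3 * K * (K * (M + (1 + Z * M))) * (1 + Z)"

text \<open>
  The elements \<open>R\<^sub>0 h\<close> have boundary values in the range of \<open>Q\<^sub>0\<close>; correcting them to the range of \<open>Q\<close> costs
  at most a multiple of \<open>norm (Q - Q\<^sub>0)\<close>.
\<close>

lemma approximate_inverse:
  assumes H0: "extension H0 (range (blinfun_apply Q0))" and H: "extension H (range (blinfun_apply Q))"
    and z: "z \<notin> Spec H0" and M: "norm (resolvent H0 z) \<le> M" and Z: "cmod z \<le> Z"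
    and Q0: "is_orthogonal_projection Q0"
  shows "\<exists>v v'. (v, v') \<in> H \<and> norm (v - resolvent H0 z h) \<le> pert_const M Z * norm (Q - Q0) * norm h
    \<and> norm (v' - z *\<^sub>C v - h) \<le> pert_const M Z * norm (Q - Q0) * norm h"
proof -
  have M0: "M \<ge> 0" and Z0: "Z \<ge> 0" using M Z norm_ge_zero order_trans by blast+
  have lin: "linear_uop H0" using H0 by (simp add: extension_def self_adjoint_linear)
  define w where "w = resolvent H0 z h"
  define w' where "w' = h + z *\<^sub>C w"
  have w: "(w, w') \<in> H0" unfolding w_def w'_def by (rule resolvent_mem[OF lin z])
  then have wA: "(w, w') \<in> uadjoint A" using extension_subset[OF H0] by auto
  have wn: "norm w \<le> M * norm h"
    unfolding w_def by (rule order_trans[OF norm_blinfun]) (intro mult_right_mono M norm_ge_zero)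
  have "norm w' \<le> norm h + cmod z * norm w"
    unfolding w'_def by (rule order_trans[OF norm_triangle_ineq]) (simp add: norm_scaleC)
  also have "\<dots> \<le> norm h + Z * (M * norm h)"
    using wn Z Z0 by (intro add_left_mono mult_mono) auto
  finally have w'n: "norm w' \<le> norm h + Z * (M * norm h)" .
  have Tw: "norm (T w) \<le> K * (M + (1 + Z * M)) * norm h"
  proof -
    have "norm (T w) \<le> K * (norm w + norm w')" by (rule T_bound[OF wA])
    also have "\<dots> \<le> K * (M * norm h + (norm h + Z * (M * norm h)))"
      by (intro mult_left_mono add_mono wn w'n K_nonneg)
    finally show ?thesis by (simp add: algebra_simps)
  qed
  define y where "y = (Q0 - Q) (T w)"
  have "T w - y = Q (T w)"
    using extension_T[OF H0 w] orthogonal_projection_range[OF Q0] by (simp add: y_def blinfun.diff_left)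
  then have "T w - y \<in> range (blinfun_apply Q)" by simp
  from correct_to_extension[OF H wA this] obtain v v' where v: "(v, v') \<in> H"
    "norm (v - w) \<le> 3 * K * norm y" "norm (v' - w') \<le> 3 * K * norm y" by blast
  have "norm y \<le> norm (Q - Q0) * norm (T w)"
    unfolding y_def by (metis norm_blinfun norm_minus_commute)
  also have "\<dots> \<le> norm (Q - Q0) * (K * (M + (1 + Z * M)) * norm h)"
    by (intro mult_left_mono Tw) auto
  finally have yn: "3 * K * norm y \<le> 3 * K * (norm (Q - Q0) * (K * (M + (1 + Z * M)) * norm h))"
    using K_nonneg by (intro mult_left_mono) auto
  define B where "B = 3 * K * (norm (Q - Q0) * (K * (M + (1 + Z * M)) * norm h))"
  have B: "3 * K * norm y \<le> B" using yn by (simp add: B_def)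
  have Bc: "B * (1 + Z) = pert_const M Z * norm (Q - Q0) * norm h"
    by (simp add: B_def pert_const_def mult_ac)
  have B0: "B \<ge> 0" using B K_nonneg by (meson mult_nonneg_nonneg norm_ge_zero order_trans zero_le_numeral)
  have "norm (v' - z *\<^sub>C v - h) = norm ((v' - w') - z *\<^sub>C (v - w))"
    by (simp add: w'_def scaleC_diff_right algebra_simps)
  also have "\<dots> \<le> norm (v' - w') + cmod z * norm (v - w)"
    by (rule order_trans[OF norm_triangle_ineq4]) (simp add: norm_scaleC)
  also have "\<dots> \<le> B + Z * B" using v B Z Z0 by (intro add_mono mult_mono) auto
  finally have "norm (v' - z *\<^sub>C v - h) \<le> B * (1 + Z)" by (simp add: algebra_simps)
  moreover have "norm (v - w) \<le> B * (1 + Z)"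
  proof -
    have "norm (v - w) \<le> B" using v(2) B by simp
    also have "\<dots> \<le> B * (1 + Z)" using B0 Z0 by (simp add: algebra_simps)
    finally show ?thesis .
  qed
  ultimately show ?thesis using v(1) unfolding Bc w_def by blast
qed

text \<open>
  Pairing \<open>u\<close> with an approximate solution \<open>v\<close> of \<open>(H - z) v = u\<close> and moving \<open>H - z\<close> to the other side: an
  approximate right inverse at \<open>z\<close> bounds the operator from below at the conjugate point.
\<close>

lemma lower_bound_of_approximate_inverse:
  assumes sa: "self_adjoint_uop H" and M: "M > 0"
    and approx: "\<And>h. \<exists>v v'. (v, v') \<in> H \<and> norm v \<le> M * norm h \<and> norm (v' - z *\<^sub>C v - h) \<le> norm h / 2"
    and u: "(u, u') \<in> H"
  shows "1 / (2 * M) * norm u \<le> norm (u' - cnj z *\<^sub>C u)"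
proof (cases "u = 0")
  case False
  obtain v v' where v: "(v, v') \<in> H" "norm v \<le> M * norm u" "norm (v' - z *\<^sub>C v - u) \<le> norm u / 2"
    using approx[of u] by blast
  have "\<langle>u, u\<rangle> = \<langle>u' - cnj z *\<^sub>C u, v\<rangle> - \<langle>u, v' - z *\<^sub>C v - u\<rangle>"
    using self_adjoint_symmetric[OF sa u v(1)] by (simp add: cinner_algebra)
  then have "complex_of_real ((norm u)\<^sup>2) = \<langle>u' - cnj z *\<^sub>C u, v\<rangle> - \<langle>u, v' - z *\<^sub>C v - u\<rangle>"
    by (simp only: cinner_self)
  then have "(norm u)\<^sup>2 = cmod (\<langle>u' - cnj z *\<^sub>C u, v\<rangle> - \<langle>u, v' - z *\<^sub>C v - u\<rangle>)"
    by (metis norm_of_real abs_of_nonneg zero_le_power2)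
  also have "\<dots> \<le> norm (u' - cnj z *\<^sub>C u) * norm v + norm u * norm (v' - z *\<^sub>C v - u)"
    by (rule order_trans[OF norm_triangle_ineq4]) (intro add_mono norm_cinner_le)
  also have "\<dots> \<le> norm (u' - cnj z *\<^sub>C u) * (M * norm u) + norm u * (norm u / 2)"
    by (intro add_mono mult_left_mono v) auto
  finally have "norm u * (norm u / 2) \<le> norm u * (norm (u' - cnj z *\<^sub>C u) * M)"
    by (simp add: power2_eq_square algebra_simps)
  then have "norm u / 2 \<le> norm (u' - cnj z *\<^sub>C u) * M" using False by (simp add: mult_le_cancel_left)
  then show ?thesis using M by (simp add: field_simps)
qed simp

lemma resolvent_perturbation:
  assumes H0: "extension H0 (range (blinfun_apply Q0))" and H: "extension H (range (blinfun_apply Q))"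
    and z: "z \<notin> Spec H0" and M: "norm (resolvent H0 z) \<le> M" "norm (resolvent H0 (cnj z)) \<le> M"
    and Z: "cmod z \<le> Z" and Q0: "is_orthogonal_projection Q0"
    and small: "pert_const M Z * norm (Q - Q0) \<le> 1 / 2"
  shows "z \<notin> Spec H" "norm (resolvent H z) \<le> 2 * (M + 1)"
    "norm (resolvent H z - resolvent H0 z) \<le> (2 * M + 3) * (pert_const M Z * norm (Q - Q0))"
proof -
  define \<delta> where "\<delta> = pert_const M Z * norm (Q - Q0)"
  have sa: "self_adjoint_uop H" and sa0: "self_adjoint_uop H0" using H H0 by (auto simp: extension_def)
  note lin = self_adjoint_linear[OF sa]
  have M0: "M \<ge> 0" using M norm_ge_zero order_trans by blast
  have half: "\<delta> * norm h \<le> norm h / 2" for h :: 'a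
    using mult_right_mono[OF small, of "norm h"] by (simp add: \<delta>_def)
  have approx: "\<exists>v v'. (v, v') \<in> H \<and> norm v \<le> (M + 1) * norm h \<and> norm (v' - s *\<^sub>C v - h) \<le> norm h / 2"
    if s: "s = z \<or> s = cnj z" for s h
  proof -
    have "s \<notin> Spec H0" "norm (resolvent H0 s) \<le> M" "cmod s \<le> Z"
      using s z M Z cnj_notin_Spec[OF sa0 z] by auto
    from approximate_inverse[OF H0 H this Q0, of h] obtain v v' where v: "(v, v') \<in> H"
      "norm (v - resolvent H0 s h) \<le> \<delta> * norm h"
      "norm (v' - s *\<^sub>C v - h) \<le> \<delta> * norm h" unfolding \<delta>_def by blast
    have "norm v \<le> norm (v - resolvent H0 s h) + norm (resolvent H0 s h)"
      by (metis add.commute norm_triangle_sub)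
    also have "\<dots> \<le> norm h / 2 + M * norm h"
      using v(2) half[of h] order_trans[OF norm_blinfun mult_right_mono[OF \<open>norm (resolvent H0 s) \<le> M\<close> norm_ge_zero], of h]
      by (intro add_mono) auto
    also have "\<dots> \<le> (M + 1) * norm h" by (simp add: algebra_simps)
    finally show ?thesis using v half[of h] by (meson order_trans)
  qed
  have lb: "1 / (2 * (M + 1)) * norm u \<le> norm (u' - z *\<^sub>C u)" if "(u, u') \<in> H" for u u'
    using lower_bound_of_approximate_inverse[OF sa _ approx[of "cnj z"] that] M0 by simp
  have lb': "1 / (2 * (M + 1)) * norm u \<le> norm (u' - cnj z *\<^sub>C u)" if "(u, u') \<in> H" for u u'
    using lower_bound_of_approximate_inverse[OF sa _ approx[of z] that] M0 by simp
  have pos: "1 / (2 * (M + 1)) > 0" using M0 by simp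
  show zH: "z \<notin> Spec H" by (rule resolvent_of_lower_bounds(1)[OF sa pos lb lb'])
  show RM: "norm (resolvent H z) \<le> 2 * (M + 1)"
    using resolvent_of_lower_bounds(2)[OF sa pos lb lb'] by simp
  have "Z \<ge> 0" using Z norm_ge_zero order_trans by blast
  then have d0: "\<delta> \<ge> 0"
    unfolding \<delta>_def pert_const_def using K_nonneg M0
    by (intro mult_nonneg_nonneg add_nonneg_nonneg) auto
  show "norm (resolvent H z - resolvent H0 z) \<le> (2 * M + 3) * (pert_const M Z * norm (Q - Q0))"
    unfolding \<delta>_def[symmetric]
  proof (rule norm_blinfun_bound)
    show "0 \<le> (2 * M + 3) * \<delta>" using d0 M0 by simp
    fix h
    obtain v v' where v: "(v, v') \<in> H"
      "norm (v - resolvent H0 z h) \<le> \<delta> * norm h"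
      "norm (v' - z *\<^sub>C v - h) \<le> \<delta> * norm h"
      using approximate_inverse[OF H0 H z M(1) Z Q0, of h] unfolding \<delta>_def by blast
    have "(resolvent H z - resolvent H0 z) h
        = (v - resolvent H0 z h) - resolvent H z (v' - z *\<^sub>C v - h)"
      using resolvent_left[OF lin zH v(1)] by (simp add: blinfun.diff_left blinfun.diff_right)
    then have "norm ((resolvent H z - resolvent H0 z) h)
      \<le> norm (v - resolvent H0 z h) + norm (resolvent H z (v' - z *\<^sub>C v - h))"
      using norm_triangle_ineq4 by metis
    also have "\<dots> \<le> \<delta> * norm h + 2 * (M + 1) * (\<delta> * norm h)"
    proof (intro add_mono v(2))
      show "norm (resolvent H z (v' - z *\<^sub>C v - h)) \<le> 2 * (M + 1) * (\<delta> * norm h)"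
        by (rule order_trans[OF norm_blinfun]) (intro mult_mono RM v(3), use M0 in auto)
    qed
    finally show "norm ((resolvent H z - resolvent H0 z) h) \<le> (2 * M + 3) * \<delta> * norm h"
      by (simp add: algebra_simps)
  qed
qed

end

section \<open>The isolated eigenvalue\<close>

lemma isolating_radius_gap:
  assumes "l isolated_in Spec H"
  shows "isolating_radius H l > 0"
    and "z \<noteq> l \<Longrightarrow> dist l z < 2 * isolating_radius H l \<Longrightarrow> z \<notin> Spec H"
proof -
  obtain U where U: "open U" "U \<inter> Spec H = {l}" using assms by (auto simp: isolated_in_def)
  show "isolating_radius H l > 0"
  proof (cases "Spec H - {l} = {}")
    case False
    have "l \<notin> closure (Spec H - {l})"
      unfolding closure_iff_nhds_not_empty using U by blast
    then have "infdist l (Spec H - {l}) \<noteq> 0" using in_closure_iff_infdist_zero[OF False] by blast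
    then have "infdist l (Spec H - {l}) > 0" using infdist_nonneg[of l "Spec H - {l}"] by linarith
    then show ?thesis using False by (simp add: isolating_radius_def)
  qed (simp add: isolating_radius_def)
  assume z: "z \<noteq> l" "dist l z < 2 * isolating_radius H l"
  show "z \<notin> Spec H"
  proof
    assume "z \<in> Spec H"
    then have "z \<in> Spec H - {l}" using z(1) by simp
    then show False
      using z(2) infdist_le[of z "Spec H - {l}" l]
      by (auto simp: isolating_radius_def split: if_splits)
  qed
qed

text \<open>
  \<open>H\<^sub>0\<close> stands for the self-adjoint operator at \<open>t\<^sub>0\<close> and \<open>l\<close> for its isolated eigenvalue.
\<close>

locale base_point = triplet A T K for A :: "'a::chilbert_space uop" and T :: "'a \<Rightarrow> 'b::chilbert_space \<times> 'b" and K +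
  fixes H\<^sub>0 :: "'a uop" and Q\<^sub>0 :: "('b \<times> 'b) \<Rightarrow>\<^sub>L ('b \<times> 'b)" and l :: complex
  assumes ext0: "extension H\<^sub>0 (range (blinfun_apply Q\<^sub>0))" and proj0: "is_orthogonal_projection Q\<^sub>0"
    and isolated: "l isolated_in Spec H\<^sub>0"
    and eigenvector: "\<exists>n. n \<noteq> 0 \<and> (n, l *\<^sub>C n) \<in> H\<^sub>0"
    and finite_multiplicity: "\<exists>G. finite G \<and> eigenspace_uop H\<^sub>0 l \<subseteq> complex_vector.span G"
begin

abbreviation "N \<equiv> eigenspace_uop H\<^sub>0 l"
abbreviation "F\<^sub>0 \<equiv> range (blinfun_apply Q\<^sub>0)"
definition "rad = isolating_radius H\<^sub>0 l"
abbreviation "Pl \<equiv> blinfun_apply (riesz_projection (circlepath l rad) H\<^sub>0)"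
abbreviation "Sl \<equiv> blinfun_apply (reduced_resolvent (circlepath l rad) H\<^sub>0 l)"

lemma self_adjoint0: "self_adjoint_uop H\<^sub>0" and lagrangian0: "lagrangian F\<^sub>0"
  using ext0 by (auto simp: extension_def)

lemma linear0: "linear_uop H\<^sub>0"
  by (rule self_adjoint_linear[OF self_adjoint0])

lemma H0_adjoint: "(u, u') \<in> H\<^sub>0 \<Longrightarrow> (u, u') \<in> uadjoint A"
  using extension_subset[OF ext0] by auto

lemma cnj_l: "cnj l = l"
proof -
  obtain n where n: "n \<noteq> 0" "(n, l *\<^sub>C n) \<in> H\<^sub>0" using eigenvector by blast
  from self_adjoint_symmetric[OF self_adjoint0 n(2,2)] have "l * \<langle>n, n\<rangle> = cnj l * \<langle>n, n\<rangle>"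
    by (simp add: cinner_algebra)
  then show ?thesis using n(1) by simp
qed

lemma Im_l: "Im l = 0"
  using cnj_l by (metis Reals_cnj_iff complex_is_Real_iff)

lemma rad_pos: "rad > 0"
  unfolding rad_def by (rule isolating_radius_gap[OF isolated])

lemma gap: "z \<noteq> l \<Longrightarrow> dist l z < 2 * rad \<Longrightarrow> z \<notin> Spec H\<^sub>0"
  unfolding rad_def by (rule isolating_radius_gap[OF isolated])

text \<open>
  The gap around \<open>l\<close> has radius \<open>2 rad\<close>.  On the disc of radius \<open>5/4 rad\<close>, which is a little larger than the one
  bounded by the contour, the distance to the rest of the spectrum is still at least half of \<open>dist l z\<close>.
\<close>

lemma resolvent_bound0:
  assumes z: "z \<noteq> l" "dist l z < 5 / 4 * rad"
  shows "norm (resolvent H\<^sub>0 z) * dist l z \<le> 2"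
proof -
  have d: "dist l z > 0" "dist l z < 2 * rad" using z rad_pos by auto
  have zn: "z \<notin> Spec H\<^sub>0" using gap z d by blast
  have "norm (resolvent H\<^sub>0 z) \<le> 2 / dist l z"
  proof (rule norm_blinfun_bound)
    fix h
    let ?R = "resolvent H\<^sub>0 z h"
    have "dist l z / 2 * norm ?R \<le> min (dist l z) (2 * rad - dist l z) * norm ?R"
      using z d by (intro mult_right_mono) auto
    also have "\<dots> \<le> norm (h + z *\<^sub>C ?R - z *\<^sub>C ?R)"
      by (rule punctured_disc_lower_bound[OF self_adjoint0 Im_l gap d(2) resolvent_mem[OF linear0 zn]])
    finally show "norm ?R \<le> 2 / dist l z * norm h" using d(1) by (simp add: field_simps)
  qed (use d in simp)
  then show ?thesis using d(1) by (simp add: field_simps)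
qed

lemma spectral_circle0: "spectral_circle H\<^sub>0 l rad (rad / 2) (5 / 4 * rad) (2 / (rad / 2))"
  by (rule punctured_disc_spectral_circle[OF self_adjoint0 Im_l])
    (use rad_pos gap resolvent_bound0 in auto)

sublocale sc0: spectral_circle H\<^sub>0 l rad "rad / 2" "5 / 4 * rad" "2 / (rad / 2)"
  by (rule spectral_circle0)

lemma N_iff: "n \<in> N \<longleftrightarrow> (n, l *\<^sub>C n) \<in> H\<^sub>0"
  by (simp add: eigenspace_uop_def)

lemma P0_in_N: "Pl x \<in> N"
  unfolding N_iff
  by (rule riesz_isolated[OF self_adjoint0 Im_l rad_pos, where b = "5 / 4 * rad" and C = 2])
    (use rad_pos gap resolvent_bound0 in auto)

lemma P0_N: "n \<in> N \<Longrightarrow> Pl n = n"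
  unfolding N_iff by (rule sc0.riesz_eigenvector)

lemma range_P0: "range Pl = N"
  using P0_in_N P0_N by (metis image_subset_iff rangeI subsetI subset_antisym)

lemma subspace_N: "complex_vector.subspace N"
  unfolding complex_vector.subspace_def N_iff
proof (intro conjI ballI allI)
  show "(0, l *\<^sub>C 0) \<in> H\<^sub>0" using uop_zero[OF linear0] by simp
  fix x y assume "x \<in> N" "y \<in> N"
  then show "(x + y, l *\<^sub>C (x + y)) \<in> H\<^sub>0"
    unfolding N_iff scaleC_add_right by (rule uop_add[OF linear0])
next
  fix c x assume "x \<in> N"
  then have "(c *\<^sub>C x, c *\<^sub>C l *\<^sub>C x) \<in> H\<^sub>0" unfolding N_iff by (rule uop_scale[OF linear0])
  then show "(c *\<^sub>C x, l *\<^sub>C c *\<^sub>C x) \<in> H\<^sub>0" by (simp add: scaleC_scaleC mult.commute)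
qed

lemma N_add: "m \<in> N \<Longrightarrow> n \<in> N \<Longrightarrow> m + n \<in> N"
  by (rule complex_vector.subspace_add[OF subspace_N])

lemma N_diff: "m \<in> N \<Longrightarrow> n \<in> N \<Longrightarrow> m - n \<in> N"
  by (rule complex_vector.subspace_diff[OF subspace_N])

lemma N_scale: "n \<in> N \<Longrightarrow> c *\<^sub>C n \<in> N"
  by (rule complex_vector.subspace_scale[OF subspace_N])

lemma T_N: "n \<in> N \<Longrightarrow> T n \<in> F\<^sub>0"
  unfolding N_iff by (rule extension_T[OF ext0])

lemma N_domain: "n \<in> N \<Longrightarrow> n \<in> Domain (uadjoint A)"
  unfolding N_iff using H0_adjoint by blast

lemma N_eqI:
  assumes "m \<in> N" "m' \<in> N" "\<And>n. n \<in> N \<Longrightarrow> \<langle>m, n\<rangle> = \<langle>m', n\<rangle>"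
  shows "m = m'"
proof -
  have "\<langle>m - m', m - m'\<rangle> = 0"
    unfolding cinner_diff_left[of m m'] using assms(3)[OF N_diff[OF assms(1,2)]] by (simp only: right_minus_eq)
  then show ?thesis by simp
qed

lemma N_basis: obtains E where "finite E" "orthonormal E" "complex_vector.span E = N"
  using finite_multiplicity orthonormal_basis_exists[OF subspace_N] by metis

lemma P0_cinner_N: "n \<in> N \<Longrightarrow> \<langle>Pl x, n\<rangle> = \<langle>x, n\<rangle>"
  by (simp add: sc0.riesz_self_adjoint P0_N)

lemma S0_cinner_N: "n \<in> N \<Longrightarrow> \<langle>Sl x, n\<rangle> = 0"
  by (simp add: sc0.reduced_self_adjoint sc0.reduced_eigenvector N_iff)

lemma P0_orthogonal: "(\<And>n. n \<in> N \<Longrightarrow> \<langle>x, n\<rangle> = 0) \<Longrightarrow> Pl x = 0"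
  using P0_cinner_N[OF P0_in_N, of x x] P0_in_N[of x] by (metis cinner_self_eq_0)

text \<open>
  Subtracting any element with boundary value \<open>y\<close> leaves a problem in the domain of \<open>H\<^sub>0\<close>.  Its right-hand side
  is orthogonal to \<open>N\<close> by Green's identity, so the reduced resolvent \<open>Sl\<close> solves it.
\<close>

lemma boundary_problem_solvable:
  assumes "\<And>n. n \<in> N \<Longrightarrow> \<langle>h, n\<rangle> = sympl y (T n)"
  shows "\<exists>w w'. (w, w') \<in> uadjoint A \<and> w' - l *\<^sub>C w = h \<and> T w - y \<in> F\<^sub>0"
proof -
  obtain w w' where w: "(w, w') \<in> uadjoint A" "T w = y" using T_surj by blast
  define z where "z = h - (w' - l *\<^sub>C w)"
  have "Pl z = 0"
  proof (rule P0_orthogonal)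
    fix n assume n: "n \<in> N"
    have "\<langle>w', n\<rangle> - \<langle>w, l *\<^sub>C n\<rangle> = sympl y (T n)"
      using green[OF w(1), of n "l *\<^sub>C n"] n H0_adjoint w(2) by (simp add: N_iff)
    then show "\<langle>z, n\<rangle> = 0" using assms[OF n] by (simp add: z_def cinner_algebra cnj_l)
  qed
  then have S: "(Sl z, l *\<^sub>C Sl z + z) \<in> H\<^sub>0" using sc0.reduced_graph[of z] by simp
  have "(w + Sl z, w' + (l *\<^sub>C Sl z + z)) \<in> uadjoint A"
    by (intro uop_add linear_adjoint w H0_adjoint S)
  moreover have "w' + (l *\<^sub>C Sl z + z) - l *\<^sub>C (w + Sl z) = h"
    by (simp add: z_def scaleC_add_right)
  moreover have "w \<in> Domain (uadjoint A)" "Sl z \<in> Domain (uadjoint A)" using w(1) H0_adjoint[OF S] by auto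
  then have "T (w + Sl z) - y = T (Sl z)" by (simp add: T_add w(2))
  then have "T (w + Sl z) - y \<in> F\<^sub>0" using extension_T[OF ext0 S] by simp
  ultimately show ?thesis by blast
qed

text \<open>
  The adjoint of \<open>T Sl\<close>, computed from Green's identity: choosing \<open>w\<close> with \<open>T w = J y\<close>, it maps \<open>y\<close> to
  \<open>w - Pl w - Sl (A\<^sup>* - l) w\<close>.
\<close>

lemma cadjoint_TS_exists:
  "\<exists>g. (\<forall>x. \<langle>T (Sl x), y\<rangle> = \<langle>x, g\<rangle>) \<and> T g - sympl_J y \<in> F\<^sub>0 \<and> (\<forall>n\<in>N. \<langle>g, n\<rangle> = 0) \<and>
    (\<exists>e\<in>N. (g, l *\<^sub>C g + e) \<in> uadjoint A \<and> (\<forall>n\<in>N. \<langle>e, n\<rangle> = sympl (sympl_J y) (T n)))"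
proof -
  obtain w w' where w: "(w, w') \<in> uadjoint A" "T w = sympl_J y" using T_surj by blast
  define z where "z = w' - l *\<^sub>C w"
  define g where "g = w - Pl w - Sl z"
  have S: "(Sl x, l *\<^sub>C Sl x + x - Pl x) \<in> H\<^sub>0" for x by (rule sc0.reduced_graph)
  have PA: "(Pl w, l *\<^sub>C Pl w) \<in> H\<^sub>0" using P0_in_N N_iff by blast
  have "\<langle>T (Sl x), y\<rangle> = \<langle>x, g\<rangle>" for x
  proof -
    have "\<langle>T (Sl x), y\<rangle> = sympl (T (Sl x)) (T w)"
      unfolding w(2) sympl_eq_cinner by (simp add: cinner_sympl_J cinner_minus_right)
    also have "\<dots> = \<langle>l *\<^sub>C Sl x + x - Pl x, w\<rangle> - \<langle>Sl x, w'\<rangle>"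
      using green[OF H0_adjoint[OF S] w(1)] by simp
    also have "\<dots> = \<langle>x, w\<rangle> - \<langle>Pl x, w\<rangle> - \<langle>Sl x, z\<rangle>"
      by (simp add: z_def cinner_algebra cnj_l)
    finally show ?thesis
      by (simp add: g_def cinner_algebra sc0.riesz_self_adjoint sc0.reduced_self_adjoint)
  qed
  moreover have "T g - sympl_J y \<in> F\<^sub>0"
  proof -
    have dom: "w \<in> Domain (uadjoint A)" "Pl w \<in> Domain (uadjoint A)" "Sl z \<in> Domain (uadjoint A)"
      "w - Pl w \<in> Domain (uadjoint A)"
      using w(1) H0_adjoint[OF PA] H0_adjoint[OF S[of z]] uop_diff[OF linear_adjoint w(1) H0_adjoint[OF PA]]
      by auto
    have "T g - sympl_J y = - (T (Pl w) + T (Sl z))"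
      unfolding g_def by (simp add: T_diff dom w(2))
    then show ?thesis
      using lagrangian_minus[OF lagrangian0 lagrangian_add[OF lagrangian0 extension_T[OF ext0 PA] extension_T[OF ext0 S]]]
      by simp
  qed
  moreover have "\<langle>g, n\<rangle> = 0" if "n \<in> N" for n
    using that by (simp add: g_def cinner_algebra P0_cinner_N S0_cinner_N)
  moreover have "(g, l *\<^sub>C g + Pl z) \<in> uadjoint A"
  proof -
    have "(w - Pl w - Sl z, w' - l *\<^sub>C Pl w - (l *\<^sub>C Sl z + z - Pl z)) \<in> uadjoint A"
      by (intro uop_diff linear_adjoint w(1) H0_adjoint PA S)
    moreover have "w' - l *\<^sub>C Pl w - (l *\<^sub>C Sl z + z - Pl z) = l *\<^sub>C g + Pl z"
      by (simp add: g_def z_def scaleC_diff_right)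
    ultimately show ?thesis by (simp add: g_def)
  qed
  moreover have "\<langle>Pl z, n\<rangle> = sympl (sympl_J y) (T n)" if n: "n \<in> N" for n
    using green[OF w(1), of n "l *\<^sub>C n"] n H0_adjoint w(2)
    by (simp add: N_iff P0_cinner_N[OF n] z_def cinner_algebra cnj_l)
  ultimately show ?thesis using P0_in_N by blast
qed

definition "TS_adj = cadjoint (T \<circ> Sl)"

lemma TS_adj:
  "\<langle>T (Sl x), y\<rangle> = \<langle>x, TS_adj y\<rangle>" "T (TS_adj y) - sympl_J y \<in> F\<^sub>0" "n \<in> N \<Longrightarrow> \<langle>TS_adj y, n\<rangle> = 0"
  "\<exists>e\<in>N. (TS_adj y, l *\<^sub>C TS_adj y + e) \<in> uadjoint A \<and> (\<forall>n\<in>N. \<langle>e, n\<rangle> = sympl (sympl_J y) (T n))"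
proof -
  obtain G where G: "\<And>y x. \<langle>T (Sl x), y\<rangle> = \<langle>x, G y\<rangle>" "\<And>y. T (G y) - sympl_J y \<in> F\<^sub>0"
    "\<And>y n. n \<in> N \<Longrightarrow> \<langle>G y, n\<rangle> = 0"
    "\<And>y. \<exists>e\<in>N. (G y, l *\<^sub>C G y + e) \<in> uadjoint A \<and> (\<forall>n\<in>N. \<langle>e, n\<rangle> = sympl (sympl_J y) (T n))"
    using cadjoint_TS_exists by metis
  have "TS_adj = G" unfolding TS_adj_def by (rule cadjoint_eqI) (simp add: G(1))
  then show "\<langle>T (Sl x), y\<rangle> = \<langle>x, TS_adj y\<rangle>" "T (TS_adj y) - sympl_J y \<in> F\<^sub>0" "n \<in> N \<Longrightarrow> \<langle>TS_adj y, n\<rangle> = 0"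
    "\<exists>e\<in>N. (TS_adj y, l *\<^sub>C TS_adj y + e) \<in> uadjoint A \<and> (\<forall>n\<in>N. \<langle>e, n\<rangle> = sympl (sympl_J y) (T n))"
    using G by auto
qed

lemma TS_adj_domain: "TS_adj y \<in> Domain (uadjoint A)"
  using TS_adj(4)[of y] by blast

lemma TS_adj_add: "TS_adj (y + y') = TS_adj y + TS_adj y'"
  by (rule cinner_eqI_right) (simp add: TS_adj(1)[symmetric] cinner_add_right)

lemma TS_adj_scale: "TS_adj (c *\<^sub>C y) = c *\<^sub>C TS_adj y"
  by (rule cinner_eqI_right) (simp add: TS_adj(1)[symmetric] cinner_scaleC_right)

text \<open>
  Both \<open>TS_adj y\<close> and \<open>TS_adj y'\<close> solve \<open>(A\<^sup>* - l) v \<in> N\<close> and are orthogonal to \<open>N\<close>, so \<open>\<omega>\<close> vanishes on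
  their boundary values, which are \<open>J y\<close> and \<open>J y'\<close> up to elements of \<open>F\<^sub>0\<close>.
\<close>

lemma T_TS_adj_symmetric:
  "\<langle>T (TS_adj y), y'\<rangle> = \<langle>y, T (TS_adj y')\<rangle> - \<langle>y, sympl_J y'\<rangle>"
proof -
  define v v' where "v = TS_adj y" and "v' = TS_adj y'"
  obtain e e' where e: "e \<in> N" "(v, l *\<^sub>C v + e) \<in> uadjoint A" and e': "e' \<in> N" "(v', l *\<^sub>C v' + e') \<in> uadjoint A"
    using TS_adj(4) unfolding v_def v'_def by blast
  have o: "\<langle>e, v'\<rangle> = 0" "\<langle>v, e'\<rangle> = 0"
    using TS_adj(3)[OF e(1), of y'] TS_adj(3)[OF e'(1), of y] cinner_commute[of e v']
    by (auto simp: v_def v'_def)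
  define q q' where "q = T v - sympl_J y" and "q' = T v' - sympl_J y'"
  have q: "q \<in> F\<^sub>0" "q' \<in> F\<^sub>0" using TS_adj(2) by (auto simp: q_def q'_def v_def v'_def)
  have "sympl (T v) (T v') = 0"
    using green[OF e(2) e'(2)] o by (simp add: cinner_algebra cnj_l)
  then have 1: "sympl (T v) (sympl_J y') = - sympl (T v) q'" by (simp add: q'_def sympl_diff_right)
  have "sympl q q' = 0" by (rule lagrangian_isotropic[OF lagrangian0 q])
  then have 2: "sympl (T v) q' = sympl (sympl_J y) q'" by (simp add: q_def sympl_diff_left)
  have "\<langle>T v, y'\<rangle> = sympl (T v) (sympl_J y')"
    unfolding sympl_eq_cinner by (simp add: cinner_sympl_J cinner_minus_right)
  also have "\<dots> = \<langle>y, q'\<rangle>" unfolding 1 2 by (simp add: sympl_eq_cinner cinner_minus_left)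
  finally show ?thesis by (simp add: v_def v'_def q'_def cinner_diff_right)
qed

text \<open>
  \<open>F Pl\<close> has finite rank: expanding in an orthonormal basis of \<open>N\<close> gives an adjoint for every linear \<open>F\<close>.
\<close>

lemma cadjoint_P0:
  assumes add: "\<And>m n. m \<in> N \<Longrightarrow> n \<in> N \<Longrightarrow> F (m + n) = F m + F n"
    and scale: "\<And>c n. n \<in> N \<Longrightarrow> F (c *\<^sub>C n) = c *\<^sub>C F n"
  shows "cadjoint (F \<circ> Pl) y \<in> N" and "n \<in> N \<Longrightarrow> \<langle>cadjoint (F \<circ> Pl) y, n\<rangle> = \<langle>y, F n\<rangle>"
proof -
  obtain E where E: "finite E" "orthonormal E" "complex_vector.span E = N" by (rule N_basis)
  define G where "G y = (\<Sum>e\<in>E. \<langle>y, F e\<rangle> *\<^sub>C e)" for y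
  have EN: "e \<in> N" if "e \<in> E" for e using E(3) that complex_vector.span_base by blast
  have GN: "G y \<in> N" for y
    unfolding G_def using EN by (intro complex_vector.subspace_sum[OF subspace_N] N_scale)
  have F_sum: "F (\<Sum>e\<in>E'. c e *\<^sub>C e) = (\<Sum>e\<in>E'. c e *\<^sub>C F e)" if "E' \<subseteq> E" for E' c
    using finite_subset[OF that E(1)] that
  proof (induction E' rule: finite_induct)
    case empty
    show ?case using scale[of 0 0] complex_vector.subspace_0[OF subspace_N] by simp
  next
    case (insert e E')
    then have "(\<Sum>e\<in>E'. c e *\<^sub>C e) \<in> N"
      using EN by (intro complex_vector.subspace_sum[OF subspace_N] N_scale) auto
    then show ?case using insert EN by (simp add: add scale N_scale)
  qed
  have P0E: "Pl x = (\<Sum>e\<in>E. \<langle>x, e\<rangle> *\<^sub>C e)" for x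
    using ortho_sum_eq[OF E(1,2), of "Pl x"] P0_in_N[of x] EN
    by (simp add: E(3) ortho_sum_def P0_cinner_N)
  have "\<langle>(F \<circ> Pl) x, y\<rangle> = \<langle>x, G y\<rangle>" for x y
  proof -
    have "\<langle>(F \<circ> Pl) x, y\<rangle> = (\<Sum>e\<in>E. \<langle>x, e\<rangle> * \<langle>F e, y\<rangle>)"
      by (simp add: P0E F_sum cinner_sum_left cinner_scaleC_left)
    also have "\<dots> = (\<Sum>e\<in>E. \<langle>x, \<langle>y, F e\<rangle> *\<^sub>C e\<rangle>)"
      by (intro sum.cong refl) (simp add: cinner_scaleC_right cinner_commute[symmetric] mult.commute)
    finally show ?thesis by (simp add: G_def cinner_sum_right)
  qed
  then have eq: "cadjoint (F \<circ> Pl) = G" and adj: "\<And>x y. \<langle>F (Pl x), y\<rangle> = \<langle>x, G y\<rangle>"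
    by (auto intro: cadjoint_eqI)
  show "cadjoint (F \<circ> Pl) y \<in> N" unfolding eq by (rule GN)
  assume n: "n \<in> N"
  show "\<langle>cadjoint (F \<circ> Pl) y, n\<rangle> = \<langle>y, F n\<rangle>"
    unfolding eq using adj[of n y] cinner_commute[of "G y" n] cinner_commute[of y "F n"] P0_N[OF n] by simp
qed

end

section \<open>Derivatives of the projections and of the eigenvalue operator\<close>

text \<open>
  The identities for \<open>Qd\<close> and \<open>Qdd\<close> are those obtained by differentiating \<open>Q\<^sup>* = Q\<close>, \<open>J Q + Q J = J\<close> and \<open>Q\<^sup>2 = Q\<close>.
\<close>

locale second_order = base_point A T K H\<^sub>0 Q\<^sub>0 l
  for A :: "'a::chilbert_space uop" and T :: "'a \<Rightarrow> 'b::chilbert_space \<times> 'b" and K H\<^sub>0 Q\<^sub>0 l +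
  fixes Qd Qdd :: "('b \<times> 'b) \<Rightarrow>\<^sub>L ('b \<times> 'b)"
  assumes Qd_scale: "\<And>c x. Qd (c *\<^sub>C x) = c *\<^sub>C Qd x"
    and Qdd_scale: "\<And>c x. Qdd (c *\<^sub>C x) = c *\<^sub>C Qdd x"
    and Qd_adj: "\<And>x y. \<langle>Qd x, y\<rangle> = \<langle>x, Qd y\<rangle>"
    and Qdd_adj: "\<And>x y. \<langle>Qdd x, y\<rangle> = \<langle>x, Qdd y\<rangle>"
    and Qd_J: "\<And>x. sympl_J (Qd x) = - Qd (sympl_J x)"
    and Qdd_J: "\<And>x. sympl_J (Qdd x) = - Qdd (sympl_J x)"
    and Qd_idem: "\<And>x. Q\<^sub>0 (Qd x) + Qd (Q\<^sub>0 x)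
      = Qd x"
begin

definition "Wdot = cadjoint (T \<circ> Pl) \<circ> sympl_J \<circ> blinfun_apply Qd \<circ> T \<circ> Pl"

definition "Wddot = (\<lambda>h.
      (cadjoint (T \<circ> Pl) \<circ> sympl_J \<circ> blinfun_apply Qdd \<circ> T \<circ> Pl) h
      - 2 *\<^sub>C (cadjoint (T \<circ> cadjoint (T \<circ> Sl) \<circ> blinfun_apply Qd \<circ> sympl_J \<circ> T \<circ> Pl)
               \<circ> blinfun_apply Qd \<circ> sympl_J \<circ> T \<circ> Pl) h)"

abbreviation Y :: "'a \<Rightarrow> 'b \<times> 'b" where "Y n \<equiv> Qd (sympl_J (T n))"

lemma Y_eq: "Y n = - sympl_J (Qd (T n))"
  by (simp add: Qd_J)

lemma J_Y: "sympl_J (Y n) = Qd (T n)"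
  by (simp add: Y_eq sympl_J_minus)

lemma T_N_add: "m \<in> N \<Longrightarrow> n \<in> N \<Longrightarrow> T (m + n) = T m + T n"
  by (simp add: T_add N_domain)

lemma T_N_scale: "n \<in> N \<Longrightarrow> T (c *\<^sub>C n) = c *\<^sub>C T n"
  by (simp add: T_scaleC N_domain)

text \<open>
  \<open>Qd\<close> maps \<open>F\<^sub>0\<close> into the kernel of \<open>Q\<^sub>0\<close> and this kernel into \<open>F\<^sub>0\<close>, so \<open>Qd (Qd f)\<close> lies in \<open>F\<^sub>0\<close>, which is orthogonal
  to \<open>J F\<^sub>0\<close>.
\<close>

lemma Qd_Qd_orthogonal:
  assumes "f \<in> F\<^sub>0" "g \<in> F\<^sub>0"
  shows "\<langle>Qd f, Qd (sympl_J g)\<rangle> = 0"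
proof -
  have f: "Q\<^sub>0 f = f" using assms(1) orthogonal_projection_range[OF proj0] by blast
  have "Q\<^sub>0 (Qd f) = 0" using Qd_idem[of f] by (simp add: f)
  then have "Q\<^sub>0 (Qd (Qd f)) = Qd (Qd f)"
    using Qd_idem[of "Qd f"] by simp
  then have "Qd (Qd f) \<in> F\<^sub>0" by (metis rangeI)
  from lagrangian_isotropic[OF lagrangian0 this assms(2)] show ?thesis
    by (simp add: Qd_adj[symmetric] sympl_eq_cinner cinner_sympl_J)
qed

lemma Wdot_in_N: "Wdot u \<in> N"
  unfolding Wdot_def o_def by (rule cadjoint_P0(1)[unfolded o_def]) (simp_all add: T_N_add T_N_scale)

lemma Wdot_cinner:
  assumes "u \<in> N" "n \<in> N"
  shows "\<langle>Wdot u, n\<rangle> = sympl (Qd (T u)) (T n)"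
  unfolding Wdot_def o_def P0_N[OF assms(1)] sympl_eq_cinner
  by (rule cadjoint_P0(2)[unfolded o_def]) (simp_all add: T_N_add T_N_scale assms)

lemma second_adjoint:
  shows "cadjoint (T \<circ> cadjoint (T \<circ> Sl) \<circ> blinfun_apply Qd \<circ> sympl_J \<circ> T \<circ> Pl) y \<in> N"
    and "n \<in> N \<Longrightarrow> \<langle>cadjoint (T \<circ> cadjoint (T \<circ> Sl) \<circ> blinfun_apply Qd \<circ> sympl_J \<circ> T \<circ> Pl) y, n\<rangle>
      = \<langle>y, T (TS_adj (Y n))\<rangle>"
proof -
  have eq: "T \<circ> cadjoint (T \<circ> Sl) \<circ> blinfun_apply Qd \<circ> sympl_J \<circ> T \<circ> Pl
      = (\<lambda>n. T (TS_adj (Y n))) \<circ> Pl"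
    by (simp add: TS_adj_def fun_eq_iff)
  have add: "T (TS_adj (Y (m + n))) = T (TS_adj (Y m)) + T (TS_adj (Y n))" if "m \<in> N" "n \<in> N" for m n
    using that by (simp add: T_N_add sympl_J_add blinfun.add_right TS_adj_add T_add TS_adj_domain)
  have scale: "T (TS_adj (Y (c *\<^sub>C n))) = c *\<^sub>C T (TS_adj (Y n))" if "n \<in> N" for c n
    using that by (simp add: T_N_scale sympl_J_scaleC Qd_scale TS_adj_scale T_scaleC TS_adj_domain)
  show "cadjoint (T \<circ> cadjoint (T \<circ> Sl) \<circ> blinfun_apply Qd \<circ> sympl_J \<circ> T \<circ> Pl) y \<in> N"
    unfolding eq by (rule cadjoint_P0(1)[OF add scale])
  show "n \<in> N \<Longrightarrow> \<langle>cadjoint (T \<circ> cadjoint (T \<circ> Sl) \<circ> blinfun_apply Qd \<circ> sympl_J \<circ> T \<circ> Pl) y, n\<rangle>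
      = \<langle>y, T (TS_adj (Y n))\<rangle>"
    unfolding eq by (rule cadjoint_P0(2)[OF add scale])
qed

lemma Wddot_in_N: "Wddot u \<in> N"
proof -
  have "cadjoint (T \<circ> Pl) y \<in> N" for y
    by (rule cadjoint_P0(1)) (simp_all add: T_N_add T_N_scale)
  from this[unfolded o_def] show ?thesis
    unfolding Wddot_def o_def by (intro N_diff N_scale second_adjoint(1)[unfolded o_def])
qed

lemma Wddot_cinner:
  assumes "u \<in> N" "n \<in> N"
  shows "\<langle>Wddot u, n\<rangle> = sympl (Qdd (T u)) (T n) - 2 * \<langle>Y u, T (TS_adj (Y n))\<rangle>"
proof -
  have 1: "\<langle>cadjoint (T \<circ> Pl) y, n\<rangle> = \<langle>y, T n\<rangle>" for y
    by (rule cadjoint_P0(2)) (simp_all add: T_N_add T_N_scale assms)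
  show ?thesis
    unfolding Wddot_def o_def P0_N[OF assms(1)] cinner_diff_left cinner_scaleC_left 1[unfolded o_def]
      second_adjoint(2)[OF assms(2), unfolded o_def] sympl_eq_cinner ..
qed

lemma sympl_hermitian:
  assumes "\<And>x y. \<langle>L x, y\<rangle> = \<langle>x, L y\<rangle>" "\<And>x. sympl_J (L x) = - L (sympl_J x)"
  shows "sympl (L f) g = cnj (sympl (L g) f)"
proof -
  have "sympl (L f) g = - \<langle>sympl_J f, L g\<rangle>"
    by (simp add: sympl_eq_cinner assms cinner_minus_left)
  also have "\<dots> = \<langle>f, sympl_J (L g)\<rangle>" by (simp add: cinner_sympl_J)
  also have "\<dots> = cnj (sympl (L g) f)" unfolding sympl_eq_cinner by (rule cinner_commute)
  finally show ?thesis .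
qed

lemma Wdot_hermitian:
  assumes "u \<in> N" "n \<in> N"
  shows "\<langle>Wdot u, n\<rangle> = \<langle>u, Wdot n\<rangle>"
  using sympl_hermitian[of "blinfun_apply Qd" "T u" "T n", OF Qd_adj Qd_J]
    Wdot_cinner[OF assms] Wdot_cinner[OF assms(2,1)] cinner_commute[of u "Wdot n"] by simp

text \<open>
  The asymmetry in \<open>T_TS_adj_symmetric\<close> is \<open>\<langle>Y u, J (Y n)\<rangle>\<close>, which vanishes by \<open>Qd_Qd_orthogonal\<close>.
\<close>

lemma T_TS_adj_hermitian:
  assumes "u \<in> N" "n \<in> N"
  shows "\<langle>T (TS_adj (Y u)), Y n\<rangle> = \<langle>Y u, T (TS_adj (Y n))\<rangle>"
proof -
  have "\<langle>Qd (T n), Y u\<rangle> = 0" by (intro Qd_Qd_orthogonal T_N assms)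
  then have "\<langle>Y u, sympl_J (Y n)\<rangle> = 0" unfolding J_Y using cinner_commute[of "Y u"] by simp
  then show ?thesis using T_TS_adj_symmetric[of "Y u" "Y n"] by simp
qed

lemma Wddot_hermitian:
  assumes "u \<in> N" "n \<in> N"
  shows "\<langle>Wddot u, n\<rangle> = \<langle>u, Wddot n\<rangle>"
proof -
  have "\<langle>u, Wddot n\<rangle> = cnj (sympl (Qdd (T n)) (T u) - 2 * \<langle>Y n, T (TS_adj (Y u))\<rangle>)"
    using cinner_commute[of u "Wddot n"] Wddot_cinner[OF assms(2,1)] by simp
  also have "\<dots> = sympl (Qdd (T u)) (T n) - 2 * \<langle>T (TS_adj (Y u)), Y n\<rangle>"
    using sympl_hermitian[of "blinfun_apply Qdd" "T u" "T n", OF Qdd_adj Qdd_J]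
      cinner_commute[of "T (TS_adj (Y u))" "Y n"] by simp
  finally show ?thesis using T_TS_adj_hermitian[OF assms] Wddot_cinner[OF assms] by simp
qed

lemma Wdot_linear:
  assumes "u \<in> N" "v \<in> N"
  shows "Wdot (u + v) = Wdot u + Wdot v" "Wdot (c *\<^sub>C u) = c *\<^sub>C Wdot u"
proof -
  show "Wdot (u + v) = Wdot u + Wdot v"
    by (rule N_eqI) (simp_all add: assms N_add Wdot_in_N Wdot_hermitian cinner_algebra)
  show "Wdot (c *\<^sub>C u) = c *\<^sub>C Wdot u"
    by (rule N_eqI) (simp_all add: assms N_scale Wdot_in_N Wdot_hermitian cinner_algebra)
qed

text \<open>
  The coefficients of an approximate eigenvector \<open>u + s w\<^sub>1 + s\<^sup>2 w\<^sub>2\<close> for the approximate eigenvalue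
  \<open>l + \<mu> s + \<nu> s\<^sup>2 / 2\<close>.  The solvability conditions for \<open>w\<^sub>1\<close> and \<open>w\<^sub>2\<close> are \<open>Wdot u = \<mu> u\<close> and the equation
  for the component \<open>n\<^sub>1\<close> of \<open>w\<^sub>1\<close> in \<open>N\<close>; the other component of \<open>w\<^sub>1\<close> is \<open>TS_adj (Y u)\<close>, which is how the
  second term of \<open>Wddot\<close> arises.
\<close>

lemma quasimode_coefficients:
  assumes u: "u \<in> N" "Wdot u = \<mu> *\<^sub>C u" and n1: "n1 \<in> N"
    and eq: "2 *\<^sub>C (Wdot n1 - \<mu> *\<^sub>C n1) = \<nu> *\<^sub>C u - Wddot u"
  shows "\<exists>w1 w2 a b. (w1, l *\<^sub>C w1 + \<mu> *\<^sub>C u) \<in> uadjoint A \<and>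
    (w2, l *\<^sub>C w2 + \<mu> *\<^sub>C w1 + (\<nu> / 2) *\<^sub>C u) \<in> uadjoint A \<and> a \<in> F\<^sub>0 \<and> b \<in> F\<^sub>0 \<and>
    T w1 = Qd (T u) + a \<and>
    T w2 = (1 / 2) *\<^sub>C Qdd (T u) + Qd a + b"
proof -
  define g where "g = TS_adj (Y u)"
  obtain e where e: "e \<in> N" "(g, l *\<^sub>C g + e) \<in> uadjoint A"
    "\<And>n. n \<in> N \<Longrightarrow> \<langle>e, n\<rangle> = sympl (sympl_J (Y u)) (T n)"
    using TS_adj(4)[of "Y u"] unfolding g_def by blast
  have "e = Wdot u"
    by (rule N_eqI[OF e(1) Wdot_in_N]) (simp add: e(3) J_Y Wdot_cinner u(1))
  then have eu: "e = \<mu> *\<^sub>C u" using u(2) by simp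
  define w1 where "w1 = g + n1"
  have "(g + n1, (l *\<^sub>C g + e) + l *\<^sub>C n1) \<in> uadjoint A"
    using n1 by (intro uop_add linear_adjoint e H0_adjoint) (simp add: N_iff)
  then have w1: "(w1, l *\<^sub>C w1 + \<mu> *\<^sub>C u) \<in> uadjoint A"
    by (simp add: w1_def eu scaleC_add_right add_ac)
  have gd: "g \<in> Domain (uadjoint A)" using e(2) by auto
  define a where "a = T w1 - Qd (T u)"
  define a0 where "a0 = T g - Qd (T u)"
  have a_eq: "a = a0 + T n1"
    by (simp add: a_def a0_def w1_def T_add[OF gd N_domain[OF n1]])
  have "a0 \<in> F\<^sub>0" using TS_adj(2)[of "Y u"] by (simp add: a0_def g_def J_Y)
  then have a: "a \<in> F\<^sub>0" unfolding a_eq by (intro lagrangian_add[OF lagrangian0] T_N n1)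
  define y where "y = (1 / 2) *\<^sub>C Qdd (T u) + Qd a"
  have "\<exists>w2 w2'. (w2, w2') \<in> uadjoint A \<and> w2' - l *\<^sub>C w2 = \<mu> *\<^sub>C w1 + (\<nu> / 2) *\<^sub>C u \<and> T w2 - y \<in> F\<^sub>0"
  proof (rule boundary_problem_solvable)
    fix n assume n: "n \<in> N"
    have "sympl (Qd a0) (T n) = - \<langle>a0, Y n\<rangle>"
    proof -
      have "sympl (Qd a0) (T n) = - \<langle>sympl_J a0, Qd (T n)\<rangle>"
        by (simp add: sympl_eq_cinner Qd_J cinner_minus_left Qd_adj)
      also have "\<dots> = \<langle>a0, sympl_J (Qd (T n))\<rangle>" by (simp add: cinner_sympl_J)
      finally show ?thesis by (simp add: Qd_J cinner_minus_right)
    qed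
    also have "\<langle>a0, Y n\<rangle> = \<langle>Y u, T (TS_adj (Y n))\<rangle>"
      using T_TS_adj_hermitian[OF u(1) n] Qd_Qd_orthogonal[OF T_N[OF u(1)] T_N[OF n]]
      by (simp add: a0_def g_def cinner_diff_left)
    finally have s0: "sympl (Qd a0) (T n) = - \<langle>Y u, T (TS_adj (Y n))\<rangle>" .
    have "sympl y (T n) = (1 / 2) * sympl (Qdd (T u)) (T n)
        + (sympl (Qd a0) (T n) + sympl (Qd (T n1)) (T n))"
      by (simp add: y_def a_eq blinfun.add_right sympl_add_left sympl_scaleC_left)
    also have "\<dots> = (1 / 2) * \<langle>Wddot u, n\<rangle> + \<langle>Wdot n1, n\<rangle>"
      unfolding s0 Wddot_cinner[OF u(1) n] Wdot_cinner[OF n1 n] by (simp add: field_simps)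
    finally have sy: "sympl y (T n) = (1 / 2) * \<langle>Wddot u, n\<rangle> + \<langle>Wdot n1, n\<rangle>" .
    have "\<langle>2 *\<^sub>C (Wdot n1 - \<mu> *\<^sub>C n1), n\<rangle> = \<langle>\<nu> *\<^sub>C u - Wddot u, n\<rangle>" by (simp only: eq)
    then have "2 * (\<langle>Wdot n1, n\<rangle> - \<mu> * \<langle>n1, n\<rangle>) = \<nu> * \<langle>u, n\<rangle> - \<langle>Wddot u, n\<rangle>"
      by (simp add: cinner_algebra)
    then have "(1 / 2) * \<langle>Wddot u, n\<rangle> + \<langle>Wdot n1, n\<rangle> = \<mu> * \<langle>n1, n\<rangle> + \<nu> / 2 * \<langle>u, n\<rangle>"
      by (simp add: field_simps)
    moreover have "\<langle>\<mu> *\<^sub>C w1 + (\<nu> / 2) *\<^sub>C u, n\<rangle> = \<mu> * \<langle>n1, n\<rangle> + \<nu> / 2 * \<langle>u, n\<rangle>"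
      using TS_adj(3)[OF n, of "Y u"] by (simp add: w1_def g_def cinner_algebra)
    ultimately show "\<langle>\<mu> *\<^sub>C w1 + (\<nu> / 2) *\<^sub>C u, n\<rangle> = sympl y (T n)" using sy by simp
  qed
  then obtain w2 w2' where w2: "(w2, w2') \<in> uadjoint A" "w2' - l *\<^sub>C w2 = \<mu> *\<^sub>C w1 + (\<nu> / 2) *\<^sub>C u"
    "T w2 - y \<in> F\<^sub>0" by blast
  have "w2' = l *\<^sub>C w2 + \<mu> *\<^sub>C w1 + (\<nu> / 2) *\<^sub>C u" using w2(2) by (simp add: algebra_simps)
  then have "(w2, l *\<^sub>C w2 + \<mu> *\<^sub>C w1 + (\<nu> / 2) *\<^sub>C u) \<in> uadjoint A" using w2(1) by simp
  moreover have "T w2 = (1 / 2) *\<^sub>C Qdd (T u) + Qd a + (T w2 - y)"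
    by (simp add: y_def)
  moreover have "T w1 = Qd (T u) + a" by (simp add: a_def)
  ultimately show ?thesis using w1 a w2(3) by blast
qed

end

section \<open>Second-order expansions\<close>

lemma norm_triangle3: "norm (a + b + c) \<le> norm a + norm b + norm c"
  for a :: "'a::real_normed_vector"
  using norm_triangle_ineq[of "a + b" c] norm_triangle_ineq[of a b] by linarith

lemma norm_triangle3_diff: "norm (a + b - c) \<le> norm a + norm b + norm c"
  for a :: "'a::real_normed_vector"
  using norm_triangle3[of a b "- c"] by simp

lemma at_within_unit_interval_neq_bot:
  assumes "t\<^sub>0 \<in> {0..1::real}"
  shows "at t\<^sub>0 within {0..1} \<noteq> bot"
  using assms islimpt_Icc[of 0 1 t\<^sub>0] by (simp add: trivial_limit_within)

lemma eventually_in_unit_interval: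
  "\<forall>\<^sub>F t in at t\<^sub>0 within {0..1::real}. t \<in> {0..1} \<and> t \<noteq> t\<^sub>0"
  by (simp add: eventually_at_filter)

lemma second_order_limits:
  fixes q :: "real \<Rightarrow> 'v::real_normed_vector"
  assumes "(\<lambda>t. norm (q t - (q t\<^sub>0 + (t - t\<^sub>0) *\<^sub>R q1 + ((t - t\<^sub>0)\<^sup>2 / 2) *\<^sub>R q2)))
    \<in> o[at t\<^sub>0 within {0..1}](\<lambda>t. (t - t\<^sub>0)\<^sup>2)"
  shows "((\<lambda>t. (2 / (t - t\<^sub>0)\<^sup>2) *\<^sub>R (q t - q t\<^sub>0 - (t - t\<^sub>0) *\<^sub>R q1)) \<longlongrightarrow> q2) (at t\<^sub>0 within {0..1})"
    and "((\<lambda>t. (1 / (t - t\<^sub>0)) *\<^sub>R (q t - q t\<^sub>0)) \<longlongrightarrow> q1) (at t\<^sub>0 within {0..1})"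
    and "(q \<longlongrightarrow> q t\<^sub>0) (at t\<^sub>0 within {0..1})"
proof -
  let ?F = "at t\<^sub>0 within {0..1}"
  define \<rho> where "\<rho> t = q t - (q t\<^sub>0 + (t - t\<^sub>0) *\<^sub>R q1 + ((t - t\<^sub>0)\<^sup>2 / 2) *\<^sub>R q2)" for t
  have r: "((\<lambda>t. norm (\<rho> t) / (t - t\<^sub>0)\<^sup>2) \<longlongrightarrow> 0) ?F"
    using smalloD_tendsto[OF assms] by (simp add: \<rho>_def)
  have s: "((\<lambda>t. t - t\<^sub>0) \<longlongrightarrow> 0) ?F" by (rule tendsto_eq_intros | simp)+
  have nz: "\<forall>\<^sub>F t in ?F. t \<noteq> t\<^sub>0" using eventually_in_unit_interval by (rule eventually_mono) simp
  have "((\<lambda>t. (2 / (t - t\<^sub>0)\<^sup>2) *\<^sub>R \<rho> t) \<longlongrightarrow> 0) ?F"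
  proof (rule tendsto_norm_zero_cancel)
    have "((\<lambda>t. 2 * (norm (\<rho> t) / (t - t\<^sub>0)\<^sup>2)) \<longlongrightarrow> 2 * 0) ?F" by (intro tendsto_intros r)
    then show "((\<lambda>t. norm ((2 / (t - t\<^sub>0)\<^sup>2) *\<^sub>R \<rho> t)) \<longlongrightarrow> 0) ?F" by simp
  qed
  from tendsto_add[OF this tendsto_const[of q2]]
  have "((\<lambda>t. (2 / (t - t\<^sub>0)\<^sup>2) *\<^sub>R \<rho> t + q2) \<longlongrightarrow> q2) ?F" by simp
  then show "((\<lambda>t. (2 / (t - t\<^sub>0)\<^sup>2) *\<^sub>R (q t - q t\<^sub>0 - (t - t\<^sub>0) *\<^sub>R q1)) \<longlongrightarrow> q2) ?F"
  proof (rule Lim_transform_eventually)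
    show "\<forall>\<^sub>F t in ?F. (2 / (t - t\<^sub>0)\<^sup>2) *\<^sub>R \<rho> t + q2 = (2 / (t - t\<^sub>0)\<^sup>2) *\<^sub>R (q t - q t\<^sub>0 - (t - t\<^sub>0) *\<^sub>R q1)"
    proof (rule eventually_mono[OF nz])
      fix t assume t: "t \<noteq> t\<^sub>0"
      have "q t - q t\<^sub>0 - (t - t\<^sub>0) *\<^sub>R q1 = \<rho> t + ((t - t\<^sub>0)\<^sup>2 / 2) *\<^sub>R q2" by (simp add: \<rho>_def)
      then show "(2 / (t - t\<^sub>0)\<^sup>2) *\<^sub>R \<rho> t + q2 = (2 / (t - t\<^sub>0)\<^sup>2) *\<^sub>R (q t - q t\<^sub>0 - (t - t\<^sub>0) *\<^sub>R q1)"
        using t by (simp add: scaleR_add_right)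
    qed
  qed
  then have "((\<lambda>t. ((t - t\<^sub>0) / 2) *\<^sub>R ((2 / (t - t\<^sub>0)\<^sup>2) *\<^sub>R (q t - q t\<^sub>0 - (t - t\<^sub>0) *\<^sub>R q1)) + q1)
      \<longlongrightarrow> (0 / 2) *\<^sub>R q2 + q1) ?F"
    by (intro tendsto_intros s) auto
  then have "((\<lambda>t. ((t - t\<^sub>0) / 2) *\<^sub>R ((2 / (t - t\<^sub>0)\<^sup>2) *\<^sub>R (q t - q t\<^sub>0 - (t - t\<^sub>0) *\<^sub>R q1)) + q1) \<longlongrightarrow> q1) ?F"
    by simp
  then show d1: "((\<lambda>t. (1 / (t - t\<^sub>0)) *\<^sub>R (q t - q t\<^sub>0)) \<longlongrightarrow> q1) ?F"
  proof (rule Lim_transform_eventually)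
    show "\<forall>\<^sub>F t in ?F. ((t - t\<^sub>0) / 2) *\<^sub>R ((2 / (t - t\<^sub>0)\<^sup>2) *\<^sub>R (q t - q t\<^sub>0 - (t - t\<^sub>0) *\<^sub>R q1)) + q1
        = (1 / (t - t\<^sub>0)) *\<^sub>R (q t - q t\<^sub>0)"
    proof (rule eventually_mono[OF nz])
      fix t assume "t \<noteq> t\<^sub>0"
      moreover have "c / 2 * (2 / c\<^sup>2) = 1 / c" for c :: real
        by (simp add: power2_eq_square)
      ultimately show "((t - t\<^sub>0) / 2) *\<^sub>R ((2 / (t - t\<^sub>0)\<^sup>2) *\<^sub>R (q t - q t\<^sub>0 - (t - t\<^sub>0) *\<^sub>R q1)) + q1
        = (1 / (t - t\<^sub>0)) *\<^sub>R (q t - q t\<^sub>0)"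
        unfolding scaleR_scaleR by (simp only: scaleR_diff_right[of _ _ "(t - t\<^sub>0) *\<^sub>R q1"]) simp
    qed
  qed
  have "((\<lambda>t. (t - t\<^sub>0) *\<^sub>R ((1 / (t - t\<^sub>0)) *\<^sub>R (q t - q t\<^sub>0)) + q t\<^sub>0) \<longlongrightarrow> 0 *\<^sub>R q1 + q t\<^sub>0) ?F"
    by (intro tendsto_intros s d1)
  then have "((\<lambda>t. (t - t\<^sub>0) *\<^sub>R ((1 / (t - t\<^sub>0)) *\<^sub>R (q t - q t\<^sub>0)) + q t\<^sub>0) \<longlongrightarrow> q t\<^sub>0) ?F" by simp
  then show "(q \<longlongrightarrow> q t\<^sub>0) ?F"
    by (rule Lim_transform_eventually) (rule eventually_mono[OF nz], simp)
qed

text \<open>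
  Both coefficients are limits of difference quotients of \<open>q\<close>, and the quotients of the constant
  function \<open>L (q t)\<close> vanish.
\<close>

lemma constraint_derivatives:
  fixes q :: "real \<Rightarrow> 'v::real_normed_vector"
  assumes t0: "t\<^sub>0 \<in> {0..1}"
    and q: "(\<lambda>t. norm (q t - (q t\<^sub>0 + (t - t\<^sub>0) *\<^sub>R q1 + ((t - t\<^sub>0)\<^sup>2 / 2) *\<^sub>R q2)))
      \<in> o[at t\<^sub>0 within {0..1}](\<lambda>t. (t - t\<^sub>0)\<^sup>2)"
    and L: "bounded_linear L" and c: "\<And>t. t \<in> {0..1} \<Longrightarrow> L (q t) = c"
  shows "L q1 = 0" "L q2 = 0"
proof -
  let ?F = "at t\<^sub>0 within {0..1}"
  interpret bounded_linear L by (rule L)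
  note nb = at_within_unit_interval_neq_bot[OF t0]
  have l1: "((\<lambda>t. L ((1 / (t - t\<^sub>0)) *\<^sub>R (q t - q t\<^sub>0))) \<longlongrightarrow> L q1) ?F"
    by (rule tendsto[OF second_order_limits(2)[OF q]])
  have "\<forall>\<^sub>F t in ?F. L ((1 / (t - t\<^sub>0)) *\<^sub>R (q t - q t\<^sub>0)) = 0"
    by (rule eventually_mono[OF eventually_in_unit_interval]) (simp add: scaleR diff c c[OF t0])
  from tendsto_unique[OF nb l1 tendsto_eventually[OF this]] show q1: "L q1 = 0" .
  have l2: "((\<lambda>t. L ((2 / (t - t\<^sub>0)\<^sup>2) *\<^sub>R (q t - q t\<^sub>0 - (t - t\<^sub>0) *\<^sub>R q1))) \<longlongrightarrow> L q2) ?F"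
    by (rule tendsto[OF second_order_limits(1)[OF q]])
  have "\<forall>\<^sub>F t in ?F. L ((2 / (t - t\<^sub>0)\<^sup>2) *\<^sub>R (q t - q t\<^sub>0 - (t - t\<^sub>0) *\<^sub>R q1)) = 0"
    by (rule eventually_mono[OF eventually_in_unit_interval]) (simp add: scaleR diff c c[OF t0] q1)
  from tendsto_unique[OF nb l2 tendsto_eventually[OF this]] show "L q2 = 0" .
qed

lemma bounded_linear_cinner_blinfun_right:
  fixes x :: "'b::complex_inner" and y :: "'a::real_normed_vector"
  shows "bounded_linear (\<lambda>F :: 'a \<Rightarrow>\<^sub>L 'b. \<langle>x, F y\<rangle>)"
  using bounded_linear_compose[OF bounded_bilinear.bounded_linear_right[OF bounded_bilinear_cinner]
      bounded_bilinear.bounded_linear_left[OF bounded_bilinear_blinfun_apply]] .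

text \<open>
  The first four identities come from the linear constraints \<open>Q\<^sup>* = Q\<close> and \<open>J Q + Q J = J\<close>, the last one from the
  product rule for \<open>Q\<^sup>2 = Q\<close>.
\<close>

lemma lagrangian_projection_derivatives:
  fixes Q :: "real \<Rightarrow> ('b::complex_inner \<times> 'b) \<Rightarrow>\<^sub>L ('b \<times> 'b)"
  assumes t0: "t\<^sub>0 \<in> {0..1}"
    and Q: "\<And>t. t \<in> {0..1} \<Longrightarrow> is_orthogonal_projection (Q t)"
      "\<And>t. t \<in> {0..1} \<Longrightarrow> lagrangian (range (blinfun_apply (Q t)))"
    and expansion: "(\<lambda>t. norm (Q t - (Q t\<^sub>0 + (t - t\<^sub>0) *\<^sub>R Qd + ((t - t\<^sub>0)\<^sup>2 / 2) *\<^sub>R Qdd)))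
      \<in> o[at t\<^sub>0 within {0..1}](\<lambda>t. (t - t\<^sub>0)\<^sup>2)"
  shows "\<langle>Qd x, y\<rangle> = \<langle>x, Qd y\<rangle>"
    and "\<langle>Qdd x, y\<rangle> = \<langle>x, Qdd y\<rangle>"
    and "sympl_J (Qd x) = - Qd (sympl_J x)"
    and "sympl_J (Qdd x) = - Qdd (sympl_J x)"
    and "Q t\<^sub>0 (Qd x) + Qd (Q t\<^sub>0 x)
      = Qd x"
proof -
  let ?F = "at t\<^sub>0 within {0..1}"
  have "bounded_linear (\<lambda>B :: ('b \<times> 'b) \<Rightarrow>\<^sub>L ('b \<times> 'b). \<langle>B x, y\<rangle> - \<langle>x, B y\<rangle>)"
    by (intro bounded_linear_sub bounded_linear_cinner_blinfun bounded_linear_cinner_blinfun_right)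
  from constraint_derivatives[OF t0 expansion this, of 0]
  show "\<langle>Qd x, y\<rangle> = \<langle>x, Qd y\<rangle>" "\<langle>Qdd x, y\<rangle> = \<langle>x, Qdd y\<rangle>"
    using orthogonal_projection_self_adjoint[OF Q(1)] by auto
  have "bounded_linear (\<lambda>B :: ('b \<times> 'b) \<Rightarrow>\<^sub>L ('b \<times> 'b). sympl_J (B x) + B (sympl_J x))"
    by (intro bounded_linear_add bounded_linear_compose[OF bounded_linear_sympl_J]
        bounded_bilinear.bounded_linear_left[OF bounded_bilinear_blinfun_apply])
  from constraint_derivatives[OF t0 expansion this, of "sympl_J x"]
  show "sympl_J (Qd x) = - Qd (sympl_J x)"
    "sympl_J (Qdd x) = - Qdd (sympl_J x)"
    using lagrangian_projection_J[OF Q] by (auto simp: eq_neg_iff_add_eq_0)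
  define q where "q t = (1 / (t - t\<^sub>0)) *\<^sub>R (Q t - Q t\<^sub>0)" for t
  have q: "(q \<longlongrightarrow> Qd) ?F" unfolding q_def by (rule second_order_limits(2)[OF expansion])
  note ap = bounded_bilinear.tendsto[OF bounded_bilinear_blinfun_apply]
  have l1: "((\<lambda>t. Q t (q t x) + q t (Q t\<^sub>0 x))
      \<longlongrightarrow> Q t\<^sub>0 (Qd x) + Qd (Q t\<^sub>0 x)) ?F"
    by (intro tendsto_add ap q second_order_limits(3)[OF expansion] tendsto_const)
  have l2: "((\<lambda>t. q t x) \<longlongrightarrow> Qd x) ?F"
    by (intro ap q tendsto_const)
  have "\<forall>\<^sub>F t in ?F. Q t (q t x) + q t (Q t\<^sub>0 x)
      = q t x"
    by (rule eventually_mono[OF eventually_in_unit_interval])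
      (simp add: q_def blinfun.scaleR_left blinfun.scaleR_right blinfun.diff_left blinfun.diff_right
        orthogonal_projection_idem[OF Q(1)] orthogonal_projection_idem[OF Q(1)[OF t0]] flip: scaleR_add_right)
  from tendsto_unique[OF at_within_unit_interval_neq_bot[OF t0] Lim_transform_eventually[OF l1 this] l2]
  show "Q t\<^sub>0 (Qd x) + Qd (Q t\<^sub>0 x)
      = Qd x" .
qed

section \<open>Eigenvalues near an approximate eigenvalue\<close>

context spectral_circle
begin

lemma riesz_orthogonal_projection: "is_orthogonal_projection P"
  unfolding is_orthogonal_projection_def
  by (auto intro!: blinfun_eqI simp: clinear_riesz riesz_idempotent riesz_self_adjoint)

lemma norm_riesz_le: "norm (P x) \<le> norm x"
proof (cases "P x = 0")
  case False
  have "complex_of_real ((norm (P x))\<^sup>2) = \<langle>P x, x\<rangle>"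
    unfolding cinner_self[symmetric] by (simp add: riesz_self_adjoint riesz_idempotent)
  then have "(norm (P x))\<^sup>2 = cmod \<langle>P x, x\<rangle>"
    by (metis norm_of_real abs_of_nonneg zero_le_power2)
  also have "\<dots> \<le> norm (P x) * norm x" by (rule norm_cinner_le)
  finally show ?thesis using False by (simp add: power2_eq_square)
qed simp

lemma subspace_range_riesz: "complex_vector.subspace (range (blinfun_apply P))"
  unfolding complex_vector.subspace_def
proof (intro conjI ballI allI)
  show "0 \<in> range (blinfun_apply P)" by (metis blinfun.zero_right rangeI)
qed (auto simp flip: blinfun.add_right riesz_scaleC)

definition "restricted x = uapply A (P x)"

lemma restricted_graph: "(P x, restricted x) \<in> A"
  unfolding restricted_def using riesz_in_domain[of x] by (auto intro: uapply_mem[OF linear])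

lemma restricted_eq:
  assumes "(u, v) \<in> A"
  shows "restricted u = P v"
  unfolding restricted_def by (rule uapply_eq[OF linear riesz_commutes[OF assms]])

lemma restricted_in_range: "restricted x \<in> range (blinfun_apply P)"
proof -
  have "restricted (P x) = P (restricted x)"
    by (rule restricted_eq[OF restricted_graph])
  moreover have "restricted (P x) = restricted x"
    by (simp add: restricted_def riesz_idempotent)
  ultimately show ?thesis by (metis rangeI)
qed

lemma restricted_range_graph:
  assumes "x \<in> range (blinfun_apply P)"
  shows "(x, restricted x) \<in> A"
  using restricted_graph[of x] assms riesz_idempotent by auto

text \<open>
  In the range of \<open>P\<close> the operator is diagonal in an orthonormal basis, so a vector \<open>x\<close> with small
  \<open>(A - z) x\<close> forces an eigenvalue near \<open>z\<close>.
\<close>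

lemma eigenvalue_near:
  assumes G: "finite G" "range (blinfun_apply P) \<subseteq> complex_vector.span G"
    and v: "(v, v') \<in> A" and nz: "P v \<noteq> 0"
  shows "\<exists>z'\<in>Spec_in (range (blinfun_apply P)) restricted.
    cmod (z' - z) * norm (P v) \<le> norm (v' - z *\<^sub>C v)"
proof -
  let ?V = "range (blinfun_apply P)"
  have gr: "(x, restricted x) \<in> A" if "x \<in> ?V" for x by (rule restricted_range_graph[OF that])
  have add: "restricted (x + y) = restricted x + restricted y" if "x \<in> ?V" "y \<in> ?V" for x y
    using uop_functional[OF linear gr uop_add[OF linear gr[OF that(1)] gr[OF that(2)]]]
      complex_vector.subspace_add[OF subspace_range_riesz that] by blast
  have scale: "restricted (c *\<^sub>C x) = c *\<^sub>C restricted x" if "x \<in> ?V" for c x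
    using uop_functional[OF linear gr uop_scale[OF linear gr[OF that]]]
      complex_vector.subspace_scale[OF subspace_range_riesz that] by blast
  obtain E q where E: "finite E" "orthonormal E" "complex_vector.span E = ?V"
    and q: "\<And>e. e \<in> E \<Longrightarrow> restricted e = complex_of_real (q e) *\<^sub>C e"
  proof (rule spectral_theorem[OF subspace_range_riesz G, where L = restricted])
    show "\<langle>restricted x, y\<rangle> = \<langle>x, restricted y\<rangle>" if "x \<in> ?V" "y \<in> ?V" for x y
      by (rule self_adjoint_symmetric[OF self_adjoint gr[OF that(1)] gr[OF that(2)]])
  qed (use restricted_in_range add scale in \<open>auto simp: image_iff\<close>)
  have EV: "e \<in> ?V" if "e \<in> E" for e using E(3) that complex_vector.span_base by blast
  define x where "x = P v"
  have xV: "x \<in> ?V" by (simp add: x_def)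
  have x_sum: "x = (\<Sum>e\<in>E. \<langle>x, e\<rangle> *\<^sub>C e)"
    using ortho_sum_eq[OF E(1,2), of x] xV by (simp add: E(3) ortho_sum_def)
  define y where "y = P (v' - z *\<^sub>C v)"
  have "(x, P v') \<in> A" unfolding x_def by (rule riesz_commutes[OF v])
  then have "restricted x = P v'" using uop_functional[OF linear gr[OF xV]] by blast
  then have y: "y = restricted x - z *\<^sub>C x"
    by (simp add: y_def x_def blinfun.diff_right riesz_scaleC)
  have ye: "\<langle>y, e\<rangle> = (complex_of_real (q e) - z) * \<langle>x, e\<rangle>" if "e \<in> E" for e
  proof -
    have "\<langle>restricted x, e\<rangle> = \<langle>x, restricted e\<rangle>"
      by (rule self_adjoint_symmetric[OF self_adjoint gr[OF xV] gr[OF EV[OF that]]])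
    then show ?thesis by (simp add: y q[OF that] cinner_algebra left_diff_distrib)
  qed
  have "y \<in> ?V" by (simp add: y_def)
  then have y_sum: "y = (\<Sum>e\<in>E. ((complex_of_real (q e) - z) * \<langle>x, e\<rangle>) *\<^sub>C e)"
    using ortho_sum_eq[OF E(1,2), of y] ye by (simp add: E(3) ortho_sum_def)
  have "E \<noteq> {}" using x_sum nz by (auto simp: x_def)
  \<comment> \<open>the distance from \<open>z\<close> to the eigenvalues\<close>
  define m where "m = Min ((\<lambda>e. cmod (complex_of_real (q e) - z)) ` E)"
  have m_le: "m \<le> cmod (complex_of_real (q e) - z)" if "e \<in> E" for e
    unfolding m_def using E(1) that by simp
  have "m \<in> (\<lambda>e. cmod (complex_of_real (q e) - z)) ` E"
    unfolding m_def using E(1) \<open>E \<noteq> {}\<close> by (intro Min_in) auto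
  then obtain e where e: "e \<in> E" "m = cmod (complex_of_real (q e) - z)" by auto
  have m0: "m \<ge> 0" by (simp add: e(2))
  have "(m * norm x)\<^sup>2 = (\<Sum>e\<in>E. m\<^sup>2 * (cmod \<langle>x, e\<rangle>)\<^sup>2)"
    using norm_ortho_expansion[OF E(1,2), of "\<lambda>e. \<langle>x, e\<rangle>"] x_sum
    by (simp add: power_mult_distrib sum_distrib_left)
  also have "\<dots> \<le> (\<Sum>e\<in>E. (cmod ((complex_of_real (q e) - z) * \<langle>x, e\<rangle>))\<^sup>2)"
    unfolding norm_mult power_mult_distrib
    by (intro sum_mono mult_right_mono power_mono m_le m0) auto
  also have "\<dots> = (norm y)\<^sup>2"
    unfolding y_sum by (rule norm_ortho_expansion[OF E(1,2), symmetric])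
  finally have "m * norm x \<le> norm y" by (rule power2_le_imp_le) simp
  also have "\<dots> \<le> norm (v' - z *\<^sub>C v)" unfolding y_def by (rule norm_riesz_le)
  finally have "cmod (complex_of_real (q e) - z) * norm (P v) \<le> norm (v' - z *\<^sub>C v)"
    by (simp add: e(2) x_def)
  moreover have "complex_of_real (q e) \<in> Spec_in ?V restricted"
  proof -
    have "\<langle>e, e\<rangle> = 1" using E(2) e(1) by (simp add: orthonormal_def)
    then have "e \<noteq> 0" by auto
    moreover have "0 \<in> ?V" using complex_vector.subspace_0[OF subspace_range_riesz] .
    moreover have "restricted 0 = 0" using scale[OF \<open>0 \<in> ?V\<close>, of 0] by simp
    ultimately have "\<not> inj_on (\<lambda>x. restricted x - complex_of_real (q e) *\<^sub>C x) ?V"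
      using q[OF e(1)] EV[OF e(1)] inj_onD[of "\<lambda>x. restricted x - complex_of_real (q e) *\<^sub>C x" ?V e 0]
      by (simp only: complex_vector.scale_zero_right diff_self) blast
    then show ?thesis by (simp add: Spec_in_def bij_betw_def)
  qed
  ultimately show ?thesis by blast
qed

end

section \<open>Eigenvalue branches\<close>

locale extension_family = second_order A T K "H t\<^sub>0" "Q t\<^sub>0" l Qd Qdd
  for A :: "'a::chilbert_space uop" and T :: "'a \<Rightarrow> 'b::chilbert_space \<times> 'b" and K
    and H :: "real \<Rightarrow> 'a uop" and Q :: "real \<Rightarrow> ('b \<times> 'b) \<Rightarrow>\<^sub>L ('b \<times> 'b)" and t\<^sub>0 :: real
    and l Qd Qdd +
  assumes t0: "t\<^sub>0 \<in> {0..1}"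
    and ext: "\<And>t. t \<in> {0..1} \<Longrightarrow> extension (H t) (range (blinfun_apply (Q t)))"
    and expansion: "(\<lambda>t. norm (Q t - (Q t\<^sub>0 + (t - t\<^sub>0) *\<^sub>R Qd + ((t - t\<^sub>0)\<^sup>2 / 2) *\<^sub>R Qdd)))
      \<in> o[at t\<^sub>0 within {0..1}](\<lambda>t. (t - t\<^sub>0)\<^sup>2)"
begin

definition "remainder t = norm (Q t - (Q t\<^sub>0 + (t - t\<^sub>0) *\<^sub>R Qd + ((t - t\<^sub>0)\<^sup>2 / 2) *\<^sub>R Qdd))"

abbreviation "Pt t \<equiv> riesz_projection (circlepath l rad) (H t)"

lemma remainder_nonneg: "remainder t \<ge> 0" and remainder_t0: "remainder t\<^sub>0 = 0"
  by (simp_all add: remainder_def)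

lemma error_smallo:
  "(\<lambda>t. c * (\<bar>t - t\<^sub>0\<bar> ^ 3 + remainder t)) \<in> o[at t\<^sub>0 within {0..1}](\<lambda>t. (t - t\<^sub>0)\<^sup>2)"
proof -
  have "((\<lambda>t. t - t\<^sub>0) \<longlongrightarrow> 0) (at t\<^sub>0 within {0..1})" by (rule tendsto_eq_intros | simp)+
  then have lim: "((\<lambda>t. \<bar>t - t\<^sub>0\<bar>) \<longlongrightarrow> 0) (at t\<^sub>0 within {0..1})" by (rule tendsto_rabs_zero)
  have "(\<lambda>t. \<bar>t - t\<^sub>0\<bar> ^ 3) \<in> o[at t\<^sub>0 within {0..1}](\<lambda>t. (t - t\<^sub>0)\<^sup>2)"
  proof (rule smalloI_tendsto)
    show "((\<lambda>t. \<bar>t - t\<^sub>0\<bar> ^ 3 / (t - t\<^sub>0)\<^sup>2) \<longlongrightarrow> 0) (at t\<^sub>0 within {0..1})"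
    proof (rule Lim_transform_eventually[OF lim])
      show "\<forall>\<^sub>F t in at t\<^sub>0 within {0..1}. \<bar>t - t\<^sub>0\<bar> = \<bar>t - t\<^sub>0\<bar> ^ 3 / (t - t\<^sub>0)\<^sup>2"
      proof (rule eventually_mono[OF eventually_in_unit_interval])
        fix t assume "t \<in> {0..1} \<and> t \<noteq> t\<^sub>0"
        then have "(t - t\<^sub>0)\<^sup>2 \<noteq> 0" by simp
        moreover have "\<bar>t - t\<^sub>0\<bar> ^ 3 = \<bar>t - t\<^sub>0\<bar> * (t - t\<^sub>0)\<^sup>2"
          by (simp add: power3_eq_cube power2_eq_square)
        ultimately show "\<bar>t - t\<^sub>0\<bar> = \<bar>t - t\<^sub>0\<bar> ^ 3 / (t - t\<^sub>0)\<^sup>2" by simp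
      qed
    qed
    show "\<forall>\<^sub>F t in at t\<^sub>0 within {0..1}. (t - t\<^sub>0)\<^sup>2 \<noteq> 0"
      by (rule eventually_mono[OF eventually_in_unit_interval]) simp
  qed
  then have "(\<lambda>t. \<bar>t - t\<^sub>0\<bar> ^ 3 + remainder t) \<in> o[at t\<^sub>0 within {0..1}](\<lambda>t. (t - t\<^sub>0)\<^sup>2)"
    using expansion unfolding remainder_def by (rule sum_in_smallo(1))
  then show ?thesis by (cases "c = 0") simp_all
qed

lemma remainder_lim: "(remainder \<longlongrightarrow> 0) (at t\<^sub>0 within {0..1})"
proof -
  have "((\<lambda>t. remainder t / (t - t\<^sub>0)\<^sup>2 * (t - t\<^sub>0)\<^sup>2) \<longlongrightarrow> 0 * (t\<^sub>0 - t\<^sub>0)\<^sup>2) (at t\<^sub>0 within {0..1})"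
    using smalloD_tendsto[OF expansion] unfolding remainder_def by (intro tendsto_intros) auto
  then have "((\<lambda>t. remainder t / (t - t\<^sub>0)\<^sup>2 * (t - t\<^sub>0)\<^sup>2) \<longlongrightarrow> 0) (at t\<^sub>0 within {0..1})" by simp
  then show ?thesis
    by (rule Lim_transform_eventually) (rule eventually_mono[OF eventually_in_unit_interval], simp)
qed

text \<open>
  The truncated expansion \<open>w = u + s w\<^sub>1 + s\<^sup>2 w\<^sub>2\<close> solves \<open>(A\<^sup>* - z) w = O(s\<^sup>3)\<close>, and its boundary values differ
  from those of a domain element of \<open>H t\<close> by \<open>O(s\<^sup>3)\<close> and the remainder of \<open>Q\<close>; correcting the
  boundary values costs no more.
\<close>

lemma quasimode:
  assumes u: "u \<in> N" "Wdot u = \<mu> *\<^sub>C u" and n1: "n1 \<in> N"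
    and eq: "2 *\<^sub>C (Wdot n1 - \<mu> *\<^sub>C n1) = \<nu> *\<^sub>C u - Wddot u"
  shows "\<exists>c\<ge>0. \<forall>t\<in>{0..1}. \<exists>v v'. (v, v') \<in> H t \<and>
    norm (v' - (l + \<mu> * of_real (t - t\<^sub>0) + 1/2 * \<nu> * of_real ((t - t\<^sub>0)\<^sup>2)) *\<^sub>C v)
      \<le> c * (\<bar>t - t\<^sub>0\<bar> ^ 3 + remainder t) \<and> norm (v - u) \<le> c * (\<bar>t - t\<^sub>0\<bar> + remainder t)"
proof -
  obtain w1 w2 a b where w1: "(w1, l *\<^sub>C w1 + \<mu> *\<^sub>C u) \<in> uadjoint A"
    and w2: "(w2, l *\<^sub>C w2 + \<mu> *\<^sub>C w1 + (\<nu> / 2) *\<^sub>C u) \<in> uadjoint A"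
    and ab: "a \<in> F\<^sub>0" "b \<in> F\<^sub>0" and Tw1: "T w1 = Qd (T u) + a"
    and Tw2: "T w2 = (1 / 2) *\<^sub>C Qdd (T u) + Qd a + b"
    using quasimode_coefficients[OF assms] by blast
  have uA: "(u, l *\<^sub>C u) \<in> uadjoint A" using u(1) H0_adjoint N_iff by blast
  define e3 where "e3 = \<mu> *\<^sub>C w2 + (\<nu> / 2) *\<^sub>C w1"
  define e4 where "e4 = (\<nu> / 2) *\<^sub>C w2"
  define y3 where "y3 = Qd b + (1 / 2) *\<^sub>C Qdd a"
  define y4 where "y4 = (1 / 2) *\<^sub>C Qdd b"
  define c1 where "c1 = norm e3 + norm e4"
  define c2 where "c2 = norm y3 + norm y4 + (norm (T u) + norm a + norm b)"
  define Z where "Z = 1 + (cmod l + cmod \<mu> + cmod \<nu>)"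
  define c where "c = c1 + 3 * K * c2 * Z + (norm w1 + norm w2)"
  have Z1: "Z \<ge> 1" by (simp add: Z_def)
  have c12: "c1 \<ge> 0" "c2 \<ge> 0" by (simp_all add: c1_def c2_def)
  have KcZ: "3 * K * c2 * Z \<ge> 0" using K_nonneg c12 Z1 by simp
  have c0: "c \<ge> 0" using c12 KcZ by (simp add: c_def)
  have "\<exists>v v'. (v, v') \<in> H t \<and>
    norm (v' - (l + \<mu> * of_real (t - t\<^sub>0) + 1/2 * \<nu> * of_real ((t - t\<^sub>0)\<^sup>2)) *\<^sub>C v)
      \<le> c * (\<bar>t - t\<^sub>0\<bar> ^ 3 + remainder t) \<and> norm (v - u) \<le> c * (\<bar>t - t\<^sub>0\<bar> + remainder t)"
    if t: "t \<in> {0..1}" for t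
  proof -
    define s where "s = t - t\<^sub>0"
    define \<sigma> where "\<sigma> = complex_of_real s"
    have s1: "\<bar>s\<bar> \<le> 1" using t t0 by (auto simp: s_def)
    have \<sigma>: "cmod \<sigma> = \<bar>s\<bar>" by (simp add: \<sigma>_def)
    have s3: "\<bar>s\<bar> ^ 3 \<le> \<bar>s\<bar>" "\<bar>s\<bar> ^ 4 \<le> \<bar>s\<bar> ^ 3" "\<bar>s\<bar>\<^sup>2 \<le> \<bar>s\<bar>"
      using s1 power_decreasing[of 1 3 "\<bar>s\<bar>"] power_decreasing[of 3 4 "\<bar>s\<bar>"]
        power_decreasing[of 1 2 "\<bar>s\<bar>"] by simp_all
    define z where "z = l + \<mu> * \<sigma> + 1/2 * \<nu> * \<sigma>\<^sup>2"
    define w where "w = u + \<sigma> *\<^sub>C w1 + \<sigma>\<^sup>2 *\<^sub>C w2"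
    define w' where "w' = l *\<^sub>C u + \<sigma> *\<^sub>C (l *\<^sub>C w1 + \<mu> *\<^sub>C u)
      + \<sigma>\<^sup>2 *\<^sub>C (l *\<^sub>C w2 + \<mu> *\<^sub>C w1 + (\<nu> / 2) *\<^sub>C u)"
    have wA: "(w, w') \<in> uadjoint A"
      unfolding w_def w'_def by (intro uop_add uop_scale linear_adjoint uA w1 w2)
    have "w' - z *\<^sub>C w = - (\<sigma> ^ 3 *\<^sub>C e3 + \<sigma> ^ 4 *\<^sub>C e4)"
      by (simp add: w_def w'_def z_def e3_def e4_def scaleC_add_left scaleC_add_right scaleC_scaleC
          distrib_left power2_eq_square power3_eq_cube power4_eq_xxxx mult_ac)
    then have "norm (w' - z *\<^sub>C w) = norm (\<sigma> ^ 3 *\<^sub>C e3 + \<sigma> ^ 4 *\<^sub>C e4)"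
      by (simp only: norm_minus_cancel)
    also have "\<dots> \<le> \<bar>s\<bar> ^ 3 * norm e3 + \<bar>s\<bar> ^ 4 * norm e4"
      by (rule order_trans[OF norm_triangle_ineq]) (simp add: norm_scaleC norm_power \<sigma>)
    also have "\<dots> \<le> \<bar>s\<bar> ^ 3 * norm e3 + \<bar>s\<bar> ^ 3 * norm e4"
      by (intro add_left_mono mult_right_mono s3) simp
    finally have err: "norm (w' - z *\<^sub>C w) \<le> c1 * \<bar>s\<bar> ^ 3" by (simp add: c1_def algebra_simps)
    define f where "f = T u + \<sigma> *\<^sub>C a + \<sigma>\<^sup>2 *\<^sub>C b"
    define B where "B = Q t - (Q t\<^sub>0 + (t - t\<^sub>0) *\<^sub>R Qd + ((t - t\<^sub>0)\<^sup>2 / 2) *\<^sub>R Qdd)"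
    have fF: "f \<in> F\<^sub>0"
      unfolding f_def
      by (intro lagrangian_add[OF lagrangian0] complex_vector.subspace_scale[OF lagrangian_subspace[OF lagrangian0]]
          T_N u(1) ab)
    have Q0f: "Q t\<^sub>0 f = f" using fF orthogonal_projection_range[OF proj0] by blast
    have Qt: "Q t = Q t\<^sub>0 + s *\<^sub>R Qd + (s\<^sup>2 / 2) *\<^sub>R Qdd + B" by (simp add: B_def s_def)
    have Qtf: "Q t f = f + \<sigma> *\<^sub>C Qd f + (\<sigma>\<^sup>2 / 2) *\<^sub>C Qdd f
        + B f"
      unfolding Qt blinfun.add_left Q0f blinfun.scaleR_left by (simp add: \<sigma>_def scaleR_scaleC)
    define y where "y = T w - Q t f"
    have w1d: "w1 \<in> Domain (uadjoint A)" and w2d: "w2 \<in> Domain (uadjoint A)" and ud: "u \<in> Domain (uadjoint A)"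
      using w1 w2 uA by auto
    have scd: "c *\<^sub>C x \<in> Domain (uadjoint A)" if "x \<in> Domain (uadjoint A)" for c x
      using that uop_scale[OF linear_adjoint] by blast
    have addd: "x + x' \<in> Domain (uadjoint A)" if "x \<in> Domain (uadjoint A)" "x' \<in> Domain (uadjoint A)" for x x'
      using that uop_add[OF linear_adjoint] by blast
    have Tw: "T w = T u + \<sigma> *\<^sub>C T w1 + \<sigma>\<^sup>2 *\<^sub>C T w2"
      unfolding w_def by (simp add: T_add T_scaleC w1d w2d ud scd addd)
    have "y = - (\<sigma> ^ 3 *\<^sub>C y3 + \<sigma> ^ 4 *\<^sub>C y4 + B f)"
      unfolding y_def Qtf Tw Tw1 Tw2
      by (simp add: f_def y3_def y4_def blinfun.add_right Qd_scale Qdd_scale scaleC_add_right scaleC_scaleC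
          power2_eq_square power3_eq_cube power4_eq_xxxx mult_ac)
    then have "norm y \<le> norm (\<sigma> ^ 3 *\<^sub>C y3) + norm (\<sigma> ^ 4 *\<^sub>C y4) + norm (B f)"
      by (simp only: norm_minus_cancel norm_triangle3)
    also have "\<dots> \<le> \<bar>s\<bar> ^ 3 * norm y3 + \<bar>s\<bar> ^ 3 * norm y4 + remainder t * (norm (T u) + norm a + norm b)"
    proof (intro add_mono)
      show "norm (\<sigma> ^ 3 *\<^sub>C y3) \<le> \<bar>s\<bar> ^ 3 * norm y3" by (simp add: norm_scaleC norm_power \<sigma>)
      show "norm (\<sigma> ^ 4 *\<^sub>C y4) \<le> \<bar>s\<bar> ^ 3 * norm y4"
        unfolding norm_scaleC norm_power \<sigma> by (intro mult_right_mono s3) simp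
      have "norm f \<le> norm (T u) + norm (\<sigma> *\<^sub>C a) + norm (\<sigma>\<^sup>2 *\<^sub>C b)"
        unfolding f_def by (rule norm_triangle3)
      also have "\<dots> \<le> norm (T u) + 1 * norm a + 1 * norm b"
        unfolding norm_scaleC norm_power \<sigma>
        by (intro add_mono mult_right_mono order_refl) (use s1 s3 in auto)
      finally have "norm f \<le> norm (T u) + norm a + norm b" by simp
      then have "norm B * norm f \<le> remainder t * (norm (T u) + norm a + norm b)"
        unfolding remainder_def B_def by (intro mult_left_mono) auto
      then show "norm (B f) \<le> remainder t * (norm (T u) + norm a + norm b)"
        using norm_blinfun[of B f] by linarith
    qed
    also have "\<dots> \<le> c2 * (\<bar>s\<bar> ^ 3 + remainder t)"
      unfolding c2_def using remainder_nonneg[of t] by (simp add: distrib_right distrib_left mult.commute)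
    finally have yn: "norm y \<le> c2 * (\<bar>s\<bar> ^ 3 + remainder t)" .
    have "T w - y \<in> range (blinfun_apply (Q t))" by (simp add: y_def)
    from correct_to_extension[OF ext[OF t] wA this] obtain v v' where v: "(v, v') \<in> H t"
      "norm (v - w) \<le> 3 * K * norm y" "norm (v' - w') \<le> 3 * K * norm y" by blast
    define \<epsilon> where "\<epsilon> = 3 * K * c2 * (\<bar>s\<bar> ^ 3 + remainder t)"
    have "3 * K * norm y \<le> \<epsilon>"
      unfolding \<epsilon>_def using mult_left_mono[OF yn, of "3 * K"] K_nonneg by (simp add: mult.assoc)
    then have vw: "norm (v - w) \<le> \<epsilon>" "norm (v' - w') \<le> \<epsilon>" using v by auto
    have \<epsilon>0: "\<epsilon> \<ge> 0" using vw(1) norm_ge_zero order_trans by blast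
    have zn: "cmod z \<le> Z - 1"
    proof -
      have "cmod z \<le> cmod l + cmod (\<mu> * \<sigma>) + cmod (1/2 * \<nu> * \<sigma>\<^sup>2)"
        unfolding z_def by (rule norm_triangle3)
      also have "\<dots> \<le> cmod l + cmod \<mu> * 1 + cmod \<nu> * 1"
      proof (intro add_mono order_refl)
        show "cmod (\<mu> * \<sigma>) \<le> cmod \<mu> * 1" unfolding norm_mult \<sigma> by (intro mult_left_mono s1) simp
        have "cmod (1/2 * \<nu> * \<sigma>\<^sup>2) = cmod \<nu> * (\<bar>s\<bar>\<^sup>2 / 2)" by (simp add: norm_mult norm_power \<sigma>)
        also have "\<dots> \<le> cmod \<nu> * 1" using s1 s3(3) by (intro mult_left_mono) (linarith, simp)
        finally show "cmod (1/2 * \<nu> * \<sigma>\<^sup>2) \<le> cmod \<nu> * 1" .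
      qed
      finally show ?thesis by (simp add: Z_def)
    qed
    have "v' - z *\<^sub>C v = (w' - z *\<^sub>C w) + (v' - w') - z *\<^sub>C (v - w)" by (simp add: scaleC_diff_right)
    then have "norm (v' - z *\<^sub>C v) \<le> norm (w' - z *\<^sub>C w) + norm (v' - w') + cmod z * norm (v - w)"
      using norm_triangle3_diff[of "w' - z *\<^sub>C w" "v' - w'" "z *\<^sub>C (v - w)"] by (simp only: norm_scaleC)
    also have "\<dots> \<le> c1 * \<bar>s\<bar> ^ 3 + \<epsilon> + (Z - 1) * \<epsilon>"
      using Z1 by (intro add_mono mult_mono err vw zn) auto
    also have "\<dots> = c1 * \<bar>s\<bar> ^ 3 + (3 * K * c2 * Z) * (\<bar>s\<bar> ^ 3 + remainder t)"
      by (simp add: \<epsilon>_def algebra_simps)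
    also have "\<dots> \<le> c1 * (\<bar>s\<bar> ^ 3 + remainder t) + (3 * K * c2 * Z) * (\<bar>s\<bar> ^ 3 + remainder t)
        + (norm w1 + norm w2) * (\<bar>s\<bar> ^ 3 + remainder t)"
    proof -
      have "0 \<le> (norm w1 + norm w2) * (\<bar>s\<bar> ^ 3 + remainder t)"
        by (intro mult_nonneg_nonneg add_nonneg_nonneg remainder_nonneg) auto
      moreover have "c1 * \<bar>s\<bar> ^ 3 \<le> c1 * (\<bar>s\<bar> ^ 3 + remainder t)"
        using remainder_nonneg[of t] by (intro mult_left_mono c12) simp
      ultimately show ?thesis by linarith
    qed
    also have "\<dots> = c * (\<bar>s\<bar> ^ 3 + remainder t)" by (simp add: c_def distrib_right)
    finally have 1: "norm (v' - z *\<^sub>C v) \<le> c * (\<bar>s\<bar> ^ 3 + remainder t)" .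
    have wu: "norm (w - u) \<le> (norm w1 + norm w2) * \<bar>s\<bar>"
    proof -
      have "norm (w - u) \<le> norm (\<sigma> *\<^sub>C w1) + norm (\<sigma>\<^sup>2 *\<^sub>C w2)"
        unfolding w_def using norm_triangle_ineq[of "\<sigma> *\<^sub>C w1" "\<sigma>\<^sup>2 *\<^sub>C w2"] by (simp add: add.assoc)
      also have "\<dots> \<le> \<bar>s\<bar> * norm w1 + \<bar>s\<bar> * norm w2"
        unfolding norm_scaleC norm_power \<sigma> by (intro add_mono mult_right_mono s3 order_refl) auto
      finally show ?thesis by (simp add: algebra_simps)
    qed
    have "norm (v - u) \<le> norm (v - w) + norm (w - u)" using norm_triangle_ineq[of "v - w" "w - u"] by simp
    also have "\<dots> \<le> \<epsilon> * Z + (norm w1 + norm w2) * \<bar>s\<bar>"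
      using vw(1) wu mult_left_mono[OF Z1 \<epsilon>0] by linarith
    also have "\<dots> \<le> (3 * K * c2 * Z) * (\<bar>s\<bar> + remainder t) + (norm w1 + norm w2) * (\<bar>s\<bar> + remainder t)
        + c1 * (\<bar>s\<bar> + remainder t)"
    proof -
      have "\<epsilon> * Z = (3 * K * c2 * Z) * (\<bar>s\<bar> ^ 3 + remainder t)" by (simp add: \<epsilon>_def)
      also have "\<dots> \<le> (3 * K * c2 * Z) * (\<bar>s\<bar> + remainder t)"
        by (intro mult_left_mono KcZ add_right_mono s3)
      finally have i: "\<epsilon> * Z \<le> (3 * K * c2 * Z) * (\<bar>s\<bar> + remainder t)" .
      have ii: "(norm w1 + norm w2) * \<bar>s\<bar> \<le> (norm w1 + norm w2) * (\<bar>s\<bar> + remainder t)"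
        using remainder_nonneg[of t] by (intro mult_left_mono) auto
      have iii: "0 \<le> c1 * (\<bar>s\<bar> + remainder t)" using c12 remainder_nonneg[of t] by simp
      show ?thesis using i ii iii by linarith
    qed
    also have "\<dots> = c * (\<bar>s\<bar> + remainder t)" by (simp add: c_def distrib_right)
    finally have 2: "norm (v - u) \<le> c * (\<bar>s\<bar> + remainder t)" .
    have "z = l + \<mu> * of_real (t - t\<^sub>0) + 1/2 * \<nu> * of_real ((t - t\<^sub>0)\<^sup>2)"
      by (simp add: z_def \<sigma>_def s_def)
    then show ?thesis using v(1) 1 2 unfolding s_def by blast
  qed
  then show ?thesis using c0 by blast
qed

lemma Q_lim: "((\<lambda>t. norm (Q t - Q t\<^sub>0)) \<longlongrightarrow> 0) (at t\<^sub>0 within {0..1})"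
  using second_order_limits(3)[OF expansion] by (simp add: tendsto_norm_zero_iff LIM_zero_iff)

text \<open>
  Bounds on the annulus for the resolvent of \<open>H t\<^sub>0\<close> and for \<open>z\<close> itself.
\<close>

definition "bound0 = 2 / (rad / 2)"
definition "radius_bound = cmod l + 5 / 4 * rad"

text \<open>
  The first condition makes the approximate inverse of \<open>H t - z\<close> good enough on the annulus; the second makes
  \<open>Pt t\<close> differ from \<open>Pt t\<^sub>0\<close> by less than \<open>1/4\<close>, so that \<open>Pt t v\<close> has norm at least \<open>1/2\<close> for every \<open>v\<close> within \<open>1/4\<close> of
  a unit vector in \<open>N\<close>.
\<close>

definition near :: "real \<Rightarrow> bool"
  where "near t \<longleftrightarrow> pert_const bound0 radius_bound * norm (Q t - Q t\<^sub>0) \<le> 1 / 2 \<and>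
    rad * ((2 * bound0 + 3) * (pert_const bound0 radius_bound * norm (Q t - Q t\<^sub>0))) < 1 / 4"

lemma near_t0: "near t\<^sub>0"
  by (simp add: near_def)

lemma eventually_near: "\<forall>\<^sub>F t in at t\<^sub>0 within {0..1}. near t"
proof -
  have "((\<lambda>t. pert_const bound0 radius_bound * norm (Q t - Q t\<^sub>0)) \<longlongrightarrow> pert_const bound0 radius_bound * 0)
      (at t\<^sub>0 within {0..1})"
    by (intro tendsto_intros Q_lim)
  then have "\<forall>\<^sub>F t in at t\<^sub>0 within {0..1}. pert_const bound0 radius_bound * norm (Q t - Q t\<^sub>0) < 1 / 2"
    by (rule order_tendstoD(2)) simp
  moreover have "((\<lambda>t. rad * ((2 * bound0 + 3) * (pert_const bound0 radius_bound * norm (Q t - Q t\<^sub>0))))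
      \<longlongrightarrow> rad * ((2 * bound0 + 3) * (pert_const bound0 radius_bound * 0))) (at t\<^sub>0 within {0..1})"
    by (intro tendsto_intros Q_lim)
  then have "\<forall>\<^sub>F t in at t\<^sub>0 within {0..1}.
      rad * ((2 * bound0 + 3) * (pert_const bound0 radius_bound * norm (Q t - Q t\<^sub>0))) < 1 / 4"
    by (rule order_tendstoD(2)) simp
  ultimately show ?thesis by eventually_elim (simp add: near_def)
qed

lemma annulus_perturbation:
  assumes t: "t \<in> {0..1}" "near t" and z: "rad / 2 < dist l z" "dist l z < 5 / 4 * rad"
  shows "z \<notin> Spec (H t)" "norm (resolvent (H t) z) \<le> 2 * (bound0 + 1)"
    "norm (resolvent (H t) z - resolvent (H t\<^sub>0) z)
      \<le> (2 * bound0 + 3) * (pert_const bound0 radius_bound * norm (Q t - Q t\<^sub>0))"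
proof -
  have zn: "z \<notin> Spec (H t\<^sub>0)" and zb: "norm (resolvent (H t\<^sub>0) z) \<le> bound0"
    using sc0.annulus_notin[OF z] sc0.annulus_bound[OF z] by (auto simp: bound0_def)
  have "dist l (cnj z) = dist l z"
    using cnj_l by (metis complex_cnj_diff complex_mod_cnj dist_norm)
  then have zb': "norm (resolvent (H t\<^sub>0) (cnj z)) \<le> bound0"
    using sc0.annulus_bound[of "cnj z"] z by (simp add: bound0_def)
  have Zb: "cmod z \<le> radius_bound"
    using norm_triangle_sub[of z l] z(2) by (simp add: radius_bound_def dist_norm norm_minus_commute)
  have small: "pert_const bound0 radius_bound * norm (Q t - Q t\<^sub>0) \<le> 1 / 2" using t(2) by (simp add: near_def)
  show "z \<notin> Spec (H t)" "norm (resolvent (H t) z) \<le> 2 * (bound0 + 1)"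
    "norm (resolvent (H t) z - resolvent (H t\<^sub>0) z)
      \<le> (2 * bound0 + 3) * (pert_const bound0 radius_bound * norm (Q t - Q t\<^sub>0))"
    using resolvent_perturbation[OF ext0 ext[OF t(1)] zn zb zb' Zb proj0 small] by auto
qed

lemma spectral_circle_near:
  assumes t: "t \<in> {0..1}" "near t"
  shows "spectral_circle (H t) l rad (rad / 2) (5 / 4 * rad) (2 * (bound0 + 1))"
proof
  show "self_adjoint_uop (H t)" using ext[OF t(1)] by (simp add: extension_def)
qed (use annulus_perturbation[OF t] Im_l rad_pos in auto)

lemma riesz_near:
  assumes t: "t \<in> {0..1}" "near t"
  shows "norm (Pt t - Pt t\<^sub>0) < 1 / 4"
proof -
  let ?m = "(2 * bound0 + 3) * (pert_const bound0 radius_bound * norm (Q t - Q t\<^sub>0))"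
  let ?b = "\<lambda>t. blinfun_contour_integral (circlepath l rad) (resolvent (H t))"
  interpret st: spectral_circle "H t" l rad "rad / 2" "5 / 4 * rad" "2 * (bound0 + 1)"
    by (rule spectral_circle_near[OF t])
  have "norm (?b t - ?b t\<^sub>0) \<le> 2 * pi * rad * ?m"
    by (rule norm_blinfun_contour_integral_diff[OF st.continuous_on_R_sphere sc0.continuous_on_R_sphere rad_pos])
      (rule annulus_perturbation(3)[OF t], use rad_pos in auto)
  then have "1 / (2 * pi) * norm (?b t - ?b t\<^sub>0) \<le> 1 / (2 * pi) * (2 * pi * rad * ?m)"
    by (rule mult_left_mono) simp
  moreover have "Pt t - Pt t\<^sub>0 = scaleC_blinfun (- 1 / (2 * of_real pi * \<i>)) (?b t - ?b t\<^sub>0)"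
    by (simp only: riesz_projection_def bounded_bilinear.diff_right[OF bounded_bilinear_scaleC_blinfun])
  then have "norm (Pt t - Pt t\<^sub>0) \<le> 1 / (2 * pi) * norm (?b t - ?b t\<^sub>0)"
    using norm_scaleC_blinfun_le[of "- 1 / (2 * of_real pi * \<i>)" "?b t - ?b t\<^sub>0"]
    by (simp add: norm_divide norm_mult)
  ultimately have "norm (Pt t - Pt t\<^sub>0) \<le> 1 / (2 * pi) * (2 * pi * rad * ?m)" by linarith
  also have "\<dots> = rad * ?m" by simp
  also have "\<dots> < 1 / 4" using t(2) by (simp add: near_def)
  finally show ?thesis .
qed

lemma near_projections_near:
  assumes t: "t \<in> {0..1}" "near t"
  shows "\<exists>G. near_projections (Pt t\<^sub>0) (Pt t) G"
proof -
  obtain G where G: "finite G" "N \<subseteq> complex_vector.span G" using finite_multiplicity by blast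
  have "near_projections (Pt t\<^sub>0) (Pt t) G"
  proof
    show "is_orthogonal_projection (Pt t\<^sub>0)" by (rule sc0.riesz_orthogonal_projection)
    show "is_orthogonal_projection (Pt t)"
      by (rule spectral_circle.riesz_orthogonal_projection[OF spectral_circle_near[OF t]])
    show "norm (Pt t - Pt t\<^sub>0) < 1" using riesz_near[OF t] by simp
    show "range Pl \<subseteq> complex_vector.span G" using G(2) by (simp add: range_P0)
  qed (rule G(1))
  then show ?thesis by blast
qed

lemma eigenvalue_near_quasimode:
  assumes t: "t \<in> {0..1}" "near t" and u: "u \<in> N" "norm u = 1"
    and v: "(v, v') \<in> H t" "norm (v - u) \<le> 1 / 4"
  shows "\<exists>z'\<in>Spec_in (range (blinfun_apply (Pt t))) (\<lambda>x. uapply (H t) (Pt t x)).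
    cmod (z' - z) \<le> 2 * norm (v' - z *\<^sub>C v)"
proof -
  interpret st: spectral_circle "H t" l rad "rad / 2" "5 / 4 * rad" "2 * (bound0 + 1)"
    by (rule spectral_circle_near[OF t])
  obtain G where "near_projections (Pt t\<^sub>0) (Pt t) G" using near_projections_near[OF t] by blast
  then obtain G' where G': "finite G'" "range (blinfun_apply (Pt t)) \<subseteq> complex_vector.span G'"
    using near_projections.finite_rank_near by blast
  have "u = Pt t v + Pt t (u - v) - (Pt t - Pt t\<^sub>0) u"
    using P0_N[OF u(1)] by (simp add: blinfun.diff_left blinfun.diff_right)
  then have "norm u \<le> norm (Pt t v) + norm (Pt t (u - v))
      + norm ((Pt t - Pt t\<^sub>0) u)"
    using norm_triangle3_diff by metis
  moreover have "norm (Pt t (u - v)) \<le> 1 / 4"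
    using st.norm_riesz_le[of "u - v"] v(2) by (simp add: norm_minus_commute)
  moreover have "norm ((Pt t - Pt t\<^sub>0) u) \<le> 1 / 4"
    using norm_blinfun[of "Pt t - Pt t\<^sub>0" u] riesz_near[OF t] u(2) by simp
  ultimately have half: "norm (Pt t v) \<ge> 1 / 2" using u(2) by linarith
  then have "Pt t v \<noteq> 0" by auto
  from st.eigenvalue_near[OF G' v(1) this, of z]
  obtain z' where z': "z' \<in> Spec_in (range (blinfun_apply (Pt t))) st.restricted"
    "cmod (z' - z) * norm (Pt t v) \<le> norm (v' - z *\<^sub>C v)" by blast
  have "cmod (z' - z) * (1 / 2) \<le> cmod (z' - z) * norm (Pt t v)"
    by (intro mult_left_mono half) simp
  then have "cmod (z' - z) \<le> 2 * norm (v' - z *\<^sub>C v)" using z'(2) by simp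
  moreover have "st.restricted = (\<lambda>x. uapply (H t) (Pt t x))"
    by (simp add: fun_eq_iff st.restricted_def)
  ultimately show ?thesis using z'(1) by auto
qed

text \<open>
  The error of the quasimode is \<open>o(s\<^sup>2)\<close>, so eigenvalues chosen within twice this error of \<open>z t\<close> form a branch.
  The point \<open>t\<^sub>0\<close> is not seen by the filter and is treated separately; there the quasimode is \<open>u\<close> itself.
\<close>

theorem eigenvalue_branch:
  assumes u: "u \<in> N" "norm u = 1" "Wdot u = \<mu> *\<^sub>C u" and n1: "n1 \<in> N"
    and eq: "2 *\<^sub>C (Wdot n1 - \<mu> *\<^sub>C n1) = \<nu> *\<^sub>C u - Wddot u"
  shows "\<exists>ev. (\<forall>\<^sub>F t in at t\<^sub>0 within {0..1}. ev t \<in> Spec_in (range (blinfun_apply (Pt t)))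
        (\<lambda>x. uapply (H t) (Pt t x))) \<and>
    ev t\<^sub>0 \<in> Spec_in (range (blinfun_apply (Pt t\<^sub>0))) (\<lambda>x. uapply (H t\<^sub>0) (Pt t\<^sub>0 x)) \<and>
    (\<lambda>t. ev t - (l + \<mu> * of_real (t - t\<^sub>0) + 1/2 * \<nu> * of_real ((t - t\<^sub>0)\<^sup>2)))
      \<in> o[at t\<^sub>0 within {0..1}](\<lambda>t. of_real ((t - t\<^sub>0)\<^sup>2))"
proof -
  let ?F = "at t\<^sub>0 within {0..1}"
  define sp where "sp t = Spec_in (range (blinfun_apply (Pt t))) (\<lambda>x. uapply (H t) (Pt t x))" for t
  define z where "z t = l + \<mu> * of_real (t - t\<^sub>0) + 1/2 * \<nu> * of_real ((t - t\<^sub>0)\<^sup>2)" for t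
  obtain c where c: "c \<ge> 0" "\<And>t. t \<in> {0..1} \<Longrightarrow> \<exists>v v'. (v, v') \<in> H t \<and>
      norm (v' - z t *\<^sub>C v) \<le> c * (\<bar>t - t\<^sub>0\<bar> ^ 3 + remainder t) \<and> norm (v - u) \<le> c * (\<bar>t - t\<^sub>0\<bar> + remainder t)"
    using quasimode[OF u(1,3) n1 eq] unfolding z_def by blast
  define ok where "ok t \<longleftrightarrow> t \<in> {0..1} \<and> near t \<and> c * (\<bar>t - t\<^sub>0\<bar> + remainder t) \<le> 1 / 4" for t
  have "\<exists>z'. z' \<in> sp t \<and> cmod (z' - z t) \<le> 2 * c * (\<bar>t - t\<^sub>0\<bar> ^ 3 + remainder t)" if "ok t" for t
  proof -
    have t: "t \<in> {0..1}" "near t" "c * (\<bar>t - t\<^sub>0\<bar> + remainder t) \<le> 1 / 4" using that by (auto simp: ok_def)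
    obtain v v' where v: "(v, v') \<in> H t" "norm (v' - z t *\<^sub>C v) \<le> c * (\<bar>t - t\<^sub>0\<bar> ^ 3 + remainder t)"
      "norm (v - u) \<le> c * (\<bar>t - t\<^sub>0\<bar> + remainder t)" using c(2)[OF t(1)] by blast
    have "norm (v - u) \<le> 1 / 4" using v(3) t(3) by linarith
    from eigenvalue_near_quasimode[OF t(1,2) u(1,2) v(1) this, of "z t"]
    obtain z' where "z' \<in> sp t" "cmod (z' - z t) \<le> 2 * norm (v' - z t *\<^sub>C v)" unfolding sp_def by blast
    then show ?thesis using v(2) by (intro exI[of _ z']) auto
  qed
  then obtain ev where ev: "\<And>t. ok t \<Longrightarrow> ev t \<in> sp t"
    "\<And>t. ok t \<Longrightarrow> cmod (ev t - z t) \<le> 2 * c * (\<bar>t - t\<^sub>0\<bar> ^ 3 + remainder t)" by metis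
  have "((\<lambda>t. t - t\<^sub>0) \<longlongrightarrow> 0) ?F" by (rule tendsto_eq_intros | simp)+
  then have "((\<lambda>t. \<bar>t - t\<^sub>0\<bar>) \<longlongrightarrow> 0) ?F" by (rule tendsto_rabs_zero)
  then have "((\<lambda>t. c * (\<bar>t - t\<^sub>0\<bar> + remainder t)) \<longlongrightarrow> c * (0 + 0)) ?F"
    by (intro tendsto_intros remainder_lim)
  then have "\<forall>\<^sub>F t in ?F. c * (\<bar>t - t\<^sub>0\<bar> + remainder t) < 1 / 4"
    by (rule order_tendstoD(2)) simp
  then have evok: "\<forall>\<^sub>F t in ?F. ok t"
    using eventually_near eventually_in_unit_interval by eventually_elim (simp add: ok_def)
  have ok0: "ok t\<^sub>0" using t0 by (simp add: ok_def near_t0 remainder_t0)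
  have "(\<lambda>t. ev t - z t) \<in> o[?F](\<lambda>t. of_real ((t - t\<^sub>0)\<^sup>2))"
  proof (rule landau_o.smallI)
    fix d :: real assume d: "d > 0"
    have "\<forall>\<^sub>F t in ?F. norm (2 * c * (\<bar>t - t\<^sub>0\<bar> ^ 3 + remainder t)) \<le> d * norm ((t - t\<^sub>0)\<^sup>2)"
      by (rule landau_o.smallD[OF error_smallo d])
    then show "\<forall>\<^sub>F t in ?F. cmod (ev t - z t) \<le> d * cmod (of_real ((t - t\<^sub>0)\<^sup>2))"
      using evok
    proof eventually_elim
      case (elim t)
      have "cmod (complex_of_real ((t - t\<^sub>0)\<^sup>2)) = norm ((t - t\<^sub>0)\<^sup>2)" by (simp only: norm_of_real real_norm_def)
      then show ?case using elim(1) ev(2)[OF elim(2)] by (simp only: real_norm_def)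
    qed
  qed
  moreover have "\<forall>\<^sub>F t in ?F. ev t \<in> sp t" using evok by eventually_elim (rule ev(1))
  ultimately show ?thesis using ev(1)[OF ok0] unfolding sp_def z_def by blast
qed

end

section \<open>Eigenprojections of Hermitian operators\<close>

lemma orthogonal_projection_onto:
  fixes V :: "'a::complex_inner set"
  assumes V: "complex_vector.subspace V" "finite G" "V \<subseteq> complex_vector.span G"
  shows "orthogonal_projection_onto V x \<in> V" "v \<in> V \<Longrightarrow> \<langle>orthogonal_projection_onto V x, v\<rangle> = \<langle>x, v\<rangle>"
    "x \<in> V \<Longrightarrow> orthogonal_projection_onto V x = x"
proof -
  obtain E where E: "finite E" "orthonormal E" "complex_vector.span E = V"
    using orthonormal_basis_exists[OF V] by blast
  have unique: "p = ortho_sum E x" if p: "p \<in> V" "\<forall>v\<in>V. \<langle>x - p, v\<rangle> = 0" for p x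
  proof -
    define d where "d = p - ortho_sum E x"
    have "ortho_sum E x \<in> V" using ortho_sum_in_span[of E x] by (simp add: E(3))
    then have dV: "d \<in> V" unfolding d_def by (rule complex_vector.subspace_diff[OF V(1) p(1)])
    have "\<langle>x - ortho_sum E x, d\<rangle> = 0"
      by (rule diff_ortho_sum_orthogonal[OF E(1,2)]) (simp add: dV E(3))
    moreover have "\<langle>x - p, d\<rangle> = 0" using p(2) dV by blast
    moreover have "\<langle>d, d\<rangle> = \<langle>x - ortho_sum E x, d\<rangle> - \<langle>x - p, d\<rangle>"
      unfolding cinner_diff_left[symmetric] by (simp add: d_def)
    ultimately have "d = 0" by simp
    then show ?thesis by (simp add: d_def)
  qed
  have eq: "orthogonal_projection_onto V x = ortho_sum E x" for x
    unfolding orthogonal_projection_onto_def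
  proof (rule the_equality)
    show "ortho_sum E x \<in> V \<and> (\<forall>v\<in>V. \<langle>x - ortho_sum E x, v\<rangle> = 0)"
      using ortho_sum_in_span[of E x] diff_ortho_sum_orthogonal[OF E(1,2), of _ x] by (auto simp: E(3))
  qed (use unique in blast)
  show "orthogonal_projection_onto V x \<in> V" unfolding eq using ortho_sum_in_span[of E x] by (simp add: E(3))
  show "\<langle>orthogonal_projection_onto V x, v\<rangle> = \<langle>x, v\<rangle>" if "v \<in> V"
    using diff_ortho_sum_orthogonal[OF E(1,2), of v x] that by (simp add: eq E(3) cinner_diff_left)
  show "orthogonal_projection_onto V x = x" if "x \<in> V"
    unfolding eq by (rule ortho_sum_eq[OF E(1,2)]) (simp add: that E(3))
qed

lemma hermitian_eigenvectors_orthogonal: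
  fixes x y :: "'a::complex_inner"
  assumes herm: "\<langle>L x, y\<rangle> = \<langle>x, L y\<rangle>" "\<langle>L y, y\<rangle> = \<langle>y, L y\<rangle>"
    and x: "L x = a *\<^sub>C x" and y: "L y = b *\<^sub>C y" and ab: "a \<noteq> b"
  shows "\<langle>x, y\<rangle> = 0"
proof (cases "y = 0")
  case False
  have "cnj b = b" using herm(2) False by (simp add: y cinner_algebra)
  then have "(a - b) * \<langle>x, y\<rangle> = 0" using herm(1) by (simp add: x y cinner_algebra left_diff_distrib)
  then show ?thesis using ab by simp
qed simp

text \<open>
  In an eigenbasis the equation is diagonal, and \<open>b\<close> has no component where \<open>L - \<mu>\<close> vanishes.
\<close>

lemma hermitian_solvable:
  fixes V G :: "'a::complex_inner set"
  assumes V: "complex_vector.subspace V" "finite G" "V \<subseteq> complex_vector.span G"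
    and L: "\<And>x. x \<in> V \<Longrightarrow> L x \<in> V"
    and add: "\<And>x y. x \<in> V \<Longrightarrow> y \<in> V \<Longrightarrow> L (x + y) = L x + L y"
    and scale: "\<And>c x. x \<in> V \<Longrightarrow> L (c *\<^sub>C x) = c *\<^sub>C L x"
    and herm: "\<And>x y. x \<in> V \<Longrightarrow> y \<in> V \<Longrightarrow> \<langle>L x, y\<rangle> = \<langle>x, L y\<rangle>"
    and b: "b \<in> V" "\<And>v. v \<in> V \<Longrightarrow> L v = \<mu> *\<^sub>C v \<Longrightarrow> \<langle>b, v\<rangle> = 0"
  shows "\<exists>n\<in>V. L n - \<mu> *\<^sub>C n = b"
proof -
  obtain E q where E: "finite E" "orthonormal E" "complex_vector.span E = V"
    and q: "\<And>e. e \<in> E \<Longrightarrow> L e = complex_of_real (q e) *\<^sub>C e"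
    using spectral_theorem[OF V L add scale herm] by blast
  have EV: "e \<in> V" if "e \<in> E" for e using E(3) that complex_vector.span_base by blast
  define c where "c e = \<langle>b, e\<rangle> / (complex_of_real (q e) - \<mu>)" for e
  have ce: "(complex_of_real (q e) - \<mu>) * c e = \<langle>b, e\<rangle>" if "e \<in> E" for e
    using b(2)[OF EV[OF that]] q[OF that] by (cases "complex_of_real (q e) = \<mu>") (auto simp: c_def)
  have sum: "(\<Sum>e\<in>E'. c e *\<^sub>C e) \<in> V \<and> L (\<Sum>e\<in>E'. c e *\<^sub>C e) = (\<Sum>e\<in>E'. (complex_of_real (q e) * c e) *\<^sub>C e)"
    if "E' \<subseteq> E" for E'
    using finite_subset[OF that E(1)] that
  proof (induction E' rule: finite_induct)
    case empty
    show ?case using scale[of 0 0] complex_vector.subspace_0[OF V(1)] by simp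
  next
    case (insert e E')
    have "c e *\<^sub>C e \<in> V" using insert EV by (intro complex_vector.subspace_scale[OF V(1)]) auto
    then show ?case
      using insert EV[of e] q[of e] complex_vector.subspace_add[OF V(1), of "c e *\<^sub>C e" "\<Sum>e\<in>E'. c e *\<^sub>C e"]
      by (simp add: add scale scaleC_scaleC mult.commute)
  qed
  define n where "n = (\<Sum>e\<in>E. c e *\<^sub>C e)"
  have "L n - \<mu> *\<^sub>C n = (\<Sum>e\<in>E. ((complex_of_real (q e) - \<mu>) * c e) *\<^sub>C e)"
    using sum[of E] by (simp add: n_def complex_vector.scale_sum_right scaleC_scaleC
        left_diff_distrib scaleC_diff_left sum_subtractf)
  also have "\<dots> = (\<Sum>e\<in>E. \<langle>b, e\<rangle> *\<^sub>C e)" by (intro sum.cong) (simp_all add: ce)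
  also have "\<dots> = b" using ortho_sum_eq[OF E(1,2), of b] b(1) by (simp add: E(3) ortho_sum_def)
  finally have "L n - \<mu> *\<^sub>C n = b" .
  then show ?thesis using sum[of E] unfolding n_def by blast
qed

context extension_family
begin

abbreviation "eigenspace1 \<mu> \<equiv> eigenspace_in N Wdot \<mu>"
abbreviation "proj1 \<mu> \<equiv> eigenprojection_in N Wdot \<mu>"

lemma eigenspace1_iff: "x \<in> eigenspace1 \<mu> \<longleftrightarrow> x \<in> N \<and> Wdot x = \<mu> *\<^sub>C x"
  by (simp add: eigenspace_in_def)

lemma subspace_eigenspace1: "complex_vector.subspace (eigenspace1 \<mu>)"
  unfolding complex_vector.subspace_def
proof (intro conjI ballI allI)
  have 0: "0 \<in> N" by (rule complex_vector.subspace_0[OF subspace_N])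
  show "0 \<in> eigenspace1 \<mu>" using Wdot_linear(2)[OF 0 0, of 0] by (simp add: eigenspace1_iff 0)
qed (auto simp: eigenspace1_iff N_add N_scale Wdot_linear scaleC_add_right scaleC_scaleC mult.commute)

lemma proj1:
  shows "proj1 \<mu> x \<in> eigenspace1 \<mu>" "v \<in> eigenspace1 \<mu> \<Longrightarrow> \<langle>proj1 \<mu> x, v\<rangle> = \<langle>x, v\<rangle>"
    "x \<in> eigenspace1 \<mu> \<Longrightarrow> proj1 \<mu> x = x"
proof -
  obtain G where G: "finite G" "N \<subseteq> complex_vector.span G" using finite_multiplicity by blast
  have "eigenspace1 \<mu> \<subseteq> complex_vector.span G" using G(2) by (auto simp: eigenspace1_iff)
  from orthogonal_projection_onto[OF subspace_eigenspace1 G(1) this]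
  show "proj1 \<mu> x \<in> eigenspace1 \<mu>" "v \<in> eigenspace1 \<mu> \<Longrightarrow> \<langle>proj1 \<mu> x, v\<rangle> = \<langle>x, v\<rangle>"
    "x \<in> eigenspace1 \<mu> \<Longrightarrow> proj1 \<mu> x = x"
    unfolding eigenprojection_in_def by auto
qed

lemma range_proj1: "range (proj1 \<mu>) = eigenspace1 \<mu>"
proof
  show "range (proj1 \<mu>) \<subseteq> eigenspace1 \<mu>" using proj1(1) by blast
  show "eigenspace1 \<mu> \<subseteq> range (proj1 \<mu>)"
  proof
    fix x assume "x \<in> eigenspace1 \<mu>"
    then have "x = proj1 \<mu> x" by (simp only: proj1(3))
    then show "x \<in> range (proj1 \<mu>)" by (rule range_eqI)
  qed
qed

definition "second \<mu> = proj1 \<mu> \<circ> Wddot \<circ> proj1 \<mu>"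

lemma second_cinner:
  assumes "x \<in> eigenspace1 \<mu>" "y \<in> eigenspace1 \<mu>"
  shows "\<langle>second \<mu> x, y\<rangle> = \<langle>Wddot x, y\<rangle>"
  using assms by (simp add: second_def proj1)

lemma second_hermitian:
  assumes "x \<in> eigenspace1 \<mu>" "y \<in> eigenspace1 \<mu>"
  shows "\<langle>second \<mu> x, y\<rangle> = \<langle>x, second \<mu> y\<rangle>"
proof -
  have "\<langle>x, second \<mu> y\<rangle> = cnj \<langle>Wddot y, x\<rangle>"
    using cinner_commute[of x "second \<mu> y"] second_cinner[OF assms(2,1)] by simp
  also have "\<dots> = \<langle>x, Wddot y\<rangle>" by (rule cinner_commute[symmetric])
  also have "\<dots> = \<langle>Wddot x, y\<rangle>" using Wddot_hermitian[of x y] assms by (simp add: eigenspace1_iff)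
  finally show ?thesis by (simp add: second_cinner[OF assms])
qed

text \<open>
  Homogeneity of the compression \<open>second \<mu>\<close>, needed to normalise an eigenvector, follows from its being
  Hermitian.
\<close>

lemma normalised_eigenvector:
  assumes "\<nu> \<in> eigenvalues_in (eigenspace1 \<mu>) (second \<mu>)"
  shows "\<exists>u. u \<in> eigenspace1 \<mu> \<and> norm u = 1 \<and> second \<mu> u = \<nu> *\<^sub>C u"
proof -
  obtain x where x: "x \<in> eigenspace1 \<mu>" "second \<mu> x = \<nu> *\<^sub>C x" "x \<noteq> 0"
    using assms unfolding eigenvalues_in_def eigenspace_in_def[of _ "second \<mu>"] by auto
  define c where "c = complex_of_real (1 / norm x)"
  define u where "u = c *\<^sub>C x"
  have u: "u \<in> eigenspace1 \<mu>"
    unfolding u_def by (rule complex_vector.subspace_scale[OF subspace_eigenspace1 x(1)])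
  have nu: "norm u = 1" using x(3) by (simp add: u_def c_def norm_scaleC norm_divide)
  have V: "second \<mu> y \<in> eigenspace1 \<mu>" for y by (simp add: second_def proj1(1))
  define d where "d = second \<mu> u - \<nu> *\<^sub>C u"
  have dV: "d \<in> eigenspace1 \<mu>"
    unfolding d_def
    by (intro complex_vector.subspace_diff[OF subspace_eigenspace1] complex_vector.subspace_scale[OF subspace_eigenspace1] V u)
  have "\<langle>second \<mu> u, d\<rangle> = c * \<langle>second \<mu> x, d\<rangle>"
    unfolding second_hermitian[OF u dV] second_hermitian[OF x(1) dV] by (simp add: u_def cinner_scaleC_left)
  then have "\<langle>d, d\<rangle> = 0"
    unfolding d_def[symmetric] by (subst d_def) (simp add: x(2) u_def cinner_algebra)
  then have "second \<mu> u = \<nu> *\<^sub>C u" by (simp add: d_def)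
  then show ?thesis using u nu by blast
qed

text \<open>
  The compression of \<open>Wddot\<close> to the eigenspace of \<open>\<mu>\<close> has \<open>u\<close> as eigenvector, so \<open>\<nu> u - Wddot u\<close> is orthogonal
  to that eigenspace and lies in the range of \<open>Wdot - \<mu>\<close>.
\<close>

lemma eigenvalue_branch_eigenvector:
  assumes u: "u \<in> eigenspace1 \<mu>" "norm u = 1" "second \<mu> u = \<nu> *\<^sub>C u"
  shows "\<exists>ev. (\<forall>\<^sub>F t in at t\<^sub>0 within {0..1}. ev t \<in> Spec_in (range (blinfun_apply (Pt t)))
        (\<lambda>x. uapply (H t) (Pt t x))) \<and>
    ev t\<^sub>0 \<in> Spec_in (range (blinfun_apply (Pt t\<^sub>0))) (\<lambda>x. uapply (H t\<^sub>0) (Pt t\<^sub>0 x)) \<and>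
    (\<lambda>t. ev t - (l + \<mu> * of_real (t - t\<^sub>0) + 1/2 * \<nu> * of_real ((t - t\<^sub>0)\<^sup>2)))
      \<in> o[at t\<^sub>0 within {0..1}](\<lambda>t. of_real ((t - t\<^sub>0)\<^sup>2))"
proof -
  have uN: "u \<in> N" "Wdot u = \<mu> *\<^sub>C u" using u(1) by (auto simp: eigenspace1_iff)
  obtain G where G: "finite G" "N \<subseteq> complex_vector.span G" using finite_multiplicity by blast
  define b where "b = (1 / 2) *\<^sub>C (\<nu> *\<^sub>C u - Wddot u)"
  have "\<exists>n\<in>N. Wdot n - \<mu> *\<^sub>C n = b"
  proof (rule hermitian_solvable[OF subspace_N G])
    show "b \<in> N" unfolding b_def by (intro N_scale N_diff uN Wddot_in_N)
    fix v assume "v \<in> N" "Wdot v = \<mu> *\<^sub>C v"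
    then have v: "v \<in> eigenspace1 \<mu>" by (simp add: eigenspace1_iff)
    from second_cinner[OF u(1) v] show "\<langle>b, v\<rangle> = 0"
      by (simp add: b_def u(3) cinner_algebra)
  qed (auto simp: Wdot_in_N Wdot_linear Wdot_hermitian)
  then obtain n where n: "n \<in> N" "Wdot n - \<mu> *\<^sub>C n = b" by blast
  have "2 *\<^sub>C (Wdot n - \<mu> *\<^sub>C n) = \<nu> *\<^sub>C u - Wddot u"
    unfolding n(2) by (simp add: b_def scaleC_scaleC scaleC_one)
  from eigenvalue_branch[OF uN(1) u(2) uN(2) n(1) this] show ?thesis .
qed

lemma coefficients_sympl:
  assumes u: "u \<in> eigenspace1 \<mu>" "norm u = 1" "second \<mu> u = \<nu> *\<^sub>C u"
  shows "sympl (Qd (T u)) (T u) = \<mu>"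
    "sympl (Qdd (T u)) (T u) - 2 * \<langle>T (TS_adj (Y u)), Y u\<rangle> = \<nu>"
proof -
  have uN: "u \<in> N" "Wdot u = \<mu> *\<^sub>C u" using u(1) by (auto simp: eigenspace1_iff)
  have uu: "\<langle>u, u\<rangle> = 1" using u(2) by (simp add: cinner_self)
  show "sympl (Qd (T u)) (T u) = \<mu>"
    using Wdot_cinner[OF uN(1,1)] by (simp add: uN(2) cinner_scaleC_left uu)
  show "sympl (Qdd (T u)) (T u) - 2 * \<langle>T (TS_adj (Y u)), Y u\<rangle> = \<nu>"
    using Wddot_cinner[OF uN(1,1)] second_cinner[OF u(1,1)] T_TS_adj_hermitian[OF uN(1,1)]
    by (simp add: u(3) cinner_scaleC_left uu)
qed

definition "Ut t = transformation_op (Pt t\<^sub>0) (Pt t)"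

definition "Wt t h = Pl (inv (blinfun_apply (Ut t)) (uapply (H t) (Ut t (Pl h))))"

lemma Spec_in_Wt:
  assumes t: "t \<in> {0..1}" "near t"
  shows "Spec_in (range (blinfun_apply (Pt t))) (\<lambda>x. uapply (H t) (Pt t x))
    = Spec_in (range Pl) (Wt t)"
proof -
  interpret st: spectral_circle "H t" l rad "rad / 2" "5 / 4 * rad" "2 * (bound0 + 1)"
    by (rule spectral_circle_near[OF t])
  obtain G where "near_projections (Pt t\<^sub>0) (Pt t) G" using near_projections_near[OF t] by blast
  then interpret np: near_projections "Pt t\<^sub>0" "Pt t" G .
  have U: "bij (blinfun_apply (Ut t))" "clinear (blinfun_apply (Ut t))"
    "blinfun_apply (Ut t) ` range Pl = range (blinfun_apply (Pt t))"
    unfolding Ut_def by (rule np.bij_transformation np.clinear_transformation np.transformation_range)+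
  show ?thesis
  proof (rule Spec_in_similar[OF U])
    show "uapply (H t) (Pt t y) \<in> range (blinfun_apply (Pt t))" for y
      using st.restricted_in_range[of y] by (simp add: st.restricted_def)
    fix x assume x: "x \<in> range Pl"
    have Ux: "Pt t (Ut t x) = Ut t x"
    proof -
      have "Ut t x \<in> range (blinfun_apply (Pt t))" using U(3) x by blast
      then show ?thesis using st.riesz_idempotent by auto
    qed
    have "uapply (H t) (Ut t x) \<in> range (blinfun_apply (Pt t))"
      using st.restricted_in_range[of "Ut t x"] by (simp add: st.restricted_def Ux)
    then obtain y where y: "y \<in> range Pl" "uapply (H t) (Ut t x) = Ut t y"
      using U(3) by (metis imageE)
    have "Pl x = x" "Pl y = y" using x y(1) sc0.riesz_idempotent by auto
    then show "Wt t x = inv (blinfun_apply (Ut t)) (uapply (H t) (Pt t (Ut t x)))"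
      unfolding Wt_def Ux using y(2) U(1) by (simp add: bij_is_inj)
  qed
qed

lemma Wt_t0:
  assumes "u \<in> N"
  shows "Wt t\<^sub>0 u = l *\<^sub>C u"
proof -
  obtain G where G: "finite G" "N \<subseteq> complex_vector.span G" using finite_multiplicity by blast
  have "Ut t\<^sub>0 = id_blinfun"
    unfolding Ut_def
    by (rule transformation_op_self[OF sc0.riesz_orthogonal_projection G(1)]) (simp add: range_P0 G(2))
  then have U: "blinfun_apply (Ut t\<^sub>0) = id" by (simp add: fun_eq_iff)
  have "uapply (H t\<^sub>0) u = l *\<^sub>C u"
    using assms by (intro uapply_eq[OF linear0]) (simp add: N_iff)
  then show ?thesis by (simp add: Wt_def U P0_N[OF assms] P0_N[OF N_scale[OF assms]])
qed

end

section \<open>The asymptotic expansion of the eigenvalue curves\<close>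

lemma finite_multiplicity_dim:
  fixes V :: "'a::complex_inner set"
  assumes "complex_vector.dim V = m" "m \<ge> 1"
  shows "\<exists>n\<in>V. n \<noteq> 0" "\<exists>G. finite G \<and> V \<subseteq> complex_vector.span G"
proof -
  obtain B where B: "B \<subseteq> V" "complex_vector.independent B" "V \<subseteq> complex_vector.span B"
    "card B = complex_vector.dim V"
    by (rule complex_vector.basis_exists[of V]) blast
  have "card B > 0" using B(4) assms by simp
  then have fin: "finite B" "B \<noteq> {}" unfolding card_gt_0_iff by blast+
  then obtain b where b: "b \<in> B" by blast
  then have "b \<noteq> 0" using B(2) complex_vector.dependent_zero by blast
  then show "\<exists>n\<in>V. n \<noteq> 0" using b B(1) by blast
  show "\<exists>G. finite G \<and> V \<subseteq> complex_vector.span G" using fin(1) B(3) by blast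
qed

theorem theorem2p10:
  fixes A :: "'a::chilbert_space uop"
    and \<Gamma>\<^sub>0 \<Gamma>\<^sub>1 :: "'a \<Rightarrow> 'b::chilbert_space"
    and Q :: "real \<Rightarrow> ('b \<times> 'b) \<Rightarrow>\<^sub>L ('b \<times> 'b)"
    and Qd Qdd :: "('b \<times> 'b) \<Rightarrow>\<^sub>L ('b \<times> 'b)"
    and At :: "real \<Rightarrow> 'a uop"
    and t\<^sub>0 :: real
    and lam :: complex
    and m m' :: nat
    and mi' :: "nat \<Rightarrow> nat"
    and \<mu> :: "nat \<Rightarrow> complex"
    and \<nu> :: "nat \<Rightarrow> nat \<Rightarrow> complex"
    and T :: "'a \<Rightarrow> 'b \<times> 'b"
    and \<gamma> :: "real \<Rightarrow> complex"
    and P U :: "real \<Rightarrow> 'a \<Rightarrow>\<^sub>L 'a"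
    and P\<^sub>0 S\<^sub>0 :: "'a \<Rightarrow> 'a"
    and W :: "real \<Rightarrow> 'a \<Rightarrow> 'a"
    and Wd Wdd :: "'a \<Rightarrow> 'a"
    and Pi :: "nat \<Rightarrow> 'a \<Rightarrow> 'a"
  assumes A: "linear_uop A" "densely_defined A" "symmetric_uop A" "equal_deficiency_indices A"
    and T: "T = (\<lambda>u. (\<Gamma>\<^sub>0 u, \<Gamma>\<^sub>1 u))"
    and triplet: "boundary_triplet A \<Gamma>\<^sub>0 \<Gamma>\<^sub>1"
    and t0: "t\<^sub>0 \<in> {0..1}"
    and Q: "\<And>t. t \<in> {0..1} \<Longrightarrow> is_orthogonal_projection (Q t)"
           "\<And>t. t \<in> {0..1} \<Longrightarrow> lagrangian (range (blinfun_apply (Q t)))"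
    and Qd: "clinear (blinfun_apply Qd)" "clinear (blinfun_apply Qdd)"
    and Q_expansion:
      "(\<lambda>t. norm (Q t - (Q t\<^sub>0 + (t - t\<^sub>0) *\<^sub>R Qd + ((t - t\<^sub>0)\<^sup>2 / 2) *\<^sub>R Qdd)))
        \<in> o[at t\<^sub>0 within {0..1}](\<lambda>t. (t - t\<^sub>0)\<^sup>2)"
    and At: "\<And>t. t \<in> {0..1} \<Longrightarrow> self_adjoint_uop (At t)"
            "\<And>t. t \<in> {0..1} \<Longrightarrow> A \<subseteq> At t"
            "\<And>t. t \<in> {0..1} \<Longrightarrow> T ` Domain (At t) = range (blinfun_apply (Q t))"
    and lam: "lam isolated_in Spec (At t\<^sub>0)"
             "m \<ge> 1" "complex_vector.dim (eigenspace_uop (At t\<^sub>0) lam) = m"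
    and \<gamma>: "\<gamma> = circlepath lam (isolating_radius (At t\<^sub>0) lam)"
    and P: "P = (\<lambda>t. riesz_projection \<gamma> (At t))"
    and P0: "P\<^sub>0 = blinfun_apply (P t\<^sub>0)"
    and S0: "S\<^sub>0 = blinfun_apply (reduced_resolvent \<gamma> (At t\<^sub>0) lam)"
    and U: "U = (\<lambda>t. transformation_op (P t\<^sub>0) (P t))"
    and W: "W = (\<lambda>t h. P\<^sub>0 (inv (blinfun_apply (U t)) (uapply (At t) (blinfun_apply (U t) (P\<^sub>0 h)))))"
    and Wd: "Wd = cadjoint (T \<circ> P\<^sub>0) \<circ> sympl_J \<circ> blinfun_apply Qd \<circ> T \<circ> P\<^sub>0"
    and Wdd: "Wdd = (\<lambda>h.
      (cadjoint (T \<circ> P\<^sub>0) \<circ> sympl_J \<circ> blinfun_apply Qdd \<circ> T \<circ> P\<^sub>0) h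
      - 2 *\<^sub>C (cadjoint (T \<circ> cadjoint (T \<circ> S\<^sub>0) \<circ> blinfun_apply Qd \<circ> sympl_J \<circ> T \<circ> P\<^sub>0)
               \<circ> blinfun_apply Qd \<circ> sympl_J \<circ> T \<circ> P\<^sub>0) h)"
    and \<mu>: "m' \<le> m" "bij_betw \<mu> {1..m'} (eigenvalues_in (range P\<^sub>0) Wd)"
    and Pi: "Pi = (\<lambda>i. eigenprojection_in (range P\<^sub>0) Wd (\<mu> i))"
    and \<nu>: "\<And>i. i \<in> {1..m'} \<Longrightarrow> mi' i \<le> m"
           "\<And>i. i \<in> {1..m'} \<Longrightarrow>
              bij_betw (\<nu> i) {1..mi' i} (eigenvalues_in (range (Pi i)) (Pi i \<circ> Wdd \<circ> Pi i))"
  shows "\<exists>(ev :: nat \<Rightarrow> nat \<Rightarrow> real \<Rightarrow> complex) (u :: nat \<Rightarrow> nat \<Rightarrow> 'a).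
    (\<exists>\<delta>>0. \<forall>t\<in>{0..1}. \<bar>t - t\<^sub>0\<bar> < \<delta> \<longrightarrow>
        Spec_in (range (blinfun_apply (P t))) (\<lambda>x. uapply (At t) (blinfun_apply (P t) x))
          = Spec_in (range P\<^sub>0) (W t) \<and>
        (\<forall>i\<in>{1..m'}. \<forall>k\<in>{1..mi' i}. ev i k t \<in> Spec_in (range P\<^sub>0) (W t))) \<and>
    (\<forall>i\<in>{1..m'}. \<forall>k\<in>{1..mi' i}.
        (\<lambda>t. ev i k t - (lam + \<mu> i * of_real (t - t\<^sub>0) + 1/2 * \<nu> i k * of_real ((t - t\<^sub>0)\<^sup>2)))
          \<in> o[at t\<^sub>0 within {0..1}](\<lambda>t. of_real ((t - t\<^sub>0)\<^sup>2))) \<and>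
    (\<forall>i\<in>{1..m'}. \<forall>k\<in>{1..mi' i}.
        u i k \<in> range (Pi i) \<and> u i k \<in> range P\<^sub>0 \<and>
        (Pi i \<circ> Wdd \<circ> Pi i) (u i k) = \<nu> i k *\<^sub>C u i k \<and>
        Wd (u i k) = \<mu> i *\<^sub>C u i k \<and>
        W t\<^sub>0 (u i k) = lam *\<^sub>C u i k \<and>
        (u i k, lam *\<^sub>C u i k) \<in> At t\<^sub>0) \<and>
    (\<forall>i\<in>{1..m'}. \<forall>k\<in>{1..mi' i}. \<forall>j\<in>{1..m'}. \<forall>l\<in>{1..mi' j}.
        \<langle>u i k, u j l\<rangle> = (if i = j \<and> k = l then 1 else 0)) \<and>
    (\<forall>i\<in>{1..m'}. \<forall>k\<in>{1..mi' i}.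
        (\<lambda>t. ev i k t -
           (lam + sympl (blinfun_apply Qd (T (u i k))) (T (u i k)) * of_real (t - t\<^sub>0)
            + 1/2 * (sympl (blinfun_apply Qdd (T (u i k))) (T (u i k))
                - 2 * \<langle>T (cadjoint (T \<circ> S\<^sub>0) (blinfun_apply Qd (sympl_J (T (P\<^sub>0 (u i k)))))),
                       blinfun_apply Qd (sympl_J (T (P\<^sub>0 (u i k))))\<rangle>)
              * of_real ((t - t\<^sub>0)\<^sup>2)))
          \<in> o[at t\<^sub>0 within {0..1}](\<lambda>t. of_real ((t - t\<^sub>0)\<^sup>2)))"
proof -
  obtain K where "triplet A T K"
    using boundary_triplet_imp_triplet[OF A(2) triplet T] by blast
  then interpret triplet A T K .
  have ext: "extension (At t) (range (blinfun_apply (Q t)))" if "t \<in> {0..1}" for t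
    unfolding extension_def using At Q(2) that by blast
  interpret base_point A T K "At t\<^sub>0" "Q t\<^sub>0" lam
  proof
    show "\<exists>n. n \<noteq> 0 \<and> (n, lam *\<^sub>C n) \<in> At t\<^sub>0"
      using finite_multiplicity_dim(1)[OF lam(3,2)] by (auto simp: eigenspace_uop_def)
  qed (use ext[OF t0] Q(1)[OF t0] lam(1) finite_multiplicity_dim(2)[OF lam(3,2)] in auto)
  note der = lagrangian_projection_derivatives[OF t0 Q Q_expansion]
  interpret second_order A T K "At t\<^sub>0" "Q t\<^sub>0" lam Qd Qdd
    by unfold_locales (use Qd der in \<open>auto simp: clinear_iff\<close>)
  interpret extension_family A T K At Q t\<^sub>0 lam Qd Qdd
    by unfold_locales (use t0 ext Q_expansion in auto)
  have \<gamma>': "\<gamma> = circlepath lam rad" by (simp add: \<gamma> rad_def)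
  have Pt_eq: "P t = Pt t" for t by (simp add: P \<gamma>')
  have P0_eq: "P\<^sub>0 = blinfun_apply (Pt t\<^sub>0)" by (simp add: P0 Pt_eq)
  have S0_eq: "S\<^sub>0 = blinfun_apply (reduced_resolvent (circlepath lam rad) (At t\<^sub>0) lam)"
    by (simp add: S0 \<gamma>')
  have W_eq: "W = Wt" by (simp add: W fun_eq_iff Wt_def Ut_def U Pt_eq P0_eq)
  have Wd_eq: "Wd = Wdot" unfolding Wd Wdot_def P0_eq ..
  have Wdd_eq: "Wdd = Wddot" unfolding Wdd Wddot_def P0_eq S0_eq ..
  have ran: "range P\<^sub>0 = N" unfolding P0_eq by (rule range_P0)
  have Pi_eq: "Pi i = proj1 (\<mu> i)" for i by (simp add: Pi ran Wd_eq)
  have TS_eq: "cadjoint (T \<circ> S\<^sub>0) = TS_adj" by (simp add: TS_adj_def S0_eq)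
  have snd_eq: "Pi i \<circ> Wdd \<circ> Pi i = second (\<mu> i)" for i
    by (simp add: second_def Pi_eq Wdd_eq)
  let ?F = "at t\<^sub>0 within {0..1}"
  define I where "I = Sigma {1..m'} (\<lambda>i. {1..mi' i})"
  have finI: "finite I" by (simp add: I_def)
  define sp where "sp t = Spec_in (range (blinfun_apply (Pt t))) (\<lambda>x. uapply (At t) (Pt t x))" for t
  define z where "z i k t = lam + \<mu> i * of_real (t - t\<^sub>0) + 1/2 * \<nu> i k * of_real ((t - t\<^sub>0)\<^sup>2)" for i k t
  have "\<exists>u. u \<in> eigenspace1 (\<mu> i) \<and> norm u = 1 \<and> second (\<mu> i) u = \<nu> i k *\<^sub>C u" if "(i, k) \<in> I" for i k
  proof (rule normalised_eigenvector)
    have "\<nu> i k \<in> eigenvalues_in (range (Pi i)) (Pi i \<circ> Wdd \<circ> Pi i)"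
      using \<nu>(2)[of i] that by (auto simp: I_def bij_betw_def)
    then show "\<nu> i k \<in> eigenvalues_in (eigenspace1 (\<mu> i)) (second (\<mu> i))"
      unfolding snd_eq by (simp add: Pi_eq range_proj1)
  qed
  then obtain u where u: "\<And>i k. (i, k) \<in> I \<Longrightarrow> u i k \<in> eigenspace1 (\<mu> i)"
    "\<And>i k. (i, k) \<in> I \<Longrightarrow> norm (u i k) = 1"
    "\<And>i k. (i, k) \<in> I \<Longrightarrow> second (\<mu> i) (u i k) = \<nu> i k *\<^sub>C u i k" by metis
  have uN: "u i k \<in> N" "Wdot (u i k) = \<mu> i *\<^sub>C u i k" if "(i, k) \<in> I" for i k
    using u(1)[OF that] by (auto simp: eigenspace1_iff)
  define branch where "branch i k e \<longleftrightarrow> (\<forall>\<^sub>F t in ?F. e t \<in> sp t) \<and> e t\<^sub>0 \<in> sp t\<^sub>0 \<and>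
      (\<lambda>t. e t - z i k t) \<in> o[?F](\<lambda>t. of_real ((t - t\<^sub>0)\<^sup>2))" for i k e
  define ev where "ev i k = (SOME e. branch i k e)" for i k
  have branch: "branch i k (ev i k)" if "(i, k) \<in> I" for i k
    unfolding ev_def
  proof (rule someI_ex[where P = "branch i k"])
    show "\<exists>e. branch i k e"
      unfolding branch_def sp_def z_def by (rule eigenvalue_branch_eigenvector[OF u(1-3)[OF that]])
  qed
  then have ev: "\<And>i k. (i, k) \<in> I \<Longrightarrow> \<forall>\<^sub>F t in ?F. ev i k t \<in> sp t"
    "\<And>i k. (i, k) \<in> I \<Longrightarrow> ev i k t\<^sub>0 \<in> sp t\<^sub>0"
    "\<And>i k. (i, k) \<in> I \<Longrightarrow> (\<lambda>t. ev i k t - z i k t) \<in> o[?F](\<lambda>t. of_real ((t - t\<^sub>0)\<^sup>2))"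
    unfolding branch_def by blast+
  have "\<forall>\<^sub>F t in ?F. \<forall>p\<in>I. ev (fst p) (snd p) t \<in> sp t"
    using finI ev(1) by (intro eventually_ball_finite) auto
  then have "\<forall>\<^sub>F t in ?F. near t \<and> (\<forall>p\<in>I. ev (fst p) (snd p) t \<in> sp t)"
    using eventually_near by eventually_elim simp
  then obtain \<delta> where \<delta>: "\<delta> > 0"
    "\<forall>t\<in>{0..1}. t \<noteq> t\<^sub>0 \<and> dist t t\<^sub>0 < \<delta> \<longrightarrow> near t \<and> (\<forall>p\<in>I. ev (fst p) (snd p) t \<in> sp t)"
    unfolding eventually_at by blast
  \<comment> \<open>The filter excludes \<open>t\<^sub>0\<close>, the neighbourhood in the claim does not.\<close>
  have close: "near t \<and> (\<forall>p\<in>I. ev (fst p) (snd p) t \<in> sp t)" if "t \<in> {0..1}" "\<bar>t - t\<^sub>0\<bar> < \<delta>" for t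
  proof (cases "t = t\<^sub>0")
    case True
    then show ?thesis using near_t0 ev(2) by auto
  next
    case False
    then show ?thesis using \<delta>(2) that by (simp add: dist_real_def)
  qed
  have spW: "sp t = Spec_in (range P\<^sub>0) (W t)" if "t \<in> {0..1}" "near t" for t
    unfolding sp_def W_eq P0_eq by (rule Spec_in_Wt[OF that])
  have part1: "\<exists>\<delta>>0. \<forall>t\<in>{0..1}. \<bar>t - t\<^sub>0\<bar> < \<delta> \<longrightarrow>
      Spec_in (range (blinfun_apply (P t))) (\<lambda>x. uapply (At t) (P t x))
        = Spec_in (range P\<^sub>0) (W t) \<and>
      (\<forall>i\<in>{1..m'}. \<forall>k\<in>{1..mi' i}. ev i k t \<in> Spec_in (range P\<^sub>0) (W t))"
  proof (intro exI[of _ \<delta>] conjI \<delta>(1) ballI impI)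
    fix t assume t: "t \<in> {0..1}" "\<bar>t - t\<^sub>0\<bar> < \<delta>"
    have nt: "near t" using close[OF t] by blast
    show "Spec_in (range (blinfun_apply (P t))) (\<lambda>x. uapply (At t) (P t x))
        = Spec_in (range P\<^sub>0) (W t)"
      using spW[OF t(1) nt] by (simp add: sp_def Pt_eq)
    fix i k assume "i \<in> {1..m'}" "k \<in> {1..mi' i}"
    then have "(i, k) \<in> I" by (simp add: I_def)
    then show "ev i k t \<in> Spec_in (range P\<^sub>0) (W t)"
      using close[OF t] spW[OF t(1) nt] by fastforce
  qed
  have part2: "\<forall>i\<in>{1..m'}. \<forall>k\<in>{1..mi' i}.
      (\<lambda>t. ev i k t - (lam + \<mu> i * of_real (t - t\<^sub>0) + 1/2 * \<nu> i k * of_real ((t - t\<^sub>0)\<^sup>2)))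
        \<in> o[?F](\<lambda>t. of_real ((t - t\<^sub>0)\<^sup>2))"
    using ev(3) unfolding z_def I_def by blast
  have part3: "\<forall>i\<in>{1..m'}. \<forall>k\<in>{1..mi' i}.
      u i k \<in> range (Pi i) \<and> u i k \<in> range P\<^sub>0 \<and>
      (Pi i \<circ> Wdd \<circ> Pi i) (u i k) = \<nu> i k *\<^sub>C u i k \<and>
      Wd (u i k) = \<mu> i *\<^sub>C u i k \<and>
      W t\<^sub>0 (u i k) = lam *\<^sub>C u i k \<and>
      (u i k, lam *\<^sub>C u i k) \<in> At t\<^sub>0"
  proof (intro ballI)
    fix i k assume "i \<in> {1..m'}" "k \<in> {1..mi' i}"
    then have ik: "(i, k) \<in> I" by (simp add: I_def)
    show "u i k \<in> range (Pi i) \<and> u i k \<in> range P\<^sub>0 \<and>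
      (Pi i \<circ> Wdd \<circ> Pi i) (u i k) = \<nu> i k *\<^sub>C u i k \<and>
      Wd (u i k) = \<mu> i *\<^sub>C u i k \<and>
      W t\<^sub>0 (u i k) = lam *\<^sub>C u i k \<and>
      (u i k, lam *\<^sub>C u i k) \<in> At t\<^sub>0"
      unfolding snd_eq ran Wd_eq W_eq
      using u(1,3)[OF ik] uN[OF ik] Wt_t0[OF uN(1)[OF ik]]
      by (simp add: Pi_eq range_proj1 N_iff)
  qed
  have ortho: "\<langle>u i k, u j n\<rangle> = (if i = j \<and> k = n then 1 else 0)" if ik: "(i, k) \<in> I" and jn: "(j, n) \<in> I" for i k j n
  proof -
    consider "i \<noteq> j" | "i = j" "k \<noteq> n" | "i = j" "k = n" by blast
    then show ?thesis
    proof cases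
      case 1
      have "inj_on \<mu> {1..m'}" using \<mu>(2) by (rule bij_betw_imp_inj_on)
      from inj_on_eq_iff[OF this, of i j] have "\<mu> i \<noteq> \<mu> j" using 1 ik jn by (simp add: I_def)
      then have "\<langle>u i k, u j n\<rangle> = 0"
        by (intro hermitian_eigenvectors_orthogonal[OF _ _ uN(2)[OF ik] uN(2)[OF jn]] Wdot_hermitian uN(1) ik jn)
      then show ?thesis using 1 by simp
    next
      case 2
      have "i \<in> {1..m'}" using ik by (simp add: I_def)
      then have "inj_on (\<nu> i) {1..mi' i}" by (rule bij_betw_imp_inj_on[OF \<nu>(2)])
      from inj_on_eq_iff[OF this, of k n] have ne: "\<nu> i k \<noteq> \<nu> i n" using 2 ik jn by (simp add: I_def)
      have in': "(i, n) \<in> I" using jn 2 by simp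
      have "\<langle>u i k, u i n\<rangle> = 0"
        by (rule hermitian_eigenvectors_orthogonal[OF _ _ u(3)[OF ik] u(3)[OF in'] ne])
          (intro second_hermitian u(1) ik in')+
      then show ?thesis using 2 by simp
    next
      case 3
      then show ?thesis using u(2)[OF jn] by (simp add: cinner_self)
    qed
  qed
  have part5: "\<forall>i\<in>{1..m'}. \<forall>k\<in>{1..mi' i}.
      (\<lambda>t. ev i k t -
         (lam + sympl (Qd (T (u i k))) (T (u i k)) * of_real (t - t\<^sub>0)
          + 1/2 * (sympl (Qdd (T (u i k))) (T (u i k))
              - 2 * \<langle>T (cadjoint (T \<circ> S\<^sub>0) (Qd (sympl_J (T (P\<^sub>0 (u i k)))))),
                     Qd (sympl_J (T (P\<^sub>0 (u i k))))\<rangle>)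
            * of_real ((t - t\<^sub>0)\<^sup>2)))
        \<in> o[?F](\<lambda>t. of_real ((t - t\<^sub>0)\<^sup>2))"
  proof (intro ballI)
    fix i k assume ik': "i \<in> {1..m'}" "k \<in> {1..mi' i}"
    then have ik: "(i, k) \<in> I" by (simp add: I_def)
    have P0u: "P\<^sub>0 (u i k) = u i k" unfolding P0_eq by (rule P0_N[OF uN(1)[OF ik]])
    show "(\<lambda>t. ev i k t -
         (lam + sympl (Qd (T (u i k))) (T (u i k)) * of_real (t - t\<^sub>0)
          + 1/2 * (sympl (Qdd (T (u i k))) (T (u i k))
              - 2 * \<langle>T (cadjoint (T \<circ> S\<^sub>0) (Qd (sympl_J (T (P\<^sub>0 (u i k)))))),
                     Qd (sympl_J (T (P\<^sub>0 (u i k))))\<rangle>)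
            * of_real ((t - t\<^sub>0)\<^sup>2)))
        \<in> o[?F](\<lambda>t. of_real ((t - t\<^sub>0)\<^sup>2))"
      unfolding P0u TS_eq coefficients_sympl[OF u(1-3)[OF ik]]
      using part2 ik' by blast
  qed
  show ?thesis
    using part1 part2 part3 part5 ortho
    by (intro exI[of _ ev] exI[of _ u] conjI) (auto simp: I_def)
qed

end
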